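(* Let $\Gamma$ be a finite connected graph homeomorphic to neither $[0,1]$ nor $S^1$. Let $u,v$ be two distinct vertices of $\Gamma$ that are not joined by an edge, and let $\hat\Gamma$ be obtained from $\Gamma$ by adding an edge joining $u$ and $v$. Let $\Gamma_0$ be obtained from $\Gamma$ by removing $u$, $v$ and all edges incident to these vertices. Then there is an exact sequence $$0\to (A+\tau A)\to Q_\Gamma\to Q_{\hat\Gamma}\to G\to 0,$$ where $A\subset Q_\Gamma$ denotes the image of the linking homomorphism $\mathrm{Lk}_{v,u}:H_1(\Gamma_0)\to Q_\Gamma$ and $G$ is a free abelian group of rank $2b_0(\Gamma_0)-2$.
   Context: A graph means a finite 1-dimensional simplicial complex (the auxiliary graph $\Gamma_0$ may have isolated vertices). Homology is with integer coefficients; $b_0(\Gamma_0)$ is the number of connected components of $\Gamma_0$. For $x\in\Gamma$, $\mathrm{supp}\{x\}$ is the closure of the cell containing $x$. $D(\Gamma,2)=\{(x,y)\in\Gamma\times\Gamma:\mathrm{supp}\{x\}\cap\mathrm{supp}\{y\}=\emptyset\}$. $N_\Gamma=\overline{\Gamma\times\Gamma-D(\Gamma,2)}$ is the union of all $e\times e'$ with $e,e'$ closed edges with $e\cap e'\ne\emptyset$, and $\partial N_\Gamma=N_\Gamma\cap D(\Gamma,2)$; by excision $H_2(N_\Gamma,\partial N_\Gamma)=H_2(\Gamma\times\Gamma,D(\Gamma,2))$. The intersection form $I_\Gamma:H_1(\Gamma)\otimes H_1(\Gamma)\to H_2(N_\Gamma,\partial N_\Gamma)$ is the homomorphism $H_2(\Gamma\times\Gamma)\to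 H_2(\Gamma\times\Gamma,D(\Gamma,2))$ composed with the Künneth isomorphism $H_1(\Gamma)\otimes H_1(\Gamma)\cong H_2(\Gamma\times\Gamma)$ and excision; $Q_\Gamma=\mathrm{coker}\, I_\Gamma$ (and $Q_{\hat\Gamma}=\mathrm{coker}\, I_{\hat\Gamma}$). The map $Q_\Gamma\to Q_{\hat\Gamma}$ is induced by the inclusion $\Gamma\to\hat\Gamma$, and $A+\tau A\to Q_\Gamma$ is the inclusion. The involution $\tau(x,y)=(y,x)$ acts on $(\Gamma\times\Gamma,D(\Gamma,2))$ and, since $I_\Gamma(z\otimes z')=-\tau_*I_\Gamma(z'\otimes z)$, induces an involution $\tau$ on $Q_\Gamma$. The linking homomorphism $\mathrm{Lk}_{v,u}:H_1(\Gamma_0)\to Q_\Gamma$: given $z\in H_1(\Gamma_0)$ represented by the cellular cycle $c\in C_1(\Gamma_0)$, choose a chain $a\in C_1(\Gamma)$ with $\partial a=u-v$. The product chain $ac=a\times c\in C_2(\Gamma\times\Gamma)$ satisfies $\partial(ac)=uc-vc\in C_1(D(\Gamma,2))$, so it is a relative cycle of $(\Gamma\times\Gamma,D(\Gamma,2))$; $\mathrm{Lk}_{v,u}(z)$ is the image in $Q_\Gamma$ of its class in $H_2(N_\Gamma,\partial N_\Gamma)$. It does not depend on the choice of $a$. *)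

theory Defs
  imports "HOL-Analysis.Analysis" "HOL-Algebra.Free_Abelian_Groups" "HOL-Algebra.Exact_Sequence"
begin

section \<open>Graphs and their geometric realizations\<close>

text \<open>A graph is a finite abstract simplicial complex of dimension at most one, given by the set of
  its simplices: a vertex is a singleton, an edge a two-element set.\<close>

definition simplicial_graph :: "'a set set \<Rightarrow> bool" where
  "simplicial_graph \<Gamma> \<longleftrightarrow>
     finite \<Gamma> \<and> (\<forall>\<sigma>\<in>\<Gamma>. card \<sigma> = 1 \<or> card \<sigma> = 2) \<and>
     (\<forall>\<sigma>\<in>\<Gamma>. \<forall>\<rho>. \<rho> \<noteq> {} \<and> \<rho> \<subseteq> \<sigma> \<longrightarrow> \<rho> \<in> \<Gamma>)"

text \<open>Points of the realization are given by barycentric coordinates and carry the topology of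
  the function space, which for a finite complex is the usual one.\<close>

definition open_cell :: "'a set \<Rightarrow> ('a \<Rightarrow> real) set" where
  "open_cell \<sigma> = {x. (\<forall>v. 0 \<le> x v) \<and> {v. x v \<noteq> 0} = \<sigma> \<and> sum x \<sigma> = 1}"

definition closed_cell :: "'a set \<Rightarrow> ('a \<Rightarrow> real) set" where
  "closed_cell \<sigma> = closure (open_cell \<sigma>)"

definition realization :: "'a set set \<Rightarrow> ('a \<Rightarrow> real) set" where
  "realization \<Gamma> = (\<Union>\<sigma>\<in>\<Gamma>. open_cell \<sigma>)"

text \<open>A point \<open>x\<close> lies in exactly one open cell, that of the simplex \<open>{v. x v \<noteq> 0}\<close>.\<close>

definition supp :: "('a \<Rightarrow> real) \<Rightarrow> ('a \<Rightarrow> real) set" where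
  "supp x = closed_cell {v. x v \<noteq> 0}"

definition deleted_product :: "'a set set \<Rightarrow> (('a \<Rightarrow> real) \<times> ('a \<Rightarrow> real)) set" where
  "deleted_product \<Gamma> =
     {(x, y). x \<in> realization \<Gamma> \<and> y \<in> realization \<Gamma> \<and> supp x \<inter> supp y = {}}"

text \<open>The number of connected components of the realization (which is finite).\<close>

definition b0 :: "'a set set \<Rightarrow> nat" where
  "b0 \<Gamma> = card (components (realization \<Gamma>))"


section \<open>Cellular homology with integer coefficients\<close>

text \<open>Relative homology \<open>H\<^sub>p(K, L)\<close> of a cell complex \<open>K\<close> and a subcomplex \<open>L\<close>, both given by their
  sets of (oriented) cells, is relative cycles modulo relative boundaries; \<open>deg\<close> is the dimension
  of a cell and \<open>bd\<close> its cellular boundary. This follows the pattern of the library's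
  singular homology. Absolute homology is the case \<open>L = {}\<close>.\<close>

definition cell_chains :: "('c \<Rightarrow> nat) \<Rightarrow> nat \<Rightarrow> 'c set \<Rightarrow> ('c \<Rightarrow>\<^sub>0 int) monoid" where
  "cell_chains deg p K = free_Abelian_group {c \<in> K. deg c = p}"

definition cell_relcycles ::
    "('c \<Rightarrow> nat) \<Rightarrow> ('c \<Rightarrow> ('c \<Rightarrow>\<^sub>0 int)) \<Rightarrow> nat \<Rightarrow> 'c set \<Rightarrow> 'c set \<Rightarrow> ('c \<Rightarrow>\<^sub>0 int) monoid" where
  "cell_relcycles deg bd p K L =
     subgroup_generated (cell_chains deg p K)
       {c \<in> carrier (cell_chains deg p K). Poly_Mapping.keys (frag_extend bd c) \<subseteq> L}"

definition cell_relbds ::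
    "('c \<Rightarrow> nat) \<Rightarrow> ('c \<Rightarrow> ('c \<Rightarrow>\<^sub>0 int)) \<Rightarrow> nat \<Rightarrow> 'c set \<Rightarrow> 'c set \<Rightarrow> ('c \<Rightarrow>\<^sub>0 int) set" where
  "cell_relbds deg bd p K L =
     {frag_extend bd d + l | d l.
        d \<in> carrier (cell_chains deg (Suc p) K) \<and> l \<in> carrier (cell_chains deg p L)}"

definition cell_homology ::
    "('c \<Rightarrow> nat) \<Rightarrow> ('c \<Rightarrow> ('c \<Rightarrow>\<^sub>0 int)) \<Rightarrow> nat \<Rightarrow> 'c set \<Rightarrow> 'c set \<Rightarrow> ('c \<Rightarrow>\<^sub>0 int) set monoid" where
  "cell_homology deg bd p K L = cell_relcycles deg bd p K L Mod cell_relbds deg bd p K L"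

text \<open>The map from a quotient (of \<open>G\<close>) to \<open>H Mod N\<close> induced by \<open>f\<close>: the coset \<open>X\<close> goes to the
  common coset of all \<open>f x\<close>, \<open>x \<in> X\<close>.\<close>

definition induced_map :: "('b, 'm) monoid_scheme \<Rightarrow> 'b set \<Rightarrow> ('a \<Rightarrow> 'b) \<Rightarrow> 'a set \<Rightarrow> 'b set" where
  "induced_map H N f X = (\<Union>x\<in>X. N #>\<^bsub>H\<^esub> f x)"


subsection \<open>The cell complexes \<open>\<Gamma>\<close>, \<open>\<Gamma> \<times> \<Gamma>\<close> and \<open>D(\<Gamma>,2)\<close>\<close>

text \<open>Every edge is oriented by an arbitrary choice of its initial vertex. The choice depends on the
  edge only, so subgraphs carry the restricted orientation.\<close>

definition edge_tail :: "'a set \<Rightarrow> 'a" where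
  "edge_tail e = (SOME x. x \<in> e)"

definition edge_head :: "'a set \<Rightarrow> 'a" where
  "edge_head e = (SOME x. x \<in> e \<and> x \<noteq> edge_tail e)"

definition graph_dim :: "'a set \<Rightarrow> nat" where
  "graph_dim \<sigma> = card \<sigma> - 1"

definition graph_bd :: "'a set \<Rightarrow> ('a set \<Rightarrow>\<^sub>0 int)" where
  "graph_bd \<sigma> =
     (if graph_dim \<sigma> = 1 then frag_of {edge_head \<sigma>} - frag_of {edge_tail \<sigma>} else 0)"

definition cross_chain :: "('c \<Rightarrow>\<^sub>0 int) \<Rightarrow> ('d \<Rightarrow>\<^sub>0 int) \<Rightarrow> ('c \<times> 'd \<Rightarrow>\<^sub>0 int)" where
  "cross_chain a b = frag_extend (\<lambda>\<sigma>. frag_extend (\<lambda>\<tau>. frag_of (\<sigma>, \<tau>)) b) a"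

text \<open>The cell \<open>\<sigma> \<times> \<tau>\<close> with the product orientation is the pair \<open>(\<sigma>, \<tau>)\<close>.\<close>

definition prod_dim :: "'a set \<times> 'a set \<Rightarrow> nat" where
  "prod_dim = (\<lambda>(\<sigma>, \<tau>). graph_dim \<sigma> + graph_dim \<tau>)"

definition prod_bd :: "'a set \<times> 'a set \<Rightarrow> ('a set \<times> 'a set \<Rightarrow>\<^sub>0 int)" where
  "prod_bd = (\<lambda>(\<sigma>, \<tau>).
     cross_chain (graph_bd \<sigma>) (frag_of \<tau>)
     + frag_cmul ((-1) ^ graph_dim \<sigma>) (cross_chain (frag_of \<sigma>) (graph_bd \<tau>)))"

definition deleted_cells :: "'a set set \<Rightarrow> ('a set \<times> 'a set) set" where
  "deleted_cells \<Gamma> =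
     {(\<sigma>, \<tau>) \<in> \<Gamma> \<times> \<Gamma>. closed_cell \<sigma> \<times> closed_cell \<tau> \<subseteq> deleted_product \<Gamma>}"

abbreviation graph_chains :: "nat \<Rightarrow> 'a set set \<Rightarrow> ('a set \<Rightarrow>\<^sub>0 int) monoid" where
  "graph_chains \<equiv> cell_chains graph_dim"

abbreviation H1 :: "'a set set \<Rightarrow> ('a set \<Rightarrow>\<^sub>0 int) set monoid" where
  "H1 \<Gamma> \<equiv> cell_homology graph_dim graph_bd 1 \<Gamma> {}"

abbreviation Z2_prod where
  "Z2_prod \<Gamma> \<equiv> cell_relcycles prod_dim prod_bd 2 (\<Gamma> \<times> \<Gamma>) {}"

abbreviation B2_prod where
  "B2_prod \<Gamma> \<equiv> cell_relbds prod_dim prod_bd 2 (\<Gamma> \<times> \<Gamma>) {}"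

abbreviation H2_prod :: "'a set set \<Rightarrow> ('a set \<times> 'a set \<Rightarrow>\<^sub>0 int) set monoid" where
  "H2_prod \<Gamma> \<equiv> cell_homology prod_dim prod_bd 2 (\<Gamma> \<times> \<Gamma>) {}"

abbreviation Z2_rel where
  "Z2_rel \<Gamma> \<equiv> cell_relcycles prod_dim prod_bd 2 (\<Gamma> \<times> \<Gamma>) (deleted_cells \<Gamma>)"

abbreviation B2_rel where
  "B2_rel \<Gamma> \<equiv> cell_relbds prod_dim prod_bd 2 (\<Gamma> \<times> \<Gamma>) (deleted_cells \<Gamma>)"

text \<open>\<open>H\<^sub>2(\<Gamma> \<times> \<Gamma>, D(\<Gamma>,2))\<close>, which is identified with \<open>H\<^sub>2(N\<^sub>\<Gamma>, \<partial>N\<^sub>\<Gamma>)\<close> by excision.\<close>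

abbreviation H2_rel :: "'a set set \<Rightarrow> ('a set \<times> 'a set \<Rightarrow>\<^sub>0 int) set monoid" where
  "H2_rel \<Gamma> \<equiv> cell_homology prod_dim prod_bd 2 (\<Gamma> \<times> \<Gamma>) (deleted_cells \<Gamma>)"


section \<open>Tensor product of abelian groups\<close>

definition tensor_relations ::
    "('a, 'm) monoid_scheme \<Rightarrow> ('b, 'n) monoid_scheme \<Rightarrow> ('a \<times> 'b \<Rightarrow>\<^sub>0 int) set" where
  "tensor_relations G H =
     {frag_of (x \<otimes>\<^bsub>G\<^esub> x', y) - frag_of (x, y) - frag_of (x', y) | x x' y.
        x \<in> carrier G \<and> x' \<in> carrier G \<and> y \<in> carrier H}
     \<union> {frag_of (x, y \<otimes>\<^bsub>H\<^esub> y') - frag_of (x, y) - frag_of (x, y') | x y y'.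
        x \<in> carrier G \<and> y \<in> carrier H \<and> y' \<in> carrier H}"

definition tensor_group ::
    "('a, 'm) monoid_scheme \<Rightarrow> ('b, 'n) monoid_scheme \<Rightarrow> ('a \<times> 'b \<Rightarrow>\<^sub>0 int) set monoid" where
  "tensor_group G H =
     free_Abelian_group (carrier G \<times> carrier H) Mod
     generate (free_Abelian_group (carrier G \<times> carrier H)) (tensor_relations G H)"

text \<open>The homomorphism from the tensor product to \<open>K\<close> determined by a bilinear map \<open>\<beta>\<close>.\<close>

definition tensor_lift ::
    "('k, 'm) monoid_scheme \<Rightarrow> ('a \<Rightarrow> 'b \<Rightarrow> 'k) \<Rightarrow> ('a \<times> 'b \<Rightarrow>\<^sub>0 int) set \<Rightarrow> 'k" where
  "tensor_lift K \<beta> X =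
     the_elem ((\<lambda>c. finprod K (\<lambda>(x, y). \<beta> x y [^]\<^bsub>K\<^esub> Poly_Mapping.lookup c (x, y))
                      (Poly_Mapping.keys c)) ` X)"


section \<open>The intersection form and its cokernel\<close>

definition homology_cross ::
    "'a set set \<Rightarrow> ('a set \<Rightarrow>\<^sub>0 int) set \<Rightarrow> ('a set \<Rightarrow>\<^sub>0 int) set \<Rightarrow> ('a set \<times> 'a set \<Rightarrow>\<^sub>0 int) set" where
  "homology_cross \<Gamma> Z W = (\<Union>z\<in>Z. \<Union>w\<in>W. B2_prod \<Gamma> #>\<^bsub>Z2_prod \<Gamma>\<^esub> cross_chain z w)"

definition kuenneth where
  "kuenneth \<Gamma> = tensor_lift (H2_prod \<Gamma>) (homology_cross \<Gamma>)"

definition intersection_form ::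
    "'a set set \<Rightarrow> (('a set \<Rightarrow>\<^sub>0 int) set \<times> ('a set \<Rightarrow>\<^sub>0 int) set \<Rightarrow>\<^sub>0 int) set
       \<Rightarrow> ('a set \<times> 'a set \<Rightarrow>\<^sub>0 int) set" where
  "intersection_form \<Gamma> = induced_map (Z2_rel \<Gamma>) (B2_rel \<Gamma>) id \<circ> kuenneth \<Gamma>"

definition intersection_image :: "'a set set \<Rightarrow> ('a set \<times> 'a set \<Rightarrow>\<^sub>0 int) set set" where
  "intersection_image \<Gamma> = intersection_form \<Gamma> ` carrier (tensor_group (H1 \<Gamma>) (H1 \<Gamma>))"

definition Q :: "'a set set \<Rightarrow> ('a set \<times> 'a set \<Rightarrow>\<^sub>0 int) set set monoid" where
  "Q \<Gamma> = H2_rel \<Gamma> Mod intersection_image \<Gamma>"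

text \<open>The map \<open>Q \<Gamma> \<rightarrow> Q \<Gamma>'\<close> induced by a chain map of the pairs \<open>(\<Gamma> \<times> \<Gamma>, D(\<Gamma>,2))\<close> and
  \<open>(\<Gamma>' \<times> \<Gamma>', D(\<Gamma>',2))\<close>; the second group enters only through \<open>\<Gamma>'\<close>.\<close>

definition Q_map ::
    "'a set set \<Rightarrow> (('a set \<times> 'a set \<Rightarrow>\<^sub>0 int) \<Rightarrow> ('a set \<times> 'a set \<Rightarrow>\<^sub>0 int))
       \<Rightarrow> ('a set \<times> 'a set \<Rightarrow>\<^sub>0 int) set set \<Rightarrow> ('a set \<times> 'a set \<Rightarrow>\<^sub>0 int) set set" where
  "Q_map \<Gamma>' f =
     induced_map (H2_rel \<Gamma>') (intersection_image \<Gamma>') (induced_map (Z2_rel \<Gamma>') (B2_rel \<Gamma>') f)"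

text \<open>An inclusion of graphs acts on cellular chains as the identity.\<close>

definition Q_inclusion where
  "Q_inclusion \<Gamma>' = Q_map \<Gamma>' id"

text \<open>The involution \<open>(x, y) \<mapsto> (y, x)\<close> maps \<open>\<sigma> \<times> \<tau>\<close> to \<open>\<tau> \<times> \<sigma>\<close> and reverses the product
  orientation exactly when both factors are edges.\<close>

definition swap_chain :: "('a set \<times> 'a set \<Rightarrow>\<^sub>0 int) \<Rightarrow> ('a set \<times> 'a set \<Rightarrow>\<^sub>0 int)" where
  "swap_chain = frag_extend (\<lambda>(\<sigma>, \<tau>).
     frag_cmul ((-1) ^ (graph_dim \<sigma> * graph_dim \<tau>)) (frag_of (\<tau>, \<sigma>)))"

definition Q_involution where
  "Q_involution \<Gamma> = Q_map \<Gamma> swap_chain"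


section \<open>The linking homomorphism\<close>

definition add_edge :: "'a set set \<Rightarrow> 'a \<Rightarrow> 'a \<Rightarrow> 'a set set" where
  "add_edge \<Gamma> u v = insert {u, v} \<Gamma>"

definition remove_stars :: "'a set set \<Rightarrow> 'a \<Rightarrow> 'a \<Rightarrow> 'a set set" where
  "remove_stars \<Gamma> u v = {\<sigma> \<in> \<Gamma>. u \<notin> \<sigma> \<and> v \<notin> \<sigma>}"

text \<open>The class of a relative cycle in the cokernel.\<close>

definition Q_class :: "'a set set \<Rightarrow> ('a set \<times> 'a set \<Rightarrow>\<^sub>0 int) \<Rightarrow> ('a set \<times> 'a set \<Rightarrow>\<^sub>0 int) set set" where
  "Q_class \<Gamma> c = intersection_image \<Gamma> #>\<^bsub>H2_rel \<Gamma>\<^esub> (B2_rel \<Gamma> #>\<^bsub>Z2_rel \<Gamma>\<^esub> c)"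

definition Lk :: "'a set set \<Rightarrow> 'a \<Rightarrow> 'a \<Rightarrow> ('a set \<Rightarrow>\<^sub>0 int) set \<Rightarrow> ('a set \<times> 'a set \<Rightarrow>\<^sub>0 int) set set" where
  "Lk \<Gamma> v u z =
     (let c = (SOME c. c \<in> z);
          a = (SOME a. a \<in> carrier (graph_chains 1 \<Gamma>) \<and>
                       frag_extend graph_bd a = frag_of {u} - frag_of {v})
      in Q_class \<Gamma> (cross_chain a c))"

definition linking_image where
  "linking_image \<Gamma> v u = Lk \<Gamma> v u ` carrier (H1 (remove_stars \<Gamma> u v))"

text \<open>The subgroup \<open>A + \<tau>A\<close> of \<open>Q \<Gamma>\<close>.\<close>

definition linking_subgroup where
  "linking_subgroup \<Gamma> v u =
     (Q \<Gamma>)\<lparr>carrier := linking_image \<Gamma> v u <#>\<^bsub>Q \<Gamma>\<^esub> (Q_involution \<Gamma> ` linking_image \<Gamma> v u)\<rparr>"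


section \<open>Exactness\<close>

text \<open>Unlike in the library's \<open>exact_seq\<close>, the groups may have elements of different types.\<close>

definition exact_at ::
    "('a, 'm) monoid_scheme \<Rightarrow> ('a \<Rightarrow> 'b) \<Rightarrow> ('b, 'n) monoid_scheme \<Rightarrow> ('b \<Rightarrow> 'c)
       \<Rightarrow> ('c, 'k) monoid_scheme \<Rightarrow> bool" where
  "exact_at F f G g H \<longleftrightarrow>
     group_hom F G f \<and> group_hom G H g \<and> f ` carrier F = kernel G H g"

end

theory Submission
  imports Defs
begin

text \<open>The complex \<open>\<Gamma> \<times> \<Gamma>\<close> has no \<open>3\<close>-cells. Hence a class of \<open>Q\<close> is represented by a \<open>2\<close>-chain of
  \<open>\<Gamma> \<times> \<Gamma>\<close> with boundary in the deleted product \<open>D(\<Gamma>,2)\<close>, a relative cycle, and it vanishes when the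
  chain is the sum of a chain of \<open>D(\<Gamma>,2)\<close> and a cycle of \<open>\<Gamma> \<times> \<Gamma>\<close>, a null cycle: by the Kuenneth
  theorem the latter cycles are the sums of products of \<open>1\<close>-cycles, that is, the image of the
  intersection form (\<open>Q_class_eq_iff\<close>). All maps in the sequence have formulas on chains
  (\<open>Q_map_Q_class\<close>), so exactness becomes a question about chains.

  Let \<open>e\<close> be the new edge. The deleted product of the new graph arises from that of \<open>\<Gamma>\<close> by adding the
  cells of \<open>e \<times> \<Gamma>\<^sub>0\<close> and \<open>\<Gamma>\<^sub>0 \<times> e\<close>, where \<open>\<Gamma>\<^sub>0\<close> is \<open>\<Gamma>\<close> without the stars of \<open>u\<close> and \<open>v\<close>.

  Kernel (\<open>kernel_chains\<close>). Suppose that a relative cycle of \<open>\<Gamma>\<close> becomes a null cycle \<open>d + z\<close> of the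
  new graph. The part of \<open>d\<close> on the new cells is \<open>e \<times> c\<^sub>1 + c\<^sub>2 \<times> e\<close>, and \<open>c\<^sub>1\<close> and \<open>c\<^sub>2\<close> are cycles of
  \<open>\<Gamma>\<^sub>0\<close> because the boundary contains no cell with a factor \<open>e\<close>. Replacing \<open>e\<close> by a chain \<open>a\<close> of
  \<open>\<Gamma>\<close> with the same boundary changes the chain by a cycle and leaves the linking chains \<open>a \<times> c\<^sub>1\<close> and
  \<open>c\<^sub>2 \<times> a\<close>.

  Cokernel (\<open>image_chains\<close>). For a relative cycle \<open>c\<close> of the new graph, the terms of its boundary in
  \<open>e \<times> \<Gamma>\<^sub>0\<close> form a product \<open>e \<times> p\<close>, where \<open>p\<close> is a \<open>0\<close>-chain of \<open>\<Gamma>\<^sub>0\<close> with coefficient sum zero.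
  The coefficient sums over the components, all but one, are \<open>b\<^sub>0(\<Gamma>\<^sub>0) - 1\<close> independent integers, and
  as many come from \<open>\<Gamma>\<^sub>0 \<times> e\<close>. If they all vanish, then a chain of the deleted product removes \<open>e\<close>
  from the boundary of \<open>c\<close>, and the retraction of chains that replaces \<open>e\<close> by a path in \<open>\<Gamma>\<close> shows that
  the class of \<open>c\<close> comes from \<open>\<Gamma>\<close>.

  Surjectivity (\<open>crossing_surjective\<close>). Let \<open>q\<close> be a path in \<open>\<Gamma>\<close> between two components of \<open>\<Gamma>\<^sub>0\<close>.
  The product \<open>e \<times> q\<close> has the required boundary on \<open>e \<times> \<Gamma>\<^sub>0\<close>, but \<open>\<partial>e \<times> q\<close> may meet the diagonal.
  It can be pushed off because \<open>H\<^sub>1(\<Gamma> \<times> \<Gamma>, D(\<Gamma>,2)) = 0\<close> for a connected graph with a branch vertex,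
  a vertex of degree at least three (\<open>deformable_if_relative_cycle\<close>); the argument is local around the
  diagonal. The connected graphs with at least two vertices and no branch vertex are the paths and the
  cycles, whose realizations are intervals and circles (\<open>exists_branch_vertex\<close>).\<close>

section \<open>The topology of the realization\<close>

definition segment :: "('a \<Rightarrow> real) \<Rightarrow> ('a \<Rightarrow> real) \<Rightarrow> real \<Rightarrow> 'a \<Rightarrow> real" where
  "segment x y t = (\<lambda>v. (1 - t) * x v + t * y v)"

definition vertex_point :: "'a \<Rightarrow> 'a \<Rightarrow> real" where
  "vertex_point w = (\<lambda>v. of_bool (v = w))"

text \<open>The closed simplex in barycentric coordinates. Unlike the closure of the open cell it is given by
  conditions that can be checked pointwise.\<close>

definition simplex_points :: "'a set \<Rightarrow> ('a \<Rightarrow> real) set" where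
  "simplex_points \<sigma> = {x. (\<forall>v. 0 \<le> x v) \<and> {v. x v \<noteq> 0} \<subseteq> \<sigma> \<and> sum x \<sigma> = 1}"

lemma simplex_pointsD:
  assumes "x \<in> simplex_points \<sigma>"
  shows "0 \<le> x v" "v \<notin> \<sigma> \<Longrightarrow> x v = 0" "sum x \<sigma> = 1"
  using assms unfolding simplex_points_def by (simp_all, blast)

lemma continuous_on_segment: "continuous_on T (segment x y)"
  unfolding segment_def by (intro continuous_on_coordinatewise_then_product continuous_intros)

lemma segment_in_simplex_points:
  assumes "x \<in> simplex_points \<sigma>" "y \<in> simplex_points \<sigma>" "t \<in> {0..1}"
  shows "segment x y t \<in> simplex_points \<sigma>"
proof -
  have "sum (segment x y t) \<sigma> = (1 - t) * sum x \<sigma> + t * sum y \<sigma>"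
    by (simp add: segment_def sum.distrib sum_distrib_left)
  moreover have "segment x y t v \<ge> 0" for v
    using assms by (simp add: simplex_points_def segment_def)
  moreover have "{v. segment x y t v \<noteq> 0} \<subseteq> \<sigma>"
  proof -
    have "segment x y t v = 0" if "v \<notin> \<sigma>" for v
    proof -
      have "x v = 0" "y v = 0" using assms that by (auto simp: simplex_points_def)
      thus ?thesis by (simp add: segment_def)
    qed
    thus ?thesis by blast
  qed
  ultimately show ?thesis
    using assms by (simp add: simplex_points_def)
qed

lemma continuous_on_coordinate: "continuous_on UNIV (\<lambda>x::'a \<Rightarrow> real. x v)"
  by (rule continuous_on_product_then_coordinatewise) (rule continuous_on_id)

lemma closed_simplex_points: "closed (simplex_points \<sigma>)"
proof -
  have "simplex_points \<sigma>
      = (\<Inter>v. {x. 0 \<le> x v}) \<inter> (\<Inter>v\<in>-\<sigma>. {x. x v = 0}) \<inter> {x. sum x \<sigma> = 1}"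
    by (auto simp: simplex_points_def)
  moreover have "closed \<dots>"
    by (intro closed_Int closed_INT ballI closed_Collect_le closed_Collect_eq
        continuous_on_coordinate continuous_on_sum continuous_on_const)
  ultimately show ?thesis by simp
qed

lemma open_cell_subset_simplex_points: "open_cell \<sigma> \<subseteq> simplex_points \<sigma>"
  by (auto simp: open_cell_def simplex_points_def)

lemma simplex_points_in_open_cell:
  "x \<in> simplex_points \<sigma> \<Longrightarrow> (\<And>v. v \<in> \<sigma> \<Longrightarrow> x v \<noteq> 0) \<Longrightarrow> x \<in> open_cell \<sigma>"
  by (auto simp: simplex_points_def open_cell_def)

text \<open>Moving a point of the closed simplex towards the barycentre enters the open cell at once.\<close>

lemma closed_cell_eq:
  assumes "finite \<sigma>" "\<sigma> \<noteq> {}"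
  shows "closed_cell \<sigma> = simplex_points \<sigma>"
proof
  show "closed_cell \<sigma> \<subseteq> simplex_points \<sigma>"
    unfolding closed_cell_def
    by (rule closure_minimal[OF open_cell_subset_simplex_points closed_simplex_points])
next
  define b :: "'a \<Rightarrow> real" where "b = (\<lambda>v. if v \<in> \<sigma> then 1 / card \<sigma> else 0)"
  have card: "card \<sigma> > 0" using assms by (simp add: card_gt_0_iff)
  have b: "b \<in> simplex_points \<sigma>" using assms card by (auto simp: b_def simplex_points_def)
  show "simplex_points \<sigma> \<subseteq> closed_cell \<sigma>"
  proof
    fix x assume x: "x \<in> simplex_points \<sigma>"
    have "segment x b t \<in> open_cell \<sigma>" if "t \<in> {0<..1}" for t
    proof -
      have s: "segment x b t \<in> simplex_points \<sigma>"
        using that by (intro segment_in_simplex_points x b) auto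
      have pos: "segment x b t v \<noteq> 0" if "v \<in> \<sigma>" for v
      proof -
        have "0 \<le> (1 - t) * x v" "0 < t * b v"
          using \<open>t \<in> {0<..1}\<close> x card that by (simp_all add: b_def simplex_points_def)
        thus ?thesis by (simp add: segment_def)
      qed
      show ?thesis using pos by (intro simplex_points_in_open_cell[OF s])
    qed
    hence "segment x b ` closure {0<..1} \<subseteq> closed_cell \<sigma>"
      unfolding closed_cell_def
      by (intro image_closure_subset continuous_on_segment) (auto intro: closure_subset[THEN subsetD])
    moreover have "segment x b 0 = x" by (simp add: segment_def)
    moreover have "(0::real) \<in> closure {0<..1}" by simp
    ultimately show "x \<in> closed_cell \<sigma>" by (metis image_subset_iff)
  qed
qed

lemma vertex_point_in_simplex_points:
  "finite \<sigma> \<Longrightarrow> w \<in> \<sigma> \<Longrightarrow> vertex_point w \<in> simplex_points \<sigma>"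
  by (auto simp: vertex_point_def simplex_points_def)

lemma simplex_points_mono:
  assumes "finite \<tau>" "\<sigma> \<subseteq> \<tau>" "x \<in> simplex_points \<sigma>"
  shows "x \<in> simplex_points \<tau>"
proof -
  have "sum x \<sigma> = sum x \<tau>"
    using assms by (intro sum.mono_neutral_left) (auto simp: simplex_points_def)
  with assms show ?thesis by (auto simp: simplex_points_def)
qed

lemma connected_simplex_points: "connected (simplex_points \<sigma>)"
proof (rule path_connected_imp_connected, unfold path_connected_def, intro ballI)
  fix x y assume "x \<in> simplex_points \<sigma>" "y \<in> simplex_points \<sigma>"
  thus "\<exists>g. path g \<and> path_image g \<subseteq> simplex_points \<sigma> \<and> pathstart g = x \<and> pathfinish g = y"
    by (intro exI[of _ "segment x y"])
       (auto simp: path_def path_image_def pathstart_def pathfinish_def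
         intro: continuous_on_segment segment_in_simplex_points, auto simp: segment_def)
qed

subsection \<open>Finite graphs\<close>

lemma simplicial_graph_finite_simplex:
  assumes "simplicial_graph \<Gamma>" "\<sigma> \<in> \<Gamma>"
  shows "finite \<sigma>" "\<sigma> \<noteq> {}"
  using assms unfolding simplicial_graph_def by (metis card.infinite zero_neq_one zero_neq_numeral, force)

lemma simplicial_graph_face:
  "simplicial_graph \<Gamma> \<Longrightarrow> \<sigma> \<in> \<Gamma> \<Longrightarrow> \<rho> \<subseteq> \<sigma> \<Longrightarrow> \<rho> \<noteq> {} \<Longrightarrow> \<rho> \<in> \<Gamma>"
  unfolding simplicial_graph_def by blast

lemma simplex_points_support:
  assumes "x \<in> simplex_points \<sigma>" "finite \<sigma>"
  shows "{v. x v \<noteq> 0} \<noteq> {}" "x \<in> open_cell {v. x v \<noteq> 0}"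
proof -
  show "{v. x v \<noteq> 0} \<noteq> {}"
  proof
    assume "{v. x v \<noteq> 0} = {}"
    hence "x v = 0" for v by blast
    hence "sum x \<sigma> = 0" by simp
    thus False using assms by (simp add: simplex_points_def)
  qed
  have "sum x {v. x v \<noteq> 0} = sum x \<sigma>"
    using assms by (intro sum.mono_neutral_left) (auto simp: simplex_points_def)
  thus "x \<in> open_cell {v. x v \<noteq> 0}" using assms by (auto simp: open_cell_def simplex_points_def)
qed

lemma realization_eq:
  assumes "simplicial_graph \<Gamma>"
  shows "realization \<Gamma> = (\<Union>\<sigma>\<in>\<Gamma>. simplex_points \<sigma>)"
proof
  show "realization \<Gamma> \<subseteq> (\<Union>\<sigma>\<in>\<Gamma>. simplex_points \<sigma>)"
    unfolding realization_def using open_cell_subset_simplex_points by blast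
  show "(\<Union>\<sigma>\<in>\<Gamma>. simplex_points \<sigma>) \<subseteq> realization \<Gamma>"
  proof
    fix x assume "x \<in> (\<Union>\<sigma>\<in>\<Gamma>. simplex_points \<sigma>)"
    then obtain \<sigma> where s: "\<sigma> \<in> \<Gamma>" "x \<in> simplex_points \<sigma>" by blast
    note fin = simplicial_graph_finite_simplex[OF assms s(1)]
    have "{v. x v \<noteq> 0} \<in> \<Gamma>"
      using s simplex_points_support(1)[OF s(2) fin(1)] simplicial_graph_face[OF assms s(1)]
      by (auto simp: simplex_points_def)
    with simplex_points_support(2)[OF s(2) fin(1)] show "x \<in> realization \<Gamma>"
      unfolding realization_def by blast
  qed
qed

text \<open>A common vertex of the factors is a point of both closed cells. Conversely, the support of a point
  of a closed cell uses only vertices of that cell, so disjoint factors have disjoint supports.\<close>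

lemma deleted_cells_eq:
  assumes "simplicial_graph \<Gamma>"
  shows "deleted_cells \<Gamma> = {(\<sigma>, \<tau>) \<in> \<Gamma> \<times> \<Gamma>. \<sigma> \<inter> \<tau> = {}}"
proof -
  have "closed_cell \<sigma> \<times> closed_cell \<tau> \<subseteq> deleted_product \<Gamma> \<longleftrightarrow> \<sigma> \<inter> \<tau> = {}"
    if "\<sigma> \<in> \<Gamma>" "\<tau> \<in> \<Gamma>" for \<sigma> \<tau>
  proof
    note fs = simplicial_graph_finite_simplex[OF assms \<open>\<sigma> \<in> \<Gamma>\<close>]
    note ft = simplicial_graph_finite_simplex[OF assms \<open>\<tau> \<in> \<Gamma>\<close>]
    have barycentre: "\<exists>x. x \<in> open_cell \<rho>" if "finite \<rho>" "\<rho> \<noteq> {}" for \<rho> :: "'a set"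
      using that by (intro exI[of _ "\<lambda>v. if v \<in> \<rho> then 1 / card \<rho> else 0"]) (auto simp: open_cell_def)
    have supp_open: "supp x = closed_cell \<rho>" if "x \<in> open_cell \<rho>" for x :: "'a \<Rightarrow> real" and \<rho>
      using that by (simp add: supp_def open_cell_def)
    {
      assume sub: "closed_cell \<sigma> \<times> closed_cell \<tau> \<subseteq> deleted_product \<Gamma>"
      obtain x y where xy: "x \<in> open_cell \<sigma>" "y \<in> open_cell \<tau>"
        using barycentre[OF fs] barycentre[OF ft] by (elim exE)
      hence "x \<in> closed_cell \<sigma>" "y \<in> closed_cell \<tau>"
        unfolding closed_cell_def by (meson closure_subset subsetD)+
      hence "(x, y) \<in> deleted_product \<Gamma>" using sub by blast
      hence "supp x \<inter> supp y = {}" by (simp add: deleted_product_def)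
      hence "simplex_points \<sigma> \<inter> simplex_points \<tau> = {}"
        by (simp only: supp_open[OF xy(1)] supp_open[OF xy(2)] closed_cell_eq[OF fs] closed_cell_eq[OF ft])
      thus "\<sigma> \<inter> \<tau> = {}" 
        using vertex_point_in_simplex_points[OF fs(1)] vertex_point_in_simplex_points[OF ft(1)] by blast
    }
    {
      assume disj: "\<sigma> \<inter> \<tau> = {}"
      show "closed_cell \<sigma> \<times> closed_cell \<tau> \<subseteq> deleted_product \<Gamma>"
      proof clarify
        fix x y assume xy: "x \<in> closed_cell \<sigma>" "y \<in> closed_cell \<tau>"
        hence x: "x \<in> simplex_points \<sigma>" and y: "y \<in> simplex_points \<tau>"
          by (simp_all add: closed_cell_eq fs ft)
        let ?X = "{v. x v \<noteq> 0}" and ?Y = "{v. y v \<noteq> 0}"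
        have X: "?X \<subseteq> \<sigma>" "?Y \<subseteq> \<tau>" using x y by (auto simp: simplex_points_def)
        hence "finite ?X" "finite ?Y" using finite_subset[OF _ fs(1)] finite_subset[OF _ ft(1)] by simp_all
        moreover have "?X \<noteq> {}" "?Y \<noteq> {}"
          using simplex_points_support(1)[OF x fs(1)] simplex_points_support(1)[OF y ft(1)] by simp_all
        ultimately have "supp x = simplex_points ?X" "supp y = simplex_points ?Y"
          by (simp_all add: supp_def closed_cell_eq)
        moreover have "simplex_points ?X \<inter> simplex_points ?Y = {}"
        proof (rule equals0I)
          fix z assume z: "z \<in> simplex_points ?X \<inter> simplex_points ?Y"
          hence "{v. z v \<noteq> 0} \<subseteq> \<sigma> \<inter> \<tau>" using X by (auto simp: simplex_points_def)
          with disj have "{v. z v \<noteq> 0} = {}" by blast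
          thus False using simplex_points_support(1)[of z ?X] z \<open>finite ?X\<close> by auto
        qed
        ultimately show "(x, y) \<in> deleted_product \<Gamma>"
          using x y that by (auto simp: deleted_product_def realization_eq[OF assms])
      qed
    }
  qed
  thus ?thesis unfolding deleted_cells_def by blast
qed

subsection \<open>Components\<close>

text \<open>In the relation below a step may also stay at a vertex, since \<open>{x, x} = {x}\<close>.\<close>

definition reachable :: "'a set set \<Rightarrow> ('a \<times> 'a) set" where
  "reachable \<Gamma> = {(x, y). {x, y} \<in> \<Gamma>}\<^sup>*"

definition vertices :: "'a set set \<Rightarrow> 'a set" where
  "vertices \<Gamma> = {x. {x} \<in> \<Gamma>}"

definition vertex_classes :: "'a set set \<Rightarrow> 'a set set" where
  "vertex_classes \<Gamma> = (\<lambda>w. reachable \<Gamma> `` {w}) ` vertices \<Gamma>"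

lemma sym_reachable: "sym (reachable \<Gamma>)"
  unfolding reachable_def by (rule sym_rtrancl) (auto simp: sym_def insert_commute)

lemma reachable_class_eq_iff:
  "reachable \<Gamma> `` {x} = reachable \<Gamma> `` {y} \<longleftrightarrow> (x, y) \<in> reachable \<Gamma>"
proof -
  have "trans (reachable \<Gamma>)" "refl (reachable \<Gamma>)"
    unfolding reachable_def by (simp_all add: trans_rtrancl refl_rtrancl)
  hence "equiv UNIV (reachable \<Gamma>)" using sym_reachable by (intro equivI) auto
  thus ?thesis by (simp add: eq_equiv_class_iff)
qed

lemma reachable_vertices:
  assumes "simplicial_graph \<Gamma>" "(x, y) \<in> reachable \<Gamma>" "x \<in> vertices \<Gamma>"
  shows "y \<in> vertices \<Gamma>"
  using assms(2,3) unfolding reachable_def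
  by (induction) (auto simp: vertices_def intro: simplicial_graph_face[OF assms(1)])

lemma finite_vertices:
  assumes "simplicial_graph \<Gamma>" shows "finite (vertices \<Gamma>)"
proof -
  have "finite ((\<lambda>x. {x}) ` vertices \<Gamma>)"
    using assms by (auto simp: simplicial_graph_def vertices_def intro: finite_subset[rotated])
  thus ?thesis by (rule finite_imageD) (auto simp: inj_on_def)
qed

text \<open>The realization of the full subgraph spanned by \<open>W\<close>.\<close>

definition class_points :: "'a set set \<Rightarrow> 'a set \<Rightarrow> ('a \<Rightarrow> real) set" where
  "class_points \<Gamma> W = (\<Union>\<sigma>\<in>{\<sigma>\<in>\<Gamma>. \<sigma> \<subseteq> W}. simplex_points \<sigma>)"

lemma closed_class_points: "simplicial_graph \<Gamma> \<Longrightarrow> closed (class_points \<Gamma> W)"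
  unfolding class_points_def
  by (rule closed_UN) (simp_all add: simplicial_graph_def closed_simplex_points)

lemma vertex_point_in_class_points:
  assumes "simplicial_graph \<Gamma>" "w \<in> vertices \<Gamma>"
  shows "vertex_point w \<in> class_points \<Gamma> W \<longleftrightarrow> w \<in> W"
proof
  assume "vertex_point w \<in> class_points \<Gamma> W"
  then obtain \<sigma> where "\<sigma> \<subseteq> W" "vertex_point w \<in> simplex_points \<sigma>" by (auto simp: class_points_def)
  thus "w \<in> W" by (auto simp: simplex_points_def vertex_point_def)
next
  assume "w \<in> W"
  thus "vertex_point w \<in> class_points \<Gamma> W"
    using assms vertex_point_in_simplex_points[of "{w}" w] by (auto simp: class_points_def vertices_def)
qed

lemma connected_component_simplex_points:
  assumes "simplicial_graph \<Gamma>" "\<sigma> \<in> \<Gamma>" "x \<in> simplex_points \<sigma>" "y \<in> simplex_points \<sigma>"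
  shows "connected_component (realization \<Gamma>) x y"
  unfolding connected_component_def
  using assms connected_simplex_points[of \<sigma>]
  by (intro exI[of _ "simplex_points \<sigma>"]) (auto simp: realization_eq)

lemma vertex_point_in_realization:
  assumes "simplicial_graph \<Gamma>" "w \<in> vertices \<Gamma>"
  shows "vertex_point w \<in> realization \<Gamma>"
  using assms(2) vertex_point_in_simplex_points[of "{w}" w]
  by (auto simp: realization_eq[OF assms(1)] vertices_def)

text \<open>The points over a reachability class and those over its complement are disjoint closed sets,
  so the former contain the component.\<close>

lemma connected_component_vertex_point:
  assumes "simplicial_graph \<Gamma>" "w \<in> vertices \<Gamma>"
  shows "connected_component_set (realization \<Gamma>) (vertex_point w)
      = class_points \<Gamma> (reachable \<Gamma> `` {w})"
proof
  let ?C = "connected_component_set (realization \<Gamma>) (vertex_point w)"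
  define W where "W = reachable \<Gamma> `` {w}"
  have "w \<in> W" by (simp add: W_def reachable_def)
  hence w: "vertex_point w \<in> class_points \<Gamma> W"
    by (simp add: assms vertex_point_in_class_points)
  have step: "y \<in> W" if "x \<in> W" "{x, y} \<in> \<Gamma>" for x y
    using that unfolding W_def reachable_def
    by (auto intro: rtrancl.rtrancl_into_rtrancl)
  have split: "\<sigma> \<subseteq> W \<or> \<sigma> \<subseteq> - W" if "\<sigma> \<in> \<Gamma>" for \<sigma>
  proof (rule ccontr)
    assume "\<not> (\<sigma> \<subseteq> W \<or> \<sigma> \<subseteq> - W)"
    then obtain x y where xy: "x \<in> \<sigma>" "x \<in> W" "y \<in> \<sigma>" "y \<notin> W" by blast
    hence "{x, y} \<in> \<Gamma>" using simplicial_graph_face[OF assms(1) that, of "{x, y}"] by simp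
    with step xy show False by blast
  qed
  have cover: "realization \<Gamma> \<subseteq> class_points \<Gamma> W \<union> class_points \<Gamma> (- W)"
  proof
    fix x assume "x \<in> realization \<Gamma>"
    then obtain \<sigma> where "\<sigma> \<in> \<Gamma>" "x \<in> simplex_points \<sigma>" by (auto simp: realization_eq[OF assms(1)])
    with split[of \<sigma>] show "x \<in> class_points \<Gamma> W \<union> class_points \<Gamma> (- W)"
      unfolding class_points_def by blast
  qed
  have disj: "class_points \<Gamma> W \<inter> class_points \<Gamma> (- W) = {}"
  proof (rule equals0I, elim IntE)
    fix x assume x: "x \<in> class_points \<Gamma> W" "x \<in> class_points \<Gamma> (- W)"
    obtain \<sigma> where s: "\<sigma> \<in> \<Gamma>" "\<sigma> \<subseteq> W" "x \<in> simplex_points \<sigma>"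
      using x(1) unfolding class_points_def by blast
    obtain \<tau> where t: "\<tau> \<subseteq> - W" "x \<in> simplex_points \<tau>"
      using x(2) unfolding class_points_def by blast
    have "{v. x v \<noteq> 0} \<subseteq> \<sigma>" "{v. x v \<noteq> 0} \<subseteq> \<tau>" using s(3) t(2) by (simp_all add: simplex_points_def)
    moreover have "{v. x v \<noteq> 0} \<noteq> {}"
      by (rule simplex_points_support(1)[OF s(3) simplicial_graph_finite_simplex(1)[OF assms(1) s(1)]])
    ultimately show False using s(2) t(1) by blast
  qed
  have sub: "?C \<subseteq> class_points \<Gamma> W"
  proof -
    have C: "connected ?C" "?C \<subseteq> realization \<Gamma>" "vertex_point w \<in> ?C"
      by (simp_all add: connected_component_subset connected_component_refl_eq
            vertex_point_in_realization assms)
    have "class_points \<Gamma> W \<inter> ?C = {} \<or> class_points \<Gamma> (- W) \<inter> ?C = {}"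
      using disj cover C(2) closed_class_points[OF assms(1)] by (intro connected_closedD C(1)) auto
    thus ?thesis using C(2,3) cover w by blast
  qed
  have reach: "vertex_point y \<in> ?C" if "(w, y) \<in> reachable \<Gamma>" for y
    using that unfolding reachable_def
  proof (induction)
    case base
    show ?case by (simp add: connected_component_refl_eq vertex_point_in_realization assms)
  next
    case (step y z)
    have "connected_component (realization \<Gamma>) (vertex_point y) (vertex_point z)"
      using step(2) vertex_point_in_simplex_points[of "{y, z}"]
      by (intro connected_component_simplex_points[OF assms(1), of "{y, z}"]) auto
    with step(3) show ?case by (auto intro: connected_component_trans)
  qed
  have "class_points \<Gamma> W \<subseteq> ?C"
  proof
    fix x assume "x \<in> class_points \<Gamma> W"
    then obtain \<sigma> where s: "\<sigma> \<in> \<Gamma>" "\<sigma> \<subseteq> W" "x \<in> simplex_points \<sigma>"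
      unfolding class_points_def by blast
    note fin = simplicial_graph_finite_simplex[OF assms(1) s(1)]
    then obtain y where y: "y \<in> \<sigma>" by blast
    have "connected_component (realization \<Gamma>) (vertex_point y) x"
      by (rule connected_component_simplex_points[OF assms(1) s(1)
            vertex_point_in_simplex_points[OF fin(1) y] s(3)])
    moreover have "vertex_point y \<in> ?C"
      using s(2) y by (intro reach) (auto simp: W_def)
    ultimately show "x \<in> ?C" by (auto intro: connected_component_trans)
  qed
  with sub show "?C \<subseteq> class_points \<Gamma> (reachable \<Gamma> `` {w})" "class_points \<Gamma> (reachable \<Gamma> `` {w}) \<subseteq> ?C"
    by (simp_all only: W_def)
qed

lemma components_realization:
  assumes "simplicial_graph \<Gamma>"
  shows "components (realization \<Gamma>) = class_points \<Gamma> ` vertex_classes \<Gamma>"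
proof -
  let ?comp = "connected_component_set (realization \<Gamma>)"
  have "\<exists>w\<in>vertices \<Gamma>. ?comp x = ?comp (vertex_point w)" if x: "x \<in> realization \<Gamma>" for x
  proof -
    obtain \<sigma> where s: "\<sigma> \<in> \<Gamma>" "x \<in> simplex_points \<sigma>" using x by (auto simp: realization_eq[OF assms])
    note fin = simplicial_graph_finite_simplex[OF assms s(1)]
    then obtain y where y: "y \<in> \<sigma>" by blast
    have "connected_component (realization \<Gamma>) x (vertex_point y)"
      by (rule connected_component_simplex_points[OF assms s
            vertex_point_in_simplex_points[OF fin(1) y]])
    hence "?comp (vertex_point y) = ?comp x" by (simp add: connected_component_eq)
    moreover have "y \<in> vertices \<Gamma>"
      using y simplicial_graph_face[OF assms s(1), of "{y}"] by (simp add: vertices_def)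
    ultimately show ?thesis by metis
  qed
  hence "?comp ` realization \<Gamma> \<subseteq> ?comp ` vertex_point ` vertices \<Gamma>" by blast
  moreover have "vertex_point ` vertices \<Gamma> \<subseteq> realization \<Gamma>"
    using vertex_point_in_realization[OF assms] by blast
  ultimately have "components (realization \<Gamma>) = ?comp ` vertex_point ` vertices \<Gamma>"
    unfolding components_def by (metis image_mono subset_antisym)
  thus ?thesis
    unfolding vertex_classes_def image_image
    using connected_component_vertex_point[OF assms] by simp
qed

text \<open>The vertices of \<open>class_points \<Gamma> W\<close> recover \<open>W\<close>, so different classes give different components.\<close>

lemma b0_eq:
  assumes "simplicial_graph \<Gamma>"
  shows "b0 \<Gamma> = card (vertex_classes \<Gamma>)"
proof -
  have "inj_on (class_points \<Gamma>) (vertex_classes \<Gamma>)"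
  proof (rule inj_onI)
    fix W W' assume W: "W \<in> vertex_classes \<Gamma>" "W' \<in> vertex_classes \<Gamma>"
      and eq: "class_points \<Gamma> W = class_points \<Gamma> W'"
    have "W \<subseteq> vertices \<Gamma>" "W' \<subseteq> vertices \<Gamma>"
      using W reachable_vertices[OF assms] by (auto simp: vertex_classes_def)
    thus "W = W'" using eq vertex_point_in_class_points[OF assms] by blast
  qed
  thus ?thesis unfolding b0_def components_realization[OF assms] by (rule card_image)
qed

lemma reachable_if_connected:
  assumes "simplicial_graph \<Gamma>" "connected (realization \<Gamma>)" "x \<in> vertices \<Gamma>" "y \<in> vertices \<Gamma>"
  shows "(x, y) \<in> reachable \<Gamma>"
proof -
  have "connected_component_set (realization \<Gamma>) (vertex_point x) = realization \<Gamma>"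
    using assms by (simp add: connected_component_eq_self vertex_point_in_realization)
  hence "vertex_point y \<in> class_points \<Gamma> (reachable \<Gamma> `` {x})"
    using assms by (simp add: vertex_point_in_realization flip: connected_component_vertex_point)
  thus ?thesis by (simp add: vertex_point_in_class_points assms)
qed

section \<open>Graphs without a branch vertex\<close>

definition neighbours :: "'a set set \<Rightarrow> 'a \<Rightarrow> 'a set" where
  "neighbours \<Gamma> x = {y. y \<noteq> x \<and> {x, y} \<in> \<Gamma>}"

text \<open>A cycle is the case \<open>p n = p 0\<close>, so that paths and cycles are treated together.\<close>

definition path_complex :: "(nat \<Rightarrow> 'a) \<Rightarrow> nat \<Rightarrow> 'a set set" where
  "path_complex p n = {{p i} | i. i \<le> n} \<union> {{p i, p (Suc i)} | i. i < n}"

text \<open>A closed walk needs three edges: the edges are sets, so a closed walk of length two would run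
  through the same edge twice.\<close>

definition simple_walk :: "(nat \<Rightarrow> 'a) \<Rightarrow> nat \<Rightarrow> bool" where
  "simple_walk p n \<longleftrightarrow>
     n \<ge> 1 \<and> inj_on p {..<n} \<and> inj_on p {1..n} \<and> (p 0 = p n \<longrightarrow> n \<ge> 3)"

text \<open>Piecewise linear parametrization at unit speed by \<open>[0, n]\<close>. Written as a sum of tent functions it
  is visibly continuous, and \<open>walk_point_eq\<close> shows that it follows the edges one after another.\<close>

definition walk_point :: "(nat \<Rightarrow> 'a) \<Rightarrow> nat \<Rightarrow> real \<Rightarrow> 'a \<Rightarrow> real" where
  "walk_point p n s = (\<lambda>v. \<Sum>i\<le>n. of_bool (v = p i) * max 0 (1 - \<bar>s - real i\<bar>))"

lemma walk_point_eq:
  assumes "k < n" "0 \<le> r" "r \<le> 1"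
  shows "walk_point p n (real k + r) = segment (vertex_point (p k)) (vertex_point (p (Suc k))) r"
proof
  fix v
  have "max 0 (1 - \<bar>real k + r - real i\<bar>) = (if i = k then 1 - r else if i = Suc k then r else 0)" for i
  proof -
    consider "i = k" | "i = Suc k" | "i < k" | "i > Suc k" by linarith
    thus ?thesis
    proof cases
      case 3
      hence "real i + 1 \<le> real k" by linarith
      with 3 show ?thesis using assms by (auto simp: max_def)
    next
      case 4
      hence "real k + 2 \<le> real i" by linarith
      with 4 show ?thesis using assms by (auto simp: max_def)
    qed (use assms in \<open>auto simp: max_def\<close>)
  qed
  hence "walk_point p n (real k + r) v
      = (\<Sum>i\<le>n. (if i = k then of_bool (v = p i) * (1 - r) else 0)
             + (if i = Suc k then of_bool (v = p i) * r else 0))"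
    unfolding walk_point_def by (intro sum.cong) auto
  also have "\<dots> = of_bool (v = p k) * (1 - r) + of_bool (v = p (Suc k)) * r"
    using assms by (simp add: sum.distrib)
  finally show "walk_point p n (real k + r) v
      = segment (vertex_point (p k)) (vertex_point (p (Suc k))) r v"
    by (simp add: segment_def vertex_point_def)
qed

lemma simple_walk_eqD:
  assumes "simple_walk p n" "i \<le> n" "j \<le> n" "p i = p j"
  shows "i = j \<or> i = 0 \<and> j = n \<or> i = n \<and> j = 0"
proof (cases "i < n \<and> j < n \<or> 1 \<le> i \<and> 1 \<le> j")
  case True
  have inj: "inj_on p {..<n}" "inj_on p {1..n}" using assms(1) by (simp_all add: simple_walk_def)
  from True have "i \<in> {..<n} \<and> j \<in> {..<n} \<or> i \<in> {1..n} \<and> j \<in> {1..n}" using assms(2,3) by auto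
  hence "i = j" using inj_onD[OF inj(1) assms(4)] inj_onD[OF inj(2) assms(4)] by blast
  thus ?thesis ..
qed (use assms in auto)

lemma segment_vertex_point:
  "a \<noteq> b \<Longrightarrow> segment (vertex_point a) (vertex_point b) r v
      = (if v = a then 1 - r else if v = b then r else 0)"
  by (auto simp: segment_def vertex_point_def)

text \<open>Points on different edges agree only in a common end. Comparing the coordinates at the ends of both
  edges, either the edges are consecutive or they close up the walk.\<close>

lemma walk_point_inj_less:
  assumes w: "simple_walk p n" and kl: "k < l" "l < n" and r: "0 \<le> r" "r \<le> 1" "0 \<le> s" "s \<le> 1"
    and eq: "walk_point p n (real k + r) = walk_point p n (real l + s)"
  shows "real k + r = real l + s \<or> real k + r = 0 \<and> real l + s = real n \<and> p 0 = p n"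
proof -
  note inj = simple_walk_eqD[OF w]
  have ne: "p k \<noteq> p (Suc k)" "p l \<noteq> p (Suc l)" "p k \<noteq> p l" "p (Suc k) \<noteq> p (Suc l)"
    using inj[of k "Suc k"] inj[of l "Suc l"] inj[of k l] inj[of "Suc k" "Suc l"] kl by auto
  have v: "(if v = p k then 1 - r else if v = p (Suc k) then r else 0)
      = (if v = p l then 1 - s else if v = p (Suc l) then s else 0)" for v
    using fun_cong[OF eq, of v] kl r by (simp add: walk_point_eq segment_vertex_point ne)
  show ?thesis
  proof (cases "p k = p (Suc l)")
    case True
    hence *: "k = 0" "Suc l = n" "p 0 = p n" using inj[of k "Suc l"] kl by auto
    hence "n \<ge> 3" using w by (simp add: simple_walk_def)
    hence "p (Suc k) \<noteq> p l" using inj[of "Suc k" l] kl * by auto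
    hence "r = 0" "s = 1" using v[of "p (Suc k)"] v[of "p l"] ne True by auto
    with * show ?thesis by auto
  next
    case False
    hence "r = 1" using v[of "p k"] ne by auto
    moreover from this have l: "p (Suc k) = p l" using v[of "p (Suc k)"] ne by (auto split: if_splits)
    moreover have "s = 0" using v[of "p (Suc l)"] ne False by auto
    moreover have "Suc k = l" using l inj[of "Suc k" l] kl by auto
    ultimately show ?thesis by auto
  qed
qed

lemma param_floor:
  assumes "0 \<le> s" "s \<le> real n" "n \<ge> 1"
  obtains k r where "k < n" "0 \<le> r" "r \<le> 1" "s = real k + r"
proof (cases "s = real n")
  case True
  thus ?thesis using that[of "n - 1" 1] assms by auto
next
  case False
  have "nat \<lfloor>s\<rfloor> < n" using assms False by linarith
  moreover have "s - real (nat \<lfloor>s\<rfloor>) \<ge> 0" "s - real (nat \<lfloor>s\<rfloor>) \<le> 1" using assms by linarith+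
  ultimately show ?thesis using that[of "nat \<lfloor>s\<rfloor>" "s - real (nat \<lfloor>s\<rfloor>)"] by auto
qed

lemma walk_point_inj:
  assumes w: "simple_walk p n" and s: "s \<in> {0..real n}" "t \<in> {0..real n}"
    and eq: "walk_point p n s = walk_point p n t"
  shows "s = t \<or> p 0 = p n \<and> (s = 0 \<and> t = real n \<or> s = real n \<and> t = 0)"
proof -
  have n: "n \<ge> 1" using w by (simp add: simple_walk_def)
  obtain k r where k: "k < n" "0 \<le> r" "r \<le> 1" "s = real k + r" using param_floor[of s n] s n by auto
  obtain l q where l: "l < n" "0 \<le> q" "q \<le> 1" "t = real l + q" using param_floor[of t n] s n by auto
  consider "k < l" | "l < k" | "k = l" by linarith
  thus ?thesis
  proof cases
    case 1
    thus ?thesis using walk_point_inj_less[OF w, of k l r q] k l eq by auto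
  next
    case 2
    thus ?thesis using walk_point_inj_less[OF w, of l k q r] k l eq by auto
  next
    case 3
    have "p k \<noteq> p (Suc k)" using simple_walk_eqD[OF w, of k "Suc k"] k w by (auto simp: simple_walk_def)
    hence "r = q" using fun_cong[OF eq, of "p (Suc k)"] k l 3
      by (simp add: walk_point_eq segment_vertex_point)
    with 3 k l show ?thesis by simp
  qed
qed

lemma simplex_points_edge:
  assumes "a \<noteq> b"
  shows "simplex_points {a, b} = segment (vertex_point a) (vertex_point b) ` {0..1}"
proof (intro equalityI subsetI)
  fix x assume x: "x \<in> simplex_points {a, b}"
  have sum: "x a + x b = 1" "0 \<le> x a" "0 \<le> x b" using simplex_pointsD[OF x] assms by simp_all
  have zero: "x v = 0" if "v \<notin> {a, b}" for v by (rule simplex_pointsD(2)[OF x that])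
  have "x = segment (vertex_point a) (vertex_point b) (x b)"
  proof
    fix v show "x v = segment (vertex_point a) (vertex_point b) (x b) v"
      using sum zero[of v] by (auto simp: segment_vertex_point[OF assms])
  qed
  moreover have "x b \<in> {0..1}" using sum by simp
  ultimately show "x \<in> segment (vertex_point a) (vertex_point b) ` {0..1}" by (rule image_eqI)
next
  fix x assume "x \<in> segment (vertex_point a) (vertex_point b) ` {0..1}"
  thus "x \<in> simplex_points {a, b}"
    by (auto intro!: segment_in_simplex_points vertex_point_in_simplex_points)
qed

lemma simplicial_graph_path_complex:
  assumes "simple_walk p n" shows "simplicial_graph (path_complex p n)"
proof -
  have "p i \<noteq> p (Suc i)" if "i < n" for i
    using simple_walk_eqD[OF assms, of i "Suc i"] that assms by (auto simp: simple_walk_def)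
  hence card: "card {p i, p (Suc i)} = 2" if "i < n" for i using that by simp
  have vertex: "{p i} \<in> path_complex p n" if "i \<le> n" for i using that by (auto simp: path_complex_def)
  have face: "\<rho> \<in> path_complex p n" if \<sigma>: "\<sigma> \<in> path_complex p n" and \<rho>: "\<rho> \<noteq> {}" "\<rho> \<subseteq> \<sigma>" for \<sigma> \<rho>
  proof -
    consider i where "i \<le> n" "\<sigma> = {p i}" | i where "i < n" "\<sigma> = {p i, p (Suc i)}"
      using \<sigma> by (auto simp: path_complex_def)
    thus ?thesis
    proof cases
      case (1 i)
      hence "\<rho> = {p i}" using \<rho> by blast
      with 1 vertex show ?thesis by simp
    next
      case (2 i)
      hence "\<rho> = {p i} \<or> \<rho> = {p (Suc i)} \<or> \<rho> = \<sigma>" using \<rho> by blast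
      with 2 \<sigma> show ?thesis using vertex[of i] vertex[of "Suc i"] by auto
    qed
  qed
  have "finite (path_complex p n)" unfolding path_complex_def by simp
  moreover have "card \<sigma> = 1 \<or> card \<sigma> = 2" if "\<sigma> \<in> path_complex p n" for \<sigma>
    using that card by (auto simp: path_complex_def)
  ultimately show ?thesis unfolding simplicial_graph_def using face by blast
qed

text \<open>A subspace whose points vanish outside a countable set of coordinates embeds into
  \<open>nat \<Rightarrow> real\<close>, which is metrizable.\<close>

lemma homeomorphic_reindex:
  fixes X :: "('a \<Rightarrow> real) set" and f :: "'a \<Rightarrow> nat"
  assumes inj: "inj_on f V" and X: "\<forall>x\<in>X. \<forall>v. v \<notin> V \<longrightarrow> x v = 0"
  obtains F :: "('a \<Rightarrow> real) \<Rightarrow> nat \<Rightarrow> real" where "X homeomorphic F ` X" "continuous_on UNIV F" "inj_on F X"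
proof -
  define F where "F = (\<lambda>x::'a \<Rightarrow> real. \<lambda>k. if k \<in> f ` V then x (inv_into V f k) else 0)"
  define B where "B = (\<lambda>y::nat \<Rightarrow> real. \<lambda>v. if v \<in> V then y (f v) else 0)"
  have F: "continuous_on UNIV F"
    unfolding F_def
  proof (rule continuous_on_coordinatewise_then_product)
    show "continuous_on UNIV (\<lambda>x::'a \<Rightarrow> real. if k \<in> f ` V then x (inv_into V f k) else 0)" for k
      by (cases "k \<in> f ` V") (simp_all add: continuous_on_coordinate del: image_iff)
  qed
  have B: "continuous_on UNIV B"
    unfolding B_def
  proof (rule continuous_on_coordinatewise_then_product)
    show "continuous_on UNIV (\<lambda>y::nat \<Rightarrow> real. if v \<in> V then y (f v) else 0)" for v
      by (cases "v \<in> V") (simp_all add: continuous_on_coordinate)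
  qed
  have BF: "B (F x) = x" if "x \<in> X" for x
  proof
    fix v show "B (F x) v = x v"
      using X that inv_into_f_f[OF inj, of v] by (auto simp: B_def F_def)
  qed
  have "homeomorphism X (F ` X) F B"
  proof (rule homeomorphismI)
    show "continuous_on X F" "continuous_on (F ` X) B" using F B by (auto intro: continuous_on_subset)
  qed (use BF in auto)
  hence hom: "X homeomorphic F ` X" unfolding homeomorphic_def by blast
  have "inj_on F X" using BF by (metis inj_onI)
  with hom F show ?thesis by (rule that)
qed

lemma realization_path_complex:
  assumes w: "simple_walk p n"
  shows "realization (path_complex p n) = walk_point p n ` {0..real n}"
proof -
  have n: "n \<ge> 1" using w by (simp add: simple_walk_def)
  have ne: "p i \<noteq> p (Suc i)" if "i < n" for i
    using simple_walk_eqD[OF w, of i "Suc i"] that w by (auto simp: simple_walk_def)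
  have edge: "simplex_points {p i, p (Suc i)} = (\<lambda>r. walk_point p n (real i + r)) ` {0..1}" if "i < n" for i
    using that by (auto simp: simplex_points_edge[OF ne] walk_point_eq)
  have vertex: "\<exists>j<n. p i \<in> {p j, p (Suc j)}" if "i \<le> n" for i
  proof (cases i)
    case 0
    thus ?thesis using n by (intro exI[of _ 0]) auto
  next
    case (Suc j)
    thus ?thesis using that by (intro exI[of _ j]) auto
  qed
  have "realization (path_complex p n) = (\<Union>i<n. simplex_points {p i, p (Suc i)})"
  proof (intro equalityI subsetI)
    fix x assume "x \<in> realization (path_complex p n)"
    then obtain \<sigma> where s: "\<sigma> \<in> path_complex p n" "x \<in> simplex_points \<sigma>"
      by (auto simp: realization_eq[OF simplicial_graph_path_complex[OF w]])
    have "\<exists>j<n. \<sigma> \<subseteq> {p j, p (Suc j)}"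
    proof -
      consider i where "i \<le> n" "\<sigma> = {p i}" | i where "i < n" "\<sigma> = {p i, p (Suc i)}"
        using s(1) by (auto simp: path_complex_def)
      thus ?thesis
      proof cases
        case (1 i)
        with vertex[OF 1(1)] show ?thesis by (metis empty_subsetI insert_subset)
      qed blast
    qed
    then obtain j where j: "j < n" "\<sigma> \<subseteq> {p j, p (Suc j)}" by blast
    hence "x \<in> simplex_points {p j, p (Suc j)}" using simplex_points_mono[OF _ j(2) s(2)] by simp
    with j(1) show "x \<in> (\<Union>i<n. simplex_points {p i, p (Suc i)})" by blast
  next
    fix x assume "x \<in> (\<Union>i<n. simplex_points {p i, p (Suc i)})"
    then obtain i where "i < n" "x \<in> simplex_points {p i, p (Suc i)}" by blast
    moreover have "{p i, p (Suc i)} \<in> path_complex p n" if "i < n" for i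
      using that by (auto simp: path_complex_def)
    ultimately show "x \<in> realization (path_complex p n)"
      unfolding realization_eq[OF simplicial_graph_path_complex[OF w]] by blast
  qed
  also have "\<dots> = walk_point p n ` {0..real n}"
  proof (intro equalityI subsetI)
    fix x assume "x \<in> (\<Union>i<n. simplex_points {p i, p (Suc i)})"
    then obtain i r where "i < n" "0 \<le> r" "r \<le> 1" "x = walk_point p n (real i + r)"
      using edge by auto
    thus "x \<in> walk_point p n ` {0..real n}" by (intro image_eqI[of _ _ "real i + r"]) auto
  next
    fix x assume "x \<in> walk_point p n ` {0..real n}"
    then obtain s where "x = walk_point p n s" "0 \<le> s" "s \<le> real n" by auto
    then obtain k r where "k < n" "0 \<le> r" "r \<le> 1" "x = walk_point p n (real k + r)"
      using param_floor[of s n] n by metis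
    hence "x \<in> simplex_points {p k, p (Suc k)}" by (auto simp: edge)
    with \<open>k < n\<close> show "x \<in> (\<Union>i<n. simplex_points {p i, p (Suc i)})" by blast
  qed
  finally show ?thesis .
qed

lemma realization_path_complex_homeomorphic:
  assumes w: "simple_walk p n"
  shows "p 0 = p n \<and> realization (path_complex p n) homeomorphic sphere (0::complex) 1 \<or>
    p 0 \<noteq> p n \<and> realization (path_complex p n) homeomorphic {0..1::real}"
proof -
  have n: "n \<ge> 1" using w by (simp add: simple_walk_def)
  define V where "V = p ` {..n}"
  have "finite V" by (simp add: V_def)
  then obtain f :: "'a \<Rightarrow> nat" where f: "inj_on f V" using finite_imp_inj_to_nat_seg by blast
  have R: "realization (path_complex p n) = walk_point p n ` {0..real n}"
    by (rule realization_path_complex[OF w])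
  have "x v = 0" if x: "x \<in> realization (path_complex p n)" and v: "v \<notin> V" for x v
  proof -
    obtain s where "x = walk_point p n s" using x R by auto
    thus ?thesis using v unfolding walk_point_def V_def by (auto intro!: sum.neutral)
  qed
  hence "\<forall>x\<in>realization (path_complex p n). \<forall>v. v \<notin> V \<longrightarrow> x v = 0" by blast
  from homeomorphic_reindex[OF f this]
  obtain F :: "('a \<Rightarrow> real) \<Rightarrow> nat \<Rightarrow> real" where F: "continuous_on UNIV F"
    "realization (path_complex p n) homeomorphic F ` realization (path_complex p n)"
    "inj_on F (realization (path_complex p n))" by blast
  define g where "g = (\<lambda>t. F (walk_point p n (real n * t)))"
  have "(\<lambda>t. real n * t) ` {0..1} = {0..real n}"
    using n by (simp add: image_mult_atLeastAtMost)
  hence image: "path_image g = F ` realization (path_complex p n)"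
    unfolding path_image_def g_def R by (metis image_image)
  have "continuous_on {0..1} (\<lambda>t. walk_point p n (real n * t))"
    unfolding walk_point_def
    by (intro continuous_on_coordinatewise_then_product continuous_on_sum continuous_on_mult
        continuous_on_max continuous_on_diff continuous_on_rabs continuous_on_const continuous_on_id)
  hence path: "path g"
    unfolding path_def g_def by (rule continuous_on_compose2[OF F(1)]) simp
  have inj: "s = t \<or> p 0 = p n \<and> (s = 0 \<and> t = 1 \<or> s = 1 \<and> t = 0)"
    if "s \<in> {0..1}" "t \<in> {0..1}" "g s = g t" for s t
  proof -
    have st: "real n * s \<in> {0..real n}" "real n * t \<in> {0..real n}"
      using that n by (auto simp: mult_left_le)
    hence "walk_point p n (real n * s) = walk_point p n (real n * t)"
      using that inj_onD[OF F(3)] unfolding R g_def by blast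
    from walk_point_inj[OF w st this] show ?thesis using that n by auto
  qed
  show ?thesis
  proof (cases "p 0 = p n")
    case True
    have "walk_point p n (real n * 1) = vertex_point (p n)"
      using walk_point_eq[of "n - 1" n 1 p] n by (simp add: segment_def of_nat_diff)
    moreover have "walk_point p n (real n * 0) = vertex_point (p 0)"
      using walk_point_eq[of 0 n 0 p] n by (simp add: segment_def)
    ultimately have "pathfinish g = pathstart g"
      using True unfolding pathfinish_def pathstart_def g_def by simp
    moreover have "simple_path g"
      using path inj unfolding simple_path_def loop_free_def by blast
    ultimately have "path_image g homeomorphic sphere (0::complex) 1"
      by (intro homeomorphic_simple_path_image_circle) auto
    thus ?thesis using F(2) True unfolding image by (auto intro: homeomorphic_trans)
  next
    case False
    hence "arc g" using path inj unfolding arc_def inj_on_def by blast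
    hence "path_image g homeomorphic {0..1::real}"
      by (intro homeomorphic_arc_image_interval) auto
    thus ?thesis using F(2) False unfolding image by (auto intro: homeomorphic_trans)
  qed
qed

text \<open>A longest simple path can leave its vertex set neither at its ends, by maximality, nor at an
  inner vertex, whose two neighbours are already on it.\<close>

lemma no_branch_vertex_imp_path_complex:
  assumes \<Gamma>: "simplicial_graph \<Gamma>"
    and conn: "\<And>x y. x \<in> vertices \<Gamma> \<Longrightarrow> y \<in> vertices \<Gamma> \<Longrightarrow> (x, y) \<in> reachable \<Gamma>"
    and two: "a \<in> vertices \<Gamma>" "b \<in> vertices \<Gamma>" "a \<noteq> b"
    and deg: "\<And>x. x \<in> vertices \<Gamma> \<Longrightarrow> card (neighbours \<Gamma> x) \<le> 2"
  obtains p n where "simple_walk p n" "\<Gamma> = path_complex p n"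
proof -
  define P where "P = (\<lambda>n p. inj_on p {..n} \<and> p ` {..n} \<subseteq> vertices \<Gamma> \<and> (\<forall>i<n. {p i, p (Suc i)} \<in> \<Gamma>))"
  have fin: "finite (vertices \<Gamma>)" by (rule finite_vertices[OF \<Gamma>])
  have vert: "x \<in> vertices \<Gamma>" "y \<in> vertices \<Gamma>" if "{x, y} \<in> \<Gamma>" for x y
    using simplicial_graph_face[OF \<Gamma> that, of "{x}"] simplicial_graph_face[OF \<Gamma> that, of "{y}"]
    by (auto simp: vertices_def)
  have "n \<le> card (vertices \<Gamma>)" if ex: "\<exists>p. P n p" for n
  proof -
    obtain p where "inj_on p {..n}" "p ` {..n} \<subseteq> vertices \<Gamma>" using ex by (auto simp: P_def)
    from card_inj_on_le[OF this fin] show ?thesis by simp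
  qed
  moreover have "\<exists>p. P 0 p" using two by (auto simp: P_def intro!: exI[of _ "\<lambda>_. a"])
  ultimately obtain n where n: "\<exists>p. P n p" and greatest: "\<forall>m. (\<exists>q. P m q) \<longrightarrow> m \<le> n"
    using ex_has_greatest_nat[of "\<lambda>n. \<exists>p. P n p" 0 "\<lambda>n. n" "Suc (card (vertices \<Gamma>))"] by (auto simp: less_Suc_eq_le)
  then obtain p where np: "P n p" by blast
  have max: "\<And>m q. P m q \<Longrightarrow> m \<le> n" using greatest by blast
  have inj: "p i = p j \<longleftrightarrow> i = j" if "i \<le> n" "j \<le> n" for i j
    using np that by (auto simp: P_def inj_on_eq_iff)
  have pv: "p i \<in> vertices \<Gamma>" if "i \<le> n" for i using np that by (auto simp: P_def)
  have pe: "{p i, p (Suc i)} \<in> \<Gamma>" if "i < n" for i using np that by (auto simp: P_def)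
  have inner: "y = p (i - 1) \<or> y = p (Suc i)" if i: "0 < i" "i < n" and y: "y \<in> neighbours \<Gamma> (p i)" for i y
  proof -
    have "neighbours \<Gamma> (p i) \<subseteq> vertices \<Gamma>" using vert by (auto simp: neighbours_def)
    hence fin': "finite (neighbours \<Gamma> (p i))" using fin finite_subset by blast
    have "{p (i - 1), p (Suc i)} \<subseteq> neighbours \<Gamma> (p i)"
      using i pe[of "i - 1"] pe[of i] inj[of "i - 1" i] inj[of "Suc i" i]
      by (auto simp: neighbours_def insert_commute)
    moreover have "card {p (i - 1), p (Suc i)} = 2" using i inj[of "i - 1" "Suc i"] by auto
    ultimately have "{p (i - 1), p (Suc i)} = neighbours \<Gamma> (p i)"
      using deg[OF pv, of i] i fin' by (intro card_seteq) auto
    with y show ?thesis by auto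
  qed
  have closed: "y \<in> p ` {..n}" if i: "i \<le> n" and y: "y \<in> neighbours \<Gamma> (p i)" for i y
  proof (rule ccontr)
    assume new: "y \<notin> p ` {..n}"
    have yv: "y \<in> vertices \<Gamma>" and ye: "{p i, y} \<in> \<Gamma>" using y vert by (auto simp: neighbours_def)
    consider "i = 0" | "i = n" | "0 < i" "i < n" using i by linarith
    thus False
    proof cases
      case 1
      \<comment> \<open>the new vertex is put in front\<close>
      define q where "q = (\<lambda>k. if k = 0 then y else p (k - 1))"
      have "P (Suc n) q"
        unfolding P_def
      proof (intro conjI allI impI)
        show "inj_on q {..Suc n}"
          unfolding inj_on_def q_def
        proof (intro ballI impI)
          fix j k assume jk: "j \<in> {..Suc n}" "k \<in> {..Suc n}"
            and eq: "(if j = 0 then y else p (j - 1)) = (if k = 0 then y else p (k - 1))"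
          have "p (j - 1) \<noteq> y" if "j \<noteq> 0" using new jk that by auto
          moreover have "p (k - 1) \<noteq> y" if "k \<noteq> 0" using new jk that by auto
          ultimately show "j = k" using jk eq inj[of "j - 1" "k - 1"] by (auto split: if_splits)
        qed
        show "q ` {..Suc n} \<subseteq> vertices \<Gamma>" using yv pv by (auto simp: q_def)
        fix k assume "k < Suc n"
        thus "{q k, q (Suc k)} \<in> \<Gamma>"
          using ye 1 pe[of "k - 1"] by (cases k) (auto simp: q_def insert_commute)
      qed
      from max[OF this] show False by simp
    next
      case 2
      define q where "q = p(Suc n := y)"
      have "P (Suc n) q"
        unfolding P_def
      proof (intro conjI allI impI)
        show "inj_on q {..Suc n}"
          using new np by (auto simp: q_def P_def atMost_Suc inj_on_def)
        show "q ` {..Suc n} \<subseteq> vertices \<Gamma>" using yv pv by (auto simp: q_def)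
        fix k assume "k < Suc n"
        thus "{q k, q (Suc k)} \<in> \<Gamma>" using ye 2 pe[of k] by (auto simp: q_def less_Suc_eq)
      qed
      from max[OF this] show False by simp
    next
      case 3
      with inner[OF 3 y] new show False by auto
    qed
  qed
  have reach: "x \<in> p ` {..n}" if "(p 0, x) \<in> reachable \<Gamma>" for x
    using that unfolding reachable_def
  proof (induction)
    case (step x y)
    thus ?case using closed by (cases "x = y") (auto simp: neighbours_def)
  qed auto
  have V: "vertices \<Gamma> = p ` {..n}"
    using reach conn[OF pv] pv by blast
  have "n \<ge> 1"
  proof (rule ccontr)
    assume "\<not> n \<ge> 1"
    hence "n = 0" by simp
    hence "vertices \<Gamma> = {p 0}" using V by simp
    with two show False by auto
  qed
  have edges: "j = Suc i \<or> i = 0 \<and> j = n" if ij: "i < j" "j \<le> n" "{p i, p j} \<in> \<Gamma>" for i j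
  proof (cases "i = 0")
    case False
    moreover have "p j \<in> neighbours \<Gamma> (p i)" using ij inj[of j i] by (auto simp: neighbours_def)
    ultimately show ?thesis using inner[of i "p j"] ij inj[of j "i - 1"] inj[of j "Suc i"] by auto
  next
    case True
    have "p i \<in> neighbours \<Gamma> (p j)" using ij inj[of j i] by (auto simp: neighbours_def insert_commute)
    thus ?thesis using inner[of j "p i"] ij True inj[of i "j - 1"] inj[of i "Suc j"] by auto
  qed
  have simplex: "(\<exists>i\<le>n. \<sigma> = {p i}) \<or> (\<exists>i<n. \<sigma> = {p i, p (Suc i)}) \<or> \<sigma> = {p 0, p n}"
    if s: "\<sigma> \<in> \<Gamma>" for \<sigma>
  proof -
    have "card \<sigma> = 1 \<or> card \<sigma> = 2" using \<Gamma> s by (auto simp: simplicial_graph_def)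
    then consider x where "\<sigma> = {x}" | x y where "\<sigma> = {x, y}" "x \<noteq> y"
      by (metis card_1_singletonE card_2_iff)
    thus ?thesis
    proof cases
      case (1 x)
      hence "x \<in> p ` {..n}" using s V by (auto simp: vertices_def)
      with 1 show ?thesis by auto
    next
      case (2 x y)
      hence "x \<in> p ` {..n}" "y \<in> p ` {..n}" using s V vert by blast+
      then obtain i j where ij: "i \<le> n" "j \<le> n" "x = p i" "y = p j" by auto
      have pair: "(\<exists>k<n. {p i, p j} = {p k, p (Suc k)}) \<or> {p i, p j} = {p 0, p n}"
        if "i < j" "j \<le> n" "{p i, p j} \<in> \<Gamma>" for i j
      proof (cases "j = Suc i")
        case True
        thus ?thesis using that by (intro disjI1 exI[of _ i]) auto
      next
        case False
        thus ?thesis using edges[OF that] by auto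
      qed
      have "i < j \<or> j < i" using 2 ij by (metis linorder_neqE_nat)
      thus ?thesis
      proof
        assume "i < j"
        thus ?thesis using pair[of i j] 2 s ij by simp
      next
        assume "j < i"
        thus ?thesis using pair[of j i] 2 s ij by (simp add: insert_commute)
      qed
    qed
  qed
  show ?thesis
  proof (cases "{p 0, p n} \<in> \<Gamma> \<and> n \<ge> 2")
    case True
    define q where "q = p(Suc n := p 0)"
    have "simple_walk q (Suc n)"
      unfolding simple_walk_def
    proof (intro conjI)
      show "inj_on q {..<Suc n}"
        using inj by (auto simp: q_def inj_on_def less_Suc_eq_le)
      show "inj_on q {1..Suc n}"
        using inj by (auto simp: q_def inj_on_def le_Suc_eq)
    qed (use True in auto)
    moreover have "\<Gamma> = path_complex q (Suc n)"
    proof (intro equalityI subsetI)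
      fix \<sigma> assume "\<sigma> \<in> \<Gamma>"
      from simplex[OF this] show "\<sigma> \<in> path_complex q (Suc n)"
      proof (elim disjE exE conjE)
        fix i assume "i \<le> n" "\<sigma> = {p i}"
        thus ?thesis unfolding path_complex_def by (intro UnI1 CollectI exI[of _ i]) (auto simp: q_def)
      next
        fix i assume "i < n" "\<sigma> = {p i, p (Suc i)}"
        thus ?thesis unfolding path_complex_def by (intro UnI2 CollectI exI[of _ i]) (auto simp: q_def)
      next
        assume "\<sigma> = {p 0, p n}"
        thus ?thesis unfolding path_complex_def by (intro UnI2 CollectI exI[of _ n]) (auto simp: q_def)
      qed
    next
      fix \<sigma> assume "\<sigma> \<in> path_complex q (Suc n)"
      thus "\<sigma> \<in> \<Gamma>"
        using pv pe True by (auto simp: path_complex_def q_def vertices_def less_Suc_eq insert_commute le_Suc_eq)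
    qed
    ultimately show ?thesis by (rule that)
  next
    case False
    have "simple_walk p n"
      using \<open>n \<ge> 1\<close> inj unfolding simple_walk_def by (auto simp: inj_on_def)
    moreover have "\<Gamma> = path_complex p n"
    proof (intro equalityI subsetI)
      fix \<sigma> assume s: "\<sigma> \<in> \<Gamma>"
      have "{p 0, p n} = {p 0, p (Suc 0)}" if "\<sigma> = {p 0, p n}"
      proof -
        have "n = 1" using False s that \<open>n \<ge> 1\<close> by auto
        thus ?thesis by simp
      qed
      thus "\<sigma> \<in> path_complex p n"
        using simplex[OF s] \<open>n \<ge> 1\<close> by (auto simp: path_complex_def)
    next
      fix \<sigma> assume "\<sigma> \<in> path_complex p n"
      thus "\<sigma> \<in> \<Gamma>" using pv pe by (auto simp: path_complex_def vertices_def)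
    qed
    ultimately show ?thesis by (rule that)
  qed
qed

text \<open>The only connected graphs with at least two vertices and no branch vertex are paths and cycles.\<close>

lemma exists_branch_vertex:
  assumes \<Gamma>: "simplicial_graph \<Gamma>" "connected (realization \<Gamma>)"
    and no: "\<not> realization \<Gamma> homeomorphic {0..1::real}"
      "\<not> realization \<Gamma> homeomorphic sphere (0::complex) 1"
    and two: "a \<in> vertices \<Gamma>" "b \<in> vertices \<Gamma>" "a \<noteq> b"
  obtains x where "x \<in> vertices \<Gamma>" "card (neighbours \<Gamma> x) \<ge> 3"
proof (rule ccontr)
  assume no_branch: "\<not> thesis"
  note branch = that
  have deg: "card (neighbours \<Gamma> x) \<le> 2" if x: "x \<in> vertices \<Gamma>" for x
  proof (rule ccontr)
    assume "\<not> card (neighbours \<Gamma> x) \<le> 2"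
    hence "card (neighbours \<Gamma> x) \<ge> 3" by simp
    with x have thesis by (rule branch)
    with no_branch show False ..
  qed
  obtain p n where "simple_walk p n" "\<Gamma> = path_complex p n"
    using no_branch_vertex_imp_path_complex[OF \<Gamma>(1) reachable_if_connected[OF \<Gamma>] two deg] by blast
  with realization_path_complex_homeomorphic[of p n] no show False by blast
qed

section \<open>Chains on a graph and on its square\<close>

abbreviation graph_boundary :: "('a set \<Rightarrow>\<^sub>0 int) \<Rightarrow> ('a set \<Rightarrow>\<^sub>0 int)" where
  "graph_boundary \<equiv> frag_extend graph_bd"

abbreviation prod_boundary :: "('a set \<times> 'a set \<Rightarrow>\<^sub>0 int) \<Rightarrow> ('a set \<times> 'a set \<Rightarrow>\<^sub>0 int)" where
  "prod_boundary \<equiv> frag_extend prod_bd"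

abbreviation keys where "keys \<equiv> Poly_Mapping.keys"
abbreviation lookup where "lookup \<equiv> Poly_Mapping.lookup"

lemmas frag_extend_linear = frag_extend_add frag_extend_diff frag_extend_minus frag_extend_cmul

lemma frag_cmul_diff: "frag_cmul k (a - b) = frag_cmul k a - frag_cmul k b"
  by (rule poly_mapping_eqI) (simp add: lookup_minus algebra_simps)

subsection \<open>Cross products of chains\<close>

text \<open>This formula for the coefficients makes bilinearity and the support of the cross product evident.\<close>

lemma lookup_cross_chain: "lookup (cross_chain a b) (\<sigma>, \<tau>) = lookup a \<sigma> * lookup b \<tau>"
proof -
  have *: "lookup (frag_extend (\<lambda>\<tau>. frag_of (\<rho>, \<tau>)) b) (\<sigma>, \<tau>) = of_bool (\<sigma> = \<rho>) * lookup b \<tau>" for \<rho>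
    using subset_UNIV[of "keys b"]
    by (induction b rule: frag_induction) (auto simp: frag_extend_diff lookup_minus algebra_simps)
  show ?thesis
    unfolding cross_chain_def using subset_UNIV[of "keys a"]
    by (induction a rule: frag_induction) (auto simp: frag_extend_diff lookup_minus algebra_simps *)
qed

lemma cross_chain_linear:
  "cross_chain 0 b = 0" "cross_chain a 0 = 0"
  "cross_chain (a + a') b = cross_chain a b + cross_chain a' b"
  "cross_chain a (b + b') = cross_chain a b + cross_chain a b'"
  "cross_chain (a - a') b = cross_chain a b - cross_chain a' b"
  "cross_chain a (b - b') = cross_chain a b - cross_chain a b'"
  "cross_chain (- a) b = - cross_chain a b"
  "cross_chain a (- b) = - cross_chain a b"
  "cross_chain (frag_cmul k a) b = frag_cmul k (cross_chain a b)"
  "cross_chain a (frag_cmul k b) = frag_cmul k (cross_chain a b)"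
  by (rule poly_mapping_eqI; clarsimp simp: lookup_cross_chain lookup_add lookup_minus algebra_simps)+

lemma cross_chain_frag_of: "cross_chain (frag_of \<sigma>) (frag_of \<tau>) = frag_of (\<sigma>, \<tau>)"
  by (simp add: cross_chain_def)

lemma keys_cross_chain: "keys (cross_chain a b) = keys a \<times> keys b"
  by (auto simp: in_keys_iff lookup_cross_chain)

lemma prod_chain_induct [consumes 1, case_names zero cross diff]:
  assumes "keys c \<subseteq> A \<times> B" "P 0"
    and "\<And>\<sigma> \<tau>. \<sigma> \<in> A \<Longrightarrow> \<tau> \<in> B \<Longrightarrow> P (cross_chain (frag_of \<sigma>) (frag_of \<tau>))"
    and "\<And>x y. P x \<Longrightarrow> P y \<Longrightarrow> P (x - y)"
  shows "P c"
  using assms(1) by (induction c rule: frag_induction) (auto simp: assms simp flip: cross_chain_frag_of)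

lemma keys_diff_subset: "keys a \<subseteq> X \<Longrightarrow> keys b \<subseteq> X \<Longrightarrow> keys (a - b) \<subseteq> X"
  using keys_diff[of a b] by blast

lemma keys_add_subset: "keys a \<subseteq> X \<Longrightarrow> keys b \<subseteq> X \<Longrightarrow> keys (a + b) \<subseteq> X"
  using Poly_Mapping.keys_add[of a b] by blast

lemma keys_cmul_subset: "keys a \<subseteq> X \<Longrightarrow> keys (frag_cmul k a) \<subseteq> X"
  using keys_cmul[of k a] by blast

lemma keys_frag_extend_subset:
  "keys c \<subseteq> A \<Longrightarrow> (\<And>x. x \<in> A \<Longrightarrow> keys (f x) \<subseteq> X) \<Longrightarrow> keys (frag_extend f c) \<subseteq> X"
  using keys_frag_extend[of f c] by blast

text \<open>The tensor product of the linear extensions of \<open>f\<close> and \<open>g\<close>.\<close>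

definition tensor_map ::
    "('a \<Rightarrow> ('c \<Rightarrow>\<^sub>0 int)) \<Rightarrow> ('b \<Rightarrow> ('d \<Rightarrow>\<^sub>0 int)) \<Rightarrow> ('a \<times> 'b \<Rightarrow>\<^sub>0 int) \<Rightarrow> ('c \<times> 'd \<Rightarrow>\<^sub>0 int)" where
  "tensor_map f g = frag_extend (\<lambda>(\<sigma>, \<tau>). cross_chain (f \<sigma>) (g \<tau>))"

lemma tensor_map_cross_chain:
  "tensor_map f g (cross_chain a b) = cross_chain (frag_extend f a) (frag_extend g b)"
  using subset_UNIV[of "keys a"]
proof (induction a rule: frag_induction)
  case (one \<sigma>)
  show ?case using subset_UNIV[of "keys b"]
    by (induction b rule: frag_induction)
       (simp_all add: tensor_map_def cross_chain_linear cross_chain_frag_of frag_extend_linear)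
qed (simp_all add: tensor_map_def cross_chain_linear frag_extend_linear)

lemma tensor_map_linear:
  "tensor_map f g 0 = 0" "tensor_map f g (c - d) = tensor_map f g c - tensor_map f g d"
  by (simp_all add: tensor_map_def frag_extend_linear)

lemma tensor_map_compose:
  "tensor_map f g (tensor_map f' g' c)
     = tensor_map (\<lambda>x. frag_extend f (f' x)) (\<lambda>x. frag_extend g (g' x)) c"
  using subset_UNIV[of "keys c"] unfolding UNIV_Times_UNIV[symmetric]
  by (induction c rule: prod_chain_induct) (simp_all add: tensor_map_linear tensor_map_cross_chain)

lemma tensor_map_frag_of: "tensor_map frag_of frag_of c = c"
  using frag_expansion[of c] by (simp add: tensor_map_def cross_chain_frag_of case_prod_unfold)

subsection \<open>Slices\<close>

text \<open>Every chain is the sum of the products \<open>e \<times> left_slice e c\<close>, and likewise on the right.\<close>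

definition left_slice :: "'c \<Rightarrow> ('c \<times> 'd \<Rightarrow>\<^sub>0 int) \<Rightarrow> ('d \<Rightarrow>\<^sub>0 int)" where
  "left_slice e = frag_extend (\<lambda>(\<sigma>, \<tau>). if \<sigma> = e then frag_of \<tau> else 0)"

definition right_slice :: "'d \<Rightarrow> ('c \<times> 'd \<Rightarrow>\<^sub>0 int) \<Rightarrow> ('c \<Rightarrow>\<^sub>0 int)" where
  "right_slice e = frag_extend (\<lambda>(\<sigma>, \<tau>). if \<tau> = e then frag_of \<sigma> else 0)"

lemma lookup_left_slice: "lookup (left_slice e c) \<tau> = lookup c (e, \<tau>)"
  unfolding left_slice_def using subset_UNIV[of "keys c"]
  by (induction c rule: frag_induction) (auto simp: frag_extend_linear lookup_minus split: if_splits)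

lemma lookup_right_slice: "lookup (right_slice e c) \<sigma> = lookup c (\<sigma>, e)"
  unfolding right_slice_def using subset_UNIV[of "keys c"]
  by (induction c rule: frag_induction) (auto simp: frag_extend_linear lookup_minus split: if_splits)

lemma keys_left_slice: "keys (left_slice e c) = {\<tau>. (e, \<tau>) \<in> keys c}"
  by (auto simp: in_keys_iff lookup_left_slice)

lemma keys_right_slice: "keys (right_slice e c) = {\<sigma>. (\<sigma>, e) \<in> keys c}"
  by (auto simp: in_keys_iff lookup_right_slice)

lemma slice_linear:
  "left_slice e 0 = 0" "left_slice e (c + d) = left_slice e c + left_slice e d"
  "left_slice e (c - d) = left_slice e c - left_slice e d" "left_slice e (- c) = - left_slice e c"
  "right_slice e 0 = 0" "right_slice e (c + d) = right_slice e c + right_slice e d"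
  "right_slice e (c - d) = right_slice e c - right_slice e d" "right_slice e (- c) = - right_slice e c"
  by (simp_all add: left_slice_def right_slice_def frag_extend_linear)

lemma slice_cross_chain:
  "left_slice e (cross_chain a b) = frag_cmul (lookup a e) b"
  "right_slice e (cross_chain a b) = frag_cmul (lookup b e) a"
  by (rule poly_mapping_eqI; simp add: lookup_left_slice lookup_right_slice lookup_cross_chain)+

subsection \<open>Boundaries\<close>

lemma graph_dim_simps: "card \<sigma> = 1 \<Longrightarrow> graph_dim \<sigma> = 0" "card \<sigma> = 2 \<Longrightarrow> graph_dim \<sigma> = 1"
  by (simp_all add: graph_dim_def)

lemma graph_boundary_vertices:
  assumes "keys c \<subseteq> {\<sigma>. card \<sigma> = 1}" shows "graph_boundary c = 0"
  using assms by (intro frag_extend_eq_0) (auto simp: graph_bd_def graph_dim_def)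

lemma prod_boundary_cross_edges:
  assumes "keys a \<subseteq> {\<sigma>. card \<sigma> = 2}"
  shows "prod_boundary (cross_chain a b)
      = cross_chain (graph_boundary a) b - cross_chain a (graph_boundary b)"
  using assms
proof (induction a rule: frag_induction)
  case (one \<sigma>)
  show ?case using subset_UNIV[of "keys b"]
  proof (induction b rule: frag_induction)
    case (one \<tau>)
    thus ?case using \<open>\<sigma> \<in> _\<close>
      by (simp add: cross_chain_frag_of prod_bd_def graph_dim_simps cross_chain_linear)
  qed (simp_all add: cross_chain_linear frag_extend_linear)
qed (simp_all add: cross_chain_linear frag_extend_linear)

lemma prod_boundary_cross_vertices:
  assumes "keys a \<subseteq> {\<sigma>. card \<sigma> = 1}"
  shows "prod_boundary (cross_chain a b) = cross_chain a (graph_boundary b)"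
  using assms
proof (induction a rule: frag_induction)
  case (one \<sigma>)
  show ?case using subset_UNIV[of "keys b"]
  proof (induction b rule: frag_induction)
    case (one \<tau>)
    thus ?case using \<open>\<sigma> \<in> _\<close>
      by (simp add: cross_chain_frag_of prod_bd_def graph_dim_simps cross_chain_linear graph_bd_def)
  qed (simp_all add: cross_chain_linear frag_extend_linear)
qed (simp_all add: cross_chain_linear frag_extend_linear)

lemma swap_chain_linear:
  "swap_chain 0 = 0" "swap_chain (c + d) = swap_chain c + swap_chain d"
  "swap_chain (c - d) = swap_chain c - swap_chain d" "swap_chain (- c) = - swap_chain c"
  by (simp_all add: swap_chain_def frag_extend_linear)

lemma swap_chain_cross:
  assumes "keys a \<subseteq> {\<sigma>. card \<sigma> = Suc i}" "keys b \<subseteq> {\<sigma>. card \<sigma> = Suc j}"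
  shows "swap_chain (cross_chain a b) = frag_cmul ((-1) ^ (i * j)) (cross_chain b a)"
  using assms(1)
proof (induction a rule: frag_induction)
  case (one \<sigma>)
  show ?case using assms(2)
  proof (induction b rule: frag_induction)
    case (one \<tau>)
    thus ?case using \<open>\<sigma> \<in> _\<close>
      by (simp add: cross_chain_frag_of swap_chain_def graph_dim_def)
  qed (simp_all add: cross_chain_linear swap_chain_linear frag_cmul_diff)
qed (simp_all add: cross_chain_linear swap_chain_linear frag_cmul_diff)

lemma prod_boundary_swap:
  assumes "keys c \<subseteq> {\<sigma>. card \<sigma> = 2} \<times> {\<tau>. card \<tau> = 2}"
  shows "prod_boundary (swap_chain c) = swap_chain (prod_boundary c)"
  using assms
proof (induction c rule: prod_chain_induct)
  case (cross \<sigma> \<tau>)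
  have b: "keys (graph_bd \<rho>) \<subseteq> {\<sigma>. card \<sigma> = Suc 0}" for \<rho> :: "'a set"
    by (auto simp: graph_bd_def keys_frag_of dest!: keys_diff[THEN subsetD])
  have e: "keys (frag_of \<sigma>) \<subseteq> {\<sigma>. card \<sigma> = Suc (Suc 0)}" "keys (frag_of \<tau>) \<subseteq> {\<sigma>. card \<sigma> = Suc (Suc 0)}"
    using cross by (simp_all add: keys_frag_of)
  hence e': "keys (frag_of \<sigma>) \<subseteq> {\<sigma>. card \<sigma> = 2}" "keys (frag_of \<tau>) \<subseteq> {\<sigma>. card \<sigma> = 2}"
    by (simp_all add: numeral_2_eq_2)
  have "prod_boundary (swap_chain (cross_chain (frag_of \<sigma>) (frag_of \<tau>)))
      = - (cross_chain (graph_bd \<tau>) (frag_of \<sigma>) - cross_chain (frag_of \<tau>) (graph_bd \<sigma>))"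
    by (simp only: swap_chain_cross[OF e] frag_extend_cmul prod_boundary_cross_edges[OF e'(2)]
        frag_extend_of) simp
  also have "\<dots> = swap_chain (cross_chain (graph_bd \<sigma>) (frag_of \<tau>) - cross_chain (frag_of \<sigma>) (graph_bd \<tau>))"
    by (simp only: swap_chain_linear swap_chain_cross[OF b e(2)] swap_chain_cross[OF e(1) b]) simp
  also have "\<dots> = swap_chain (prod_boundary (cross_chain (frag_of \<sigma>) (frag_of \<tau>)))"
    by (simp only: prod_boundary_cross_edges[OF e'(1)] frag_extend_of)
  finally show ?case .
qed (simp_all add: swap_chain_linear frag_extend_linear)

subsection \<open>The chains of a graph\<close>

definition edges :: "'a set set \<Rightarrow> 'a set set" where
  "edges \<Gamma> = {\<sigma> \<in> \<Gamma>. card \<sigma> = 2}"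

definition nodes :: "'a set set \<Rightarrow> 'a set set" where
  "nodes \<Gamma> = {\<sigma> \<in> \<Gamma>. card \<sigma> = 1}"

lemma edges_subset: "edges \<Gamma> \<subseteq> {\<sigma>. card \<sigma> = 2}" and nodes_subset: "nodes \<Gamma> \<subseteq> {\<sigma>. card \<sigma> = 1}"
  by (auto simp: edges_def nodes_def)

lemma nodes_eq: "nodes \<Gamma> = (\<lambda>x. {x}) ` vertices \<Gamma>"
  by (auto simp: nodes_def vertices_def card_1_singleton_iff)

lemma edge_ends:
  assumes "card \<sigma> = 2"
  shows "\<sigma> = {edge_tail \<sigma>, edge_head \<sigma>}" "edge_tail \<sigma> \<noteq> edge_head \<sigma>"
proof -
  obtain x y where xy: "\<sigma> = {x, y}" "x \<noteq> y" using assms by (auto simp: card_2_iff)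
  have "edge_tail \<sigma> \<in> \<sigma>" unfolding edge_tail_def some_in_eq using xy by simp
  moreover obtain z where "z \<in> \<sigma> \<and> z \<noteq> edge_tail \<sigma>" using xy by (metis insertCI)
  hence "edge_head \<sigma> \<in> \<sigma> \<and> edge_head \<sigma> \<noteq> edge_tail \<sigma>"
    unfolding edge_head_def[of \<sigma>] by (rule someI[where P = "\<lambda>z. z \<in> \<sigma> \<and> z \<noteq> edge_tail \<sigma>"])
  ultimately show "\<sigma> = {edge_tail \<sigma>, edge_head \<sigma>}" "edge_tail \<sigma> \<noteq> edge_head \<sigma>"
    using xy by auto
qed

lemma graph_bd_edge:
  "card \<sigma> = 2 \<Longrightarrow> graph_bd \<sigma> = frag_of {edge_head \<sigma>} - frag_of {edge_tail \<sigma>}"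
  by (simp add: graph_bd_def graph_dim_def)

text \<open>The edge between \<open>x\<close> and \<open>y\<close>, oriented towards \<open>x\<close>.\<close>

definition edge_chain :: "'a \<Rightarrow> 'a \<Rightarrow> ('a set \<Rightarrow>\<^sub>0 int)" where
  "edge_chain x y = (if edge_head {x, y} = x then frag_of {x, y} else - frag_of {x, y})"

lemma edge_chain_swap:
  assumes "x \<noteq> y" shows "edge_chain y x = - edge_chain x y"
  using edge_ends[of "{x, y}"] assms by (auto simp: edge_chain_def insert_commute doubleton_eq_iff)

lemma graph_boundary_edge_chain:
  assumes "x \<noteq> y" shows "graph_boundary (edge_chain x y) = frag_of {x} - frag_of {y}"
  using edge_ends[of "{x, y}"] assms
  by (auto simp: edge_chain_def frag_extend_linear graph_bd_edge doubleton_eq_iff)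

lemma keys_edge_chain: "keys (edge_chain x y) = {{x, y}}"
  by (simp add: edge_chain_def keys_frag_of)

lemma frag_of_edge_chain: "frag_of {x, y} = edge_chain x y \<or> frag_of {x, y} = - edge_chain x y"
  by (simp add: edge_chain_def)

lemma edge_ends_vertices:
  assumes "simplicial_graph \<Gamma>" "\<sigma> \<in> edges \<Gamma>"
  shows "edge_head \<sigma> \<in> vertices \<Gamma>" "edge_tail \<sigma> \<in> vertices \<Gamma>"
proof -
  have s: "\<sigma> \<in> \<Gamma>" "card \<sigma> = 2" using assms(2) by (simp_all add: edges_def)
  have "{edge_head \<sigma>} \<subseteq> \<sigma>" "{edge_tail \<sigma>} \<subseteq> \<sigma>"
    by (subst edge_ends(1)[OF s(2)], simp)+
  thus "edge_head \<sigma> \<in> vertices \<Gamma>" "edge_tail \<sigma> \<in> vertices \<Gamma>"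
    using simplicial_graph_face[OF assms(1) s(1)] by (simp_all add: vertices_def)
qed

lemma graph_bd_in_nodes:
  assumes "simplicial_graph \<Gamma>" "\<sigma> \<in> edges \<Gamma>"
  shows "keys (graph_bd \<sigma>) \<subseteq> nodes \<Gamma>"
proof -
  have "card \<sigma> = 2" using assms(2) by (simp add: edges_def)
  thus ?thesis using edge_ends_vertices[OF assms]
    by (simp only: graph_bd_edge) (intro keys_diff_subset, simp_all add: keys_frag_of nodes_eq)
qed

lemma graph_boundary_in_nodes:
  "simplicial_graph \<Gamma> \<Longrightarrow> keys c \<subseteq> edges \<Gamma> \<Longrightarrow> keys (graph_boundary c) \<subseteq> nodes \<Gamma>"
  by (rule keys_frag_extend_subset[of c "edges \<Gamma>"]) (auto dest: graph_bd_in_nodes)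

text \<open>With constant \<open>f\<close> this is the vanishing of the augmentation on boundaries; labels that depend on
  the component only will give the coefficient sums over the components.\<close>

lemma frag_extend_graph_boundary_eq_0:
  assumes "keys c \<subseteq> edges \<Gamma>"
    and "\<And>\<sigma>. \<sigma> \<in> edges \<Gamma> \<Longrightarrow> f {edge_head \<sigma>} = f {edge_tail \<sigma>}"
  shows "frag_extend f (graph_boundary c) = 0"
  using assms(1)
proof (induction c rule: frag_induction)
  case (one \<sigma>)
  hence "card \<sigma> = 2" by (simp add: edges_def)
  with one assms(2) show ?case by (simp add: graph_bd_edge frag_extend_linear)
qed (simp_all add: frag_extend_linear)

lemma path_chain:
  assumes "(x, y) \<in> reachable \<Gamma>"
  obtains c where "keys c \<subseteq> edges \<Gamma>" "graph_boundary c = frag_of {y} - frag_of {x}"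
proof -
  have "\<exists>c. keys c \<subseteq> edges \<Gamma> \<and> graph_boundary c = frag_of {y} - frag_of {x}"
    using assms unfolding reachable_def
  proof (induction)
    case base
    show ?case by (rule exI[of _ 0]) simp
  next
    case (step y z)
    then obtain c where c: "keys c \<subseteq> edges \<Gamma>" "graph_boundary c = frag_of {y} - frag_of {x}" by blast
    show ?case
    proof (cases "y = z")
      case False
      hence "keys (edge_chain z y) \<subseteq> edges \<Gamma>"
        using step(2) by (simp add: keys_edge_chain edges_def insert_commute)
      with c False show ?thesis
        by (intro exI[of _ "c + edge_chain z y"])
           (simp add: keys_add_subset frag_extend_linear graph_boundary_edge_chain)
    qed (use c in blast)
  qed
  with that show ?thesis by blast
qed

text \<open>Paths from the representatives \<open>r w\<close>, as a linear operator that inverts the boundary up to the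
  representatives.\<close>

lemma path_chains:
  assumes "\<And>w. w \<in> vertices \<Gamma> \<Longrightarrow> (r w, w) \<in> reachable \<Gamma>"
  obtains h where "\<And>\<sigma>. keys (h \<sigma>) \<subseteq> edges \<Gamma>"
    "\<And>w. w \<in> vertices \<Gamma> \<Longrightarrow> graph_boundary (h {w}) = frag_of {w} - frag_of {r w}"
proof -
  have "\<exists>c. keys c \<subseteq> edges \<Gamma> \<and>
      (\<forall>w\<in>vertices \<Gamma>. \<sigma> = {w} \<longrightarrow> graph_boundary c = frag_of {w} - frag_of {r w})" for \<sigma>
  proof (cases "\<exists>w\<in>vertices \<Gamma>. \<sigma> = {w}")
    case True
    then obtain w where w: "w \<in> vertices \<Gamma>" "\<sigma> = {w}" by blast
    from path_chain[OF assms[OF w(1)]] obtain c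
      where "keys c \<subseteq> edges \<Gamma>" "graph_boundary c = frag_of {w} - frag_of {r w}" .
    with w show ?thesis by auto
  next
    case False
    thus ?thesis by (intro exI[of _ 0]) auto
  qed
  then obtain h where "\<forall>\<sigma>. keys (h \<sigma>) \<subseteq> edges \<Gamma> \<and>
      (\<forall>w\<in>vertices \<Gamma>. \<sigma> = {w} \<longrightarrow> graph_boundary (h \<sigma>) = frag_of {w} - frag_of {r w})"
    by metis
  with that[of h] show ?thesis by blast
qed

text \<open>Moving every vertex to its representative along the paths of \<open>path_chains\<close> changes a \<open>0\<close>-chain by
  a boundary.\<close>

lemma boundary_if_representatives_vanish:
  assumes "\<And>w. w \<in> vertices \<Gamma> \<Longrightarrow> (r w, w) \<in> reachable \<Gamma>"
    and p: "keys p \<subseteq> nodes \<Gamma>" and zero: "frag_extend (\<lambda>\<sigma>. frag_of {r (the_elem \<sigma>)}) p = 0"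
  obtains c where "keys c \<subseteq> edges \<Gamma>" "graph_boundary c = p"
proof -
  obtain h where h: "\<And>\<sigma>. keys (h \<sigma>) \<subseteq> edges \<Gamma>"
    "\<And>w. w \<in> vertices \<Gamma> \<Longrightarrow> graph_boundary (h {w}) = frag_of {w} - frag_of {r w}"
    using path_chains[OF assms(1)] by metis
  have "graph_boundary (frag_extend h p) = p - frag_extend (\<lambda>\<sigma>. frag_of {r (the_elem \<sigma>)}) p"
    using p by (induction p rule: frag_induction) (auto simp: frag_extend_linear nodes_eq h)
  moreover have "keys (frag_extend h p) \<subseteq> edges \<Gamma>" by (rule keys_frag_extend_subset[OF p h(1)])
  ultimately show ?thesis using that zero by simp
qed

subsection \<open>Cycles on the square\<close>

lemma prod_boundary_edges:
  assumes "keys c \<subseteq> {\<sigma>. card \<sigma> = 2} \<times> {\<tau>. card \<tau> = 2}"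
  shows "prod_boundary c = tensor_map graph_bd frag_of c - tensor_map frag_of graph_bd c"
  using assms
proof (induction c rule: prod_chain_induct)
  case (cross \<sigma> \<tau>)
  hence "keys (frag_of \<sigma>) \<subseteq> {\<sigma>. card \<sigma> = 2}" by (simp add: keys_frag_of)
  thus ?case by (simp add: prod_boundary_cross_edges tensor_map_cross_chain)
qed (simp_all add: tensor_map_linear frag_extend_linear)

lemma keys_tensor_map:
  assumes "keys c \<subseteq> A \<times> B" "\<And>x. x \<in> A \<Longrightarrow> keys (f x) \<subseteq> X" "\<And>y. y \<in> B \<Longrightarrow> keys (g y) \<subseteq> Y"
  shows "keys (tensor_map f g c) \<subseteq> X \<times> Y"
  unfolding tensor_map_def
proof (rule keys_frag_extend_subset[OF assms(1)])
  fix \<rho> assume "\<rho> \<in> A \<times> B"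
  thus "keys (case \<rho> of (\<sigma>, \<tau>) \<Rightarrow> cross_chain (f \<sigma>) (g \<tau>)) \<subseteq> X \<times> Y"
    using assms(2)[of "fst \<rho>"] assms(3)[of "snd \<rho>"] by (auto simp: keys_cross_chain)
qed

text \<open>The two parts of the boundary of a \<open>2\<close>-chain live on different cells, so a cycle is killed by
  the boundary in either factor.\<close>

lemma prod_cycle_partial_boundaries:
  assumes \<Gamma>: "simplicial_graph \<Gamma>" and c: "keys c \<subseteq> edges \<Gamma> \<times> edges \<Gamma>" and "prod_boundary c = 0"
  shows "tensor_map graph_bd frag_of c = 0" "tensor_map frag_of graph_bd c = 0"
proof -
  let ?A = "tensor_map graph_bd frag_of c" and ?B = "tensor_map frag_of graph_bd c"
  have c': "keys c \<subseteq> {\<sigma>. card \<sigma> = 2} \<times> {\<tau>. card \<tau> = 2}" using c by (auto simp: edges_def)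
  have eq: "?A = ?B" using assms(3) by (simp add: prod_boundary_edges[OF c'])
  have "keys ?A \<subseteq> nodes \<Gamma> \<times> edges \<Gamma>" "keys ?B \<subseteq> edges \<Gamma> \<times> nodes \<Gamma>"
    by (rule keys_tensor_map[OF c]; simp add: graph_bd_in_nodes[OF \<Gamma>] keys_frag_of)+
  hence "keys ?A \<subseteq> (nodes \<Gamma> \<inter> edges \<Gamma>) \<times> edges \<Gamma>" using eq by auto
  moreover have "nodes \<Gamma> \<inter> edges \<Gamma> = {}" by (auto simp: nodes_def edges_def)
  ultimately have "keys ?A = {}" by simp
  thus "?A = 0" "?B = 0" using eq by simp_all
qed

text \<open>A linear retraction of the \<open>1\<close>-chains onto the \<open>1\<close>-cycles.\<close>

definition cycle_projection :: "('a set \<Rightarrow> ('a set \<Rightarrow>\<^sub>0 int)) \<Rightarrow> 'a set \<Rightarrow> ('a set \<Rightarrow>\<^sub>0 int)" where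
  "cycle_projection h \<sigma> = frag_of \<sigma> - frag_extend h (graph_bd \<sigma>)"

text \<open>The surjectivity part of the Kuenneth theorem: the retraction onto the cycles, applied in both
  factors, fixes every \<open>2\<close>-cycle and thereby writes it as a sum of products of \<open>1\<close>-cycles.\<close>

lemma prod_cycle_decomposition:
  assumes \<Gamma>: "simplicial_graph \<Gamma>"
    and conn: "\<And>x y. x \<in> vertices \<Gamma> \<Longrightarrow> y \<in> vertices \<Gamma> \<Longrightarrow> (x, y) \<in> reachable \<Gamma>"
  obtains P where "\<And>\<sigma>. \<sigma> \<in> edges \<Gamma> \<Longrightarrow> keys (P \<sigma>) \<subseteq> edges \<Gamma> \<and> graph_boundary (P \<sigma>) = 0"
    "\<And>c. keys c \<subseteq> edges \<Gamma> \<times> edges \<Gamma> \<Longrightarrow> prod_boundary c = 0 \<Longrightarrow> tensor_map P P c = c"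
proof -
  obtain h b where h: "\<And>\<sigma>. keys (h \<sigma>) \<subseteq> edges \<Gamma>"
    "\<And>w. w \<in> vertices \<Gamma> \<Longrightarrow> graph_boundary (h {w}) = frag_of {w} - frag_of {b}"
  proof (cases "vertices \<Gamma> = {}")
    case True
    show ?thesis by (rule that[of "\<lambda>_. 0"]) (simp_all add: True)
  next
    case False
    then obtain b where "b \<in> vertices \<Gamma>" by blast
    with path_chains[of \<Gamma> "\<lambda>_. b"] conn that[of _ b] show ?thesis by metis
  qed
  define P where "P = cycle_projection h"
  have P: "keys (P \<sigma>) \<subseteq> edges \<Gamma> \<and> graph_boundary (P \<sigma>) = 0" if s: "\<sigma> \<in> edges \<Gamma>" for \<sigma>
  proof
    note bd = graph_bd_in_nodes[OF \<Gamma> s]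
    show "keys (P \<sigma>) \<subseteq> edges \<Gamma>"
      unfolding P_def cycle_projection_def
      by (intro keys_diff_subset keys_frag_extend_subset[OF bd] h) (simp add: keys_frag_of s)
    have "card \<sigma> = 2" using s by (simp add: edges_def)
    with edge_ends_vertices[OF \<Gamma> s] show "graph_boundary (P \<sigma>) = 0"
      by (simp add: P_def cycle_projection_def frag_extend_linear graph_bd_edge h)
  qed
  have "tensor_map P P c = c" if c: "keys c \<subseteq> edges \<Gamma> \<times> edges \<Gamma>" "prod_boundary c = 0" for c
  proof -
    let ?h = "\<lambda>\<sigma>. frag_extend h (graph_bd \<sigma>)"
    note z = prod_cycle_partial_boundaries[OF \<Gamma> c]
    have diff: "tensor_map P P c = tensor_map frag_of P c - tensor_map ?h P c" for c
      by (simp add: tensor_map_def P_def cycle_projection_def cross_chain_linear frag_extend_def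
          case_prod_unfold frag_cmul_diff sum_subtractf)
    have diff': "tensor_map frag_of P c = tensor_map frag_of frag_of c - tensor_map frag_of ?h c" for c
      by (simp add: tensor_map_def P_def cycle_projection_def cross_chain_linear frag_extend_def
          case_prod_unfold frag_cmul_diff sum_subtractf)
    have "tensor_map ?h P c = tensor_map h P (tensor_map graph_bd frag_of c)"
      by (simp add: tensor_map_compose)
    moreover have "tensor_map frag_of ?h c = tensor_map frag_of h (tensor_map frag_of graph_bd c)"
      by (simp add: tensor_map_compose)
    ultimately show ?thesis by (simp add: diff diff' z tensor_map_linear tensor_map_frag_of)
  qed
  with P that show ?thesis by blast
qed

section \<open>Pushing 1-chains off the diagonal\<close>

text \<open>The \<open>1\<close>-chains of the square that are homologous to a chain of the deleted product.\<close>

definition deformable :: "'a set set \<Rightarrow> ('a set \<times> 'a set \<Rightarrow>\<^sub>0 int) set" where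
  "deformable \<Gamma> = {x. \<exists>c. keys c \<subseteq> edges \<Gamma> \<times> edges \<Gamma> \<and> keys (x - prod_boundary c) \<subseteq> deleted_cells \<Gamma>}"

lemma deformable_diff:
  assumes "x \<in> deformable \<Gamma>" "y \<in> deformable \<Gamma>"
  shows "x - y \<in> deformable \<Gamma>"
proof -
  obtain c d where c: "keys c \<subseteq> edges \<Gamma> \<times> edges \<Gamma>" "keys (x - prod_boundary c) \<subseteq> deleted_cells \<Gamma>"
    and d: "keys d \<subseteq> edges \<Gamma> \<times> edges \<Gamma>" "keys (y - prod_boundary d) \<subseteq> deleted_cells \<Gamma>"
    using assms by (auto simp: deformable_def)
  have cd: "keys (c - d) \<subseteq> edges \<Gamma> \<times> edges \<Gamma>" by (rule keys_diff_subset[OF c(1) d(1)])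
  have eq: "(x - y) - prod_boundary (c - d) = (x - prod_boundary c) - (y - prod_boundary d)"
    by (simp add: frag_extend_diff)
  have "keys ((x - y) - prod_boundary (c - d)) \<subseteq> deleted_cells \<Gamma>"
    unfolding eq by (rule keys_diff_subset[OF c(2) d(2)])
  with cd show ?thesis by (auto simp: deformable_def)
qed

lemma deformable_if_deleted: "keys x \<subseteq> deleted_cells \<Gamma> \<Longrightarrow> x \<in> deformable \<Gamma>"
  by (auto simp: deformable_def intro!: exI[of _ 0])

lemma deformable_minus: "x \<in> deformable \<Gamma> \<Longrightarrow> - x \<in> deformable \<Gamma>"
  using deformable_diff[of 0 \<Gamma> x] deformable_if_deleted[of 0 \<Gamma>] by simp

lemma deformable_add: "x \<in> deformable \<Gamma> \<Longrightarrow> y \<in> deformable \<Gamma> \<Longrightarrow> x + y \<in> deformable \<Gamma>"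
  using deformable_diff[of x \<Gamma> "- y"] deformable_minus by fastforce

text \<open>The first point moves from \<open>y\<close> to \<open>x\<close>, where the second one waits; the boundary is
  \<open>(x, x) - (y, x)\<close>. In \<open>meet_right\<close> the roles are exchanged.\<close>

definition meet_left :: "'a \<Rightarrow> 'a \<Rightarrow> ('a set \<times> 'a set \<Rightarrow>\<^sub>0 int)" where
  "meet_left x y = cross_chain (edge_chain x y) (frag_of {x})"

definition meet_right :: "'a \<Rightarrow> 'a \<Rightarrow> ('a set \<times> 'a set \<Rightarrow>\<^sub>0 int)" where
  "meet_right x y = cross_chain (frag_of {x}) (edge_chain x y)"

lemma edge_chain_in_edges:
  "y \<in> neighbours \<Gamma> x \<Longrightarrow> keys (edge_chain x y) \<subseteq> edges \<Gamma>"
  by (auto simp: keys_edge_chain edges_def neighbours_def)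

lemma neighbours_sym: "y \<in> neighbours \<Gamma> x \<longleftrightarrow> x \<in> neighbours \<Gamma> y"
  by (auto simp: neighbours_def insert_commute)

lemma prod_boundary_two_edges:
  assumes "y \<in> neighbours \<Gamma> x" "z \<in> neighbours \<Gamma> x"
  shows "prod_boundary (cross_chain (edge_chain x y) (edge_chain x z))
      = (meet_right x z - cross_chain (frag_of {y}) (edge_chain x z))
        - (meet_left x y - cross_chain (edge_chain x y) (frag_of {z}))"
proof -
  have "keys (edge_chain x y) \<subseteq> {\<sigma>. card \<sigma> = 2}"
    using edge_chain_in_edges[OF assms(1)] edges_subset by blast
  moreover have "x \<noteq> y" "x \<noteq> z" using assms by (auto simp: neighbours_def)
  ultimately show ?thesis
    by (simp add: prod_boundary_cross_edges graph_boundary_edge_chain cross_chain_linear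
        meet_left_def meet_right_def)
qed

text \<open>The square of two different edges at \<open>x\<close> has only the corner \<open>(x, x)\<close> on the diagonal. Two of its
  sides lie in the deleted product, and the other two are the two ways into the corner.\<close>

lemma meet_left_minus_meet_right:
  assumes \<Gamma>: "simplicial_graph \<Gamma>" and yz: "y \<in> neighbours \<Gamma> x" "z \<in> neighbours \<Gamma> x" "y \<noteq> z"
  shows "meet_left x y - meet_right x z \<in> deformable \<Gamma>"
proof -
  let ?c = "- cross_chain (edge_chain x y) (edge_chain x z)"
  have "keys ?c \<subseteq> edges \<Gamma> \<times> edges \<Gamma>"
    using edge_chain_in_edges[OF yz(1)] edge_chain_in_edges[OF yz(2)] by (auto simp: keys_cross_chain)
  moreover have "meet_left x y - meet_right x z - prod_boundary ?c
      = cross_chain (edge_chain x y) (frag_of {z}) - cross_chain (frag_of {y}) (edge_chain x z)"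
    by (simp add: frag_extend_minus prod_boundary_two_edges[OF yz(1,2)])
  moreover have "keys \<dots> \<subseteq> deleted_cells \<Gamma>"
  proof (rule keys_diff_subset)
    have "{y} \<in> \<Gamma>" "{z} \<in> \<Gamma>" "{x, y} \<in> \<Gamma>" "{x, z} \<in> \<Gamma>" "x \<noteq> y" "x \<noteq> z"
      using yz simplicial_graph_face[OF \<Gamma>, of "{x, y}" "{y}"] simplicial_graph_face[OF \<Gamma>, of "{x, z}" "{z}"]
      by (auto simp: neighbours_def)
    thus "keys (cross_chain (edge_chain x y) (frag_of {z})) \<subseteq> deleted_cells \<Gamma>"
      "keys (cross_chain (frag_of {y}) (edge_chain x z)) \<subseteq> deleted_cells \<Gamma>"
      using yz(3) by (simp_all add: deleted_cells_eq[OF \<Gamma>] keys_cross_chain keys_edge_chain keys_frag_of)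
  qed
  ultimately show ?thesis unfolding deformable_def by (intro CollectI exI[of _ ?c]) simp
qed

text \<open>The square of an edge with itself has two corners on the diagonal, and its four sides are the ways
  into them.\<close>

lemma meet_difference_antisym:
  assumes "y \<in> neighbours \<Gamma> x"
  shows "(meet_left x y - meet_right x y) + (meet_left y x - meet_right y x) \<in> deformable \<Gamma>"
proof -
  let ?c = "- cross_chain (edge_chain x y) (edge_chain x y)"
  have "x \<noteq> y" using assms by (auto simp: neighbours_def)
  hence "(meet_left x y - meet_right x y) + (meet_left y x - meet_right y x) = prod_boundary ?c"
    by (simp add: frag_extend_minus prod_boundary_two_edges[OF assms assms] meet_left_def meet_right_def
        edge_chain_swap[of x y] cross_chain_linear)
  moreover have "keys ?c \<subseteq> edges \<Gamma> \<times> edges \<Gamma>"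
    using edge_chain_in_edges[OF assms] by (auto simp: keys_cross_chain)
  ultimately show ?thesis unfolding deformable_def by (intro CollectI exI[of _ ?c]) simp
qed

text \<open>At a balanced vertex all ways into \<open>(x, x)\<close> are homologous modulo the deleted product: ways along
  different edges are compared by \<open>meet_left_minus_meet_right\<close>.\<close>

definition balanced :: "'a set set \<Rightarrow> 'a \<Rightarrow> bool" where
  "balanced \<Gamma> x \<longleftrightarrow> (\<forall>y\<in>neighbours \<Gamma> x. meet_left x y - meet_right x y \<in> deformable \<Gamma>)"

text \<open>With two further edges at \<open>x\<close>, the two ways along \<open>y\<close> are connected by a chain of comparisons
  between different edges.\<close>

lemma balanced_branch_vertex:
  assumes \<Gamma>: "simplicial_graph \<Gamma>" and deg: "card (neighbours \<Gamma> x) \<ge> 3"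
  shows "balanced \<Gamma> x"
  unfolding balanced_def
proof
  fix y assume y: "y \<in> neighbours \<Gamma> x"
  have "card (neighbours \<Gamma> x - {y}) \<ge> 2" using deg y by (simp add: card_Diff_singleton)
  then obtain z z' where z: "z \<in> neighbours \<Gamma> x - {y}" "z' \<in> neighbours \<Gamma> x - {y}" "z \<noteq> z'"
    by (meson card_2_iff' obtain_subset_with_card_n subsetD)
  have "meet_left x y - meet_right x z \<in> deformable \<Gamma>" "meet_left x z' - meet_right x z \<in> deformable \<Gamma>"
    "meet_left x z' - meet_right x y \<in> deformable \<Gamma>"
    using z y by (auto intro!: meet_left_minus_meet_right[OF \<Gamma>])
  from deformable_add[OF deformable_diff[OF this(1,2)] this(3)]
  show "meet_left x y - meet_right x y \<in> deformable \<Gamma>" by simp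
qed

text \<open>The edge from \<open>x\<close> to \<open>y\<close> is balanced at \<open>y\<close> by antisymmetry, and every other edge at \<open>y\<close> is compared
  with it.\<close>

lemma balanced_neighbour:
  assumes \<Gamma>: "simplicial_graph \<Gamma>" and "balanced \<Gamma> x" and y: "y \<in> neighbours \<Gamma> x"
  shows "balanced \<Gamma> y"
  unfolding balanced_def
proof
  have "meet_left x y - meet_right x y \<in> deformable \<Gamma>" using assms by (simp add: balanced_def)
  from deformable_diff[OF meet_difference_antisym[OF y] this]
  have yx: "meet_left y x - meet_right y x \<in> deformable \<Gamma>" by simp
  fix z assume z: "z \<in> neighbours \<Gamma> y"
  show "meet_left y z - meet_right y z \<in> deformable \<Gamma>"
  proof (cases "z = x")
    case False
    have "x \<in> neighbours \<Gamma> y" using y neighbours_sym by fast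
    hence "meet_left y z - meet_right y x \<in> deformable \<Gamma>" "meet_left y x - meet_right y z \<in> deformable \<Gamma>"
      using False z by (auto intro!: meet_left_minus_meet_right[OF \<Gamma>])
    from deformable_add[OF deformable_diff[OF this(1) yx] this(2)] show ?thesis by simp
  qed (use yx in simp)
qed

lemma balanced_reachable:
  assumes "simplicial_graph \<Gamma>" "balanced \<Gamma> x" "(x, y) \<in> reachable \<Gamma>"
  shows "balanced \<Gamma> y"
  using assms(3) unfolding reachable_def
proof (induction)
  case (step y z)
  thus ?case using balanced_neighbour[OF assms(1), of y z] by (cases "y = z") (auto simp: neighbours_def)
qed (rule assms)

text \<open>One chosen way into \<open>(x, x)\<close> for each vertex \<open>x\<close>; the cells off the diagonal go to zero.\<close>

definition diagonal_chain :: "'a set set \<Rightarrow> 'a set \<times> 'a set \<Rightarrow> ('a set \<times> 'a set \<Rightarrow>\<^sub>0 int)" where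
  "diagonal_chain \<Gamma> = (\<lambda>(\<sigma>, \<tau>). if \<sigma> = \<tau> \<and> \<sigma> \<noteq> {}
     then meet_left (the_elem \<sigma>) (SOME y. y \<in> neighbours \<Gamma> (the_elem \<sigma>)) else 0)"

text \<open>Modulo deformable chains every edge of the square that touches the diagonal may be replaced by the
  chosen way into its end on the diagonal, so the boundary determines the chain.\<close>

lemma deformable_modulo_diagonal:
  assumes \<Gamma>: "simplicial_graph \<Gamma>" and bal: "\<And>x. x \<in> vertices \<Gamma> \<Longrightarrow> balanced \<Gamma> x"
    and x: "keys x \<subseteq> edges \<Gamma> \<times> nodes \<Gamma> \<union> nodes \<Gamma> \<times> edges \<Gamma>"
  shows "x - frag_extend (diagonal_chain \<Gamma>) (prod_boundary x) \<in> deformable \<Gamma>"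
    (is "?P x")
proof -
  let ?d = "frag_extend (diagonal_chain \<Gamma>)"
  have P_minus: "?P (- c)" if "?P c" for c
    using deformable_minus[OF that] by (simp add: frag_extend_minus)
  define n where "n = (\<lambda>x. SOME y. y \<in> neighbours \<Gamma> x)"
  have d: "diagonal_chain \<Gamma> ({w}, {w'}) = (if w = w' then meet_left w (n w) else 0)" for w w'
    by (simp add: diagonal_chain_def n_def)
  have meet: "?P (meet_left w y)" "?P (meet_right w y)" if w: "w \<in> vertices \<Gamma>" and y: "y \<in> neighbours \<Gamma> w" for w y
  proof -
    have ne: "w \<noteq> y" using y by (auto simp: neighbours_def)
    have n: "n w \<in> neighbours \<Gamma> w" using y unfolding n_def by (rule someI)
    have balw: "meet_left w z - meet_right w z \<in> deformable \<Gamma>" if "z \<in> neighbours \<Gamma> w" for z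
      using bal[OF w] that by (simp add: balanced_def)
    have L: "meet_left w y - meet_left w (n w) \<in> deformable \<Gamma>"
    proof (cases "y = n w")
      case True
      thus ?thesis by (simp add: deformable_if_deleted)
    next
      case False
      from deformable_diff[OF meet_left_minus_meet_right[OF \<Gamma> y n False] balw[OF n]]
      show ?thesis by simp
    qed
    have "keys (edge_chain w y) \<subseteq> {\<sigma>. card \<sigma> = 2}"
      using edge_chain_in_edges[OF y] edges_subset by blast
    hence "?d (prod_boundary (meet_left w y)) = meet_left w (n w)"
      using ne by (simp add: meet_left_def prod_boundary_cross_edges graph_boundary_edge_chain
          cross_chain_linear cross_chain_frag_of frag_extend_linear d graph_bd_def graph_dim_def)
    with L show "?P (meet_left w y)" by simp
    have "keys (frag_of {w}) \<subseteq> {\<sigma>. card \<sigma> = 1}" by (simp add: keys_frag_of)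
    hence "?d (prod_boundary (meet_right w y)) = meet_left w (n w)"
      using ne by (simp add: meet_right_def prod_boundary_cross_vertices graph_boundary_edge_chain
          cross_chain_linear cross_chain_frag_of frag_extend_linear d)
    moreover have "meet_right w y - meet_left w (n w) \<in> deformable \<Gamma>"
      using deformable_diff[OF L balw[OF y]] by simp
    ultimately show "?P (meet_right w y)" by simp
  qed
  have adjacent: "\<exists>y\<in>neighbours \<Gamma> w. \<sigma> = {w, y}" if "\<sigma> \<in> edges \<Gamma>" "w \<in> \<sigma>" for \<sigma> w
    using that by (auto simp: edges_def card_2_iff neighbours_def insert_commute doubleton_eq_iff)
  have deleted: "({w}, \<sigma>) \<in> deleted_cells \<Gamma>" "(\<sigma>, {w}) \<in> deleted_cells \<Gamma>"
    if "\<sigma> \<in> edges \<Gamma>" "{w} \<in> \<Gamma>" "w \<notin> \<sigma>" for \<sigma> w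
    using that by (auto simp: deleted_cells_eq[OF \<Gamma>] edges_def)
  have left: "?P (frag_of (\<sigma>, {w}))" if s: "\<sigma> \<in> edges \<Gamma>" and w: "w \<in> vertices \<Gamma>" for \<sigma> w
  proof (cases "w \<in> \<sigma>")
    case True
    then obtain y where y: "y \<in> neighbours \<Gamma> w" "\<sigma> = {w, y}" using adjacent[OF s] by blast
    have "frag_of (\<sigma>, {w}) = meet_left w y \<or> frag_of (\<sigma>, {w}) = - meet_left w y"
      using frag_of_edge_chain[of w y] y(2)
      by (auto simp: meet_left_def cross_chain_linear simp flip: cross_chain_frag_of)
    thus ?thesis using meet(1)[OF w y(1)] P_minus by metis
  next
    case False
    have c: "card \<sigma> = 2" using s by (simp add: edges_def)
    have "edge_head \<sigma> \<noteq> w" "edge_tail \<sigma> \<noteq> w" using edge_ends(1)[OF c] False by auto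
    hence "?d (prod_boundary (frag_of (\<sigma>, {w}))) = 0"
      using c by (simp add: prod_boundary_cross_edges keys_frag_of graph_bd_edge cross_chain_linear
          frag_extend_linear d graph_boundary_vertices flip: cross_chain_frag_of)
        (simp add: cross_chain_frag_of d graph_bd_def graph_dim_def cross_chain_linear)
    thus ?thesis using deleted(2)[OF s _ False] w
      by (simp add: deformable_if_deleted keys_frag_of vertices_def)
  qed
  have right: "?P (frag_of ({w}, \<sigma>))" if s: "\<sigma> \<in> edges \<Gamma>" and w: "w \<in> vertices \<Gamma>" for \<sigma> w
  proof (cases "w \<in> \<sigma>")
    case True
    then obtain y where y: "y \<in> neighbours \<Gamma> w" "\<sigma> = {w, y}" using adjacent[OF s] by blast
    have "frag_of ({w}, \<sigma>) = meet_right w y \<or> frag_of ({w}, \<sigma>) = - meet_right w y"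
      using frag_of_edge_chain[of w y] y(2)
      by (auto simp: meet_right_def cross_chain_linear simp flip: cross_chain_frag_of)
    thus ?thesis using meet(2)[OF w y(1)] P_minus by metis
  next
    case False
    have c: "card \<sigma> = 2" using s by (simp add: edges_def)
    have "edge_head \<sigma> \<noteq> w" "edge_tail \<sigma> \<noteq> w" using edge_ends(1)[OF c] False by auto
    hence "?d (prod_boundary (frag_of ({w}, \<sigma>))) = 0"
      using c by (simp add: prod_boundary_cross_vertices keys_frag_of graph_bd_edge cross_chain_linear
          frag_extend_linear flip: cross_chain_frag_of)
        (simp add: cross_chain_frag_of d)
    thus ?thesis using deleted(1)[OF s _ False] w
      by (simp add: deformable_if_deleted keys_frag_of vertices_def)
  qed
  show ?thesis using x
  proof (induction x rule: frag_induction)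
    case zero
    show ?case by (simp add: deformable_if_deleted)
  next
    case (one \<rho>)
    thus ?case using left right by (auto simp: nodes_eq)
  next
    case (diff a b)
    from deformable_diff[OF this] show ?case by (simp add: frag_extend_diff algebra_simps)
  qed
qed

text \<open>All vertices are balanced, since balance spreads from the branch vertex. This proves that the first
  homology of the square relative to the deleted product vanishes.\<close>

proposition deformable_if_relative_cycle:
  assumes \<Gamma>: "simplicial_graph \<Gamma>"
    and conn: "\<And>x y. x \<in> vertices \<Gamma> \<Longrightarrow> y \<in> vertices \<Gamma> \<Longrightarrow> (x, y) \<in> reachable \<Gamma>"
    and branch: "b \<in> vertices \<Gamma>" "card (neighbours \<Gamma> b) \<ge> 3"
    and x: "keys x \<subseteq> edges \<Gamma> \<times> nodes \<Gamma> \<union> nodes \<Gamma> \<times> edges \<Gamma>"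
    and bd: "keys (prod_boundary x) \<subseteq> deleted_cells \<Gamma>"
  obtains c where "keys c \<subseteq> edges \<Gamma> \<times> edges \<Gamma>" "keys (x - prod_boundary c) \<subseteq> deleted_cells \<Gamma>"
proof -
  have "balanced \<Gamma> y" if "y \<in> vertices \<Gamma>" for y
    by (rule balanced_reachable[OF \<Gamma> balanced_branch_vertex[OF \<Gamma> branch(2)] conn[OF branch(1) that]])
  hence "x - frag_extend (diagonal_chain \<Gamma>) (prod_boundary x) \<in> deformable \<Gamma>"
    using deformable_modulo_diagonal[OF \<Gamma> _ x] by blast
  moreover have "frag_extend (diagonal_chain \<Gamma>) (prod_boundary x) = 0"
    using bd by (intro frag_extend_eq_0) (auto simp: deleted_cells_eq[OF \<Gamma>] diagonal_chain_def)
  ultimately show ?thesis using that by (auto simp: deformable_def)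
qed

section \<open>The cokernel of the intersection form\<close>

subsection \<open>Iterated quotients of abelian groups\<close>

lemma (in comm_group) rcos_eq_iff:
  assumes "subgroup N G" "a \<in> carrier G" "b \<in> carrier G"
  shows "N #> a = N #> b \<longleftrightarrow> a \<otimes> inv b \<in> N"
proof
  assume "N #> a = N #> b"
  hence "a \<in> N #> b" using rcos_self[OF assms(2,1)] by simp
  then obtain n where "n \<in> N" "a = n \<otimes> b" by (auto simp: r_coset_def)
  thus "a \<otimes> inv b \<in> N"
    using assms subgroup.mem_carrier[OF assms(1)] by (simp add: m_assoc)
next
  assume *: "a \<otimes> inv b \<in> N"
  have "a = (a \<otimes> inv b) \<otimes> b" using assms by (simp add: m_assoc)
  hence "a \<in> N #> b" using * by (auto simp: r_coset_def)
  thus "N #> a = N #> b" using repr_independence assms by metis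
qed

text \<open>The group \<open>Q\<close> is a quotient of a quotient. Its elements are represented by elements of the original
  group, and the last equivalence decides when two of them represent the same element.\<close>

lemma (in comm_group) double_quotient:
  assumes N: "subgroup N G" and M: "subgroup M (G Mod N)"
  shows "comm_group (G Mod N Mod M)"
    "(\<lambda>g. M #>\<^bsub>G Mod N\<^esub> (N #> g)) \<in> hom G (G Mod N Mod M)"
    "carrier (G Mod N Mod M) = (\<lambda>g. M #>\<^bsub>G Mod N\<^esub> (N #> g)) ` carrier G"
    "a \<in> carrier G \<Longrightarrow> b \<in> carrier G \<Longrightarrow>
       M #>\<^bsub>G Mod N\<^esub> (N #> a) = M #>\<^bsub>G Mod N\<^esub> (N #> b) \<longleftrightarrow> N #> (a \<otimes> inv b) \<in> M"
proof -
  interpret N: normal N G by (rule subgroup_imp_normal[OF N])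
  interpret GN: comm_group "G Mod N" by (rule abelian_FactGroup[OF N])
  interpret M: normal M "G Mod N" by (rule GN.subgroup_imp_normal[OF M])
  show "comm_group (G Mod N Mod M)" by (rule GN.abelian_FactGroup[OF M])
  interpret h: group_hom G "G Mod N" "\<lambda>g. N #> g"
    using N.r_coset_hom_Mod by (simp add: group_hom_def group_hom_axioms_def is_group GN.is_group)
  interpret m: group_hom "G Mod N" "G Mod N Mod M" "\<lambda>X. M #>\<^bsub>G Mod N\<^esub> X"
    using M.r_coset_hom_Mod M.factorgroup_is_group
    by (simp only: group_hom_def group_hom_axioms_def GN.is_group simp_thms)
  show "(\<lambda>g. M #>\<^bsub>G Mod N\<^esub> (N #> g)) \<in> hom G (G Mod N Mod M)"
  proof (rule homI)
    fix a b assume ab: "a \<in> carrier G" "b \<in> carrier G"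
    show "M #>\<^bsub>G Mod N\<^esub> (N #> a) \<in> carrier (G Mod N Mod M)"
      by (rule m.hom_closed[OF h.hom_closed[OF ab(1)]])
    show "M #>\<^bsub>G Mod N\<^esub> (N #> (a \<otimes> b))
        = (M #>\<^bsub>G Mod N\<^esub> (N #> a)) \<otimes>\<^bsub>G Mod N Mod M\<^esub> (M #>\<^bsub>G Mod N\<^esub> (N #> b))"
      by (simp only: h.hom_mult[OF ab] m.hom_mult[OF h.hom_closed[OF ab(1)] h.hom_closed[OF ab(2)]])
  qed
  show "carrier (G Mod N Mod M) = (\<lambda>g. M #>\<^bsub>G Mod N\<^esub> (N #> g)) ` carrier G"
    by (simp only: carrier_FactGroup image_image)
  assume ab: "a \<in> carrier G" "b \<in> carrier G"
  have "(N #> a) \<otimes>\<^bsub>G Mod N\<^esub> inv\<^bsub>G Mod N\<^esub> (N #> b) = N #> (a \<otimes> inv b)"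
    by (simp only: h.hom_mult[OF ab(1) inv_closed[OF ab(2)]] h.hom_inv[OF ab(2)])
  moreover have "N #> a \<in> carrier (G Mod N)" "N #> b \<in> carrier (G Mod N)"
    by (rule h.hom_closed[OF ab(1)], rule h.hom_closed[OF ab(2)])
  ultimately show "M #>\<^bsub>G Mod N\<^esub> (N #> a) = M #>\<^bsub>G Mod N\<^esub> (N #> b) \<longleftrightarrow> N #> (a \<otimes> inv b) \<in> M"
    using GN.rcos_eq_iff[OF M, of "N #> a" "N #> b"] by (simp only:)
qed

text \<open>All members of the union that defines \<open>induced_map\<close> coincide, so any representative computes it.\<close>

lemma induced_map_rcos:
  assumes f: "group_hom G H f" and N: "subgroup N G" and N': "subgroup N' H"
    and sub: "f ` N \<subseteq> N'" and g: "g \<in> carrier G"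
  shows "induced_map H N' f (N #>\<^bsub>G\<^esub> g) = N' #>\<^bsub>H\<^esub> f g"
proof -
  interpret f: group_hom G H f by (rule f)
  have "N' #>\<^bsub>H\<^esub> f (n \<otimes>\<^bsub>G\<^esub> g) = N' #>\<^bsub>H\<^esub> f g" if "n \<in> N" for n
  proof -
    have n: "n \<in> carrier G" "f n \<in> N'" using that subgroup.mem_carrier[OF N] sub by auto
    have "N' #>\<^bsub>H\<^esub> f (n \<otimes>\<^bsub>G\<^esub> g) = (N' #>\<^bsub>H\<^esub> f n) #>\<^bsub>H\<^esub> f g"
      using n g subgroup.subset[OF N'] by (simp add: f.H.coset_mult_assoc)
    also have "N' #>\<^bsub>H\<^esub> f n = N'" using n N' by (simp add: f.H.coset_join2)
    finally show ?thesis .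
  qed
  moreover have "N \<noteq> {}" using subgroup.one_closed[OF N] by blast
  ultimately show ?thesis unfolding induced_map_def r_coset_def[of G] by auto
qed

subsection \<open>Homology in the top dimension\<close>

lemma subgroup_cell_relcycles:
  "subgroup {c \<in> carrier (cell_chains deg p K). keys (frag_extend bd c) \<subseteq> L} (cell_chains deg p K)"
proof -
  interpret comm_group "cell_chains deg p K"
    unfolding cell_chains_def by (rule abelian_free_Abelian_group)
  show ?thesis
  proof (rule subgroupI)
    show "{c \<in> carrier (cell_chains deg p K). keys (frag_extend bd c) \<subseteq> L} \<noteq> {}"
      by (auto simp: cell_chains_def intro: exI[of _ 0])
  next
    fix a assume "a \<in> {c \<in> carrier (cell_chains deg p K). keys (frag_extend bd c) \<subseteq> L}"
    thus "inv\<^bsub>cell_chains deg p K\<^esub> a \<in> {c \<in> carrier (cell_chains deg p K). keys (frag_extend bd c) \<subseteq> L}"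
      by (simp add: cell_chains_def frag_extend_minus)
  next
    fix a b assume "a \<in> {c \<in> carrier (cell_chains deg p K). keys (frag_extend bd c) \<subseteq> L}"
      "b \<in> {c \<in> carrier (cell_chains deg p K). keys (frag_extend bd c) \<subseteq> L}"
    thus "a \<otimes>\<^bsub>cell_chains deg p K\<^esub> b \<in> {c \<in> carrier (cell_chains deg p K). keys (frag_extend bd c) \<subseteq> L}"
      by (simp add: cell_chains_def frag_extend_add keys_add_subset)
  qed auto
qed

lemma carrier_cell_relcycles:
  "carrier (cell_relcycles deg bd p K L)
     = {c. keys c \<subseteq> {\<sigma> \<in> K. deg \<sigma> = p} \<and> keys (frag_extend bd c) \<subseteq> L}"
  unfolding cell_relcycles_def subgroup.carrier_subgroup_generated_subgroup[OF subgroup_cell_relcycles]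
  by (simp add: cell_chains_def)

lemma cell_relcycles_simps:
  "mult (cell_relcycles deg bd p K L) = (+)" "one (cell_relcycles deg bd p K L) = 0"
  by (rule ext | simp add: cell_relcycles_def cell_chains_def)+

lemma comm_group_cell_relcycles: "comm_group (cell_relcycles deg bd p K L)"
  unfolding cell_relcycles_def cell_chains_def
  using abelian_free_Abelian_group by (intro group.abelian_subgroup_generated) auto

lemma inv_cell_relcycles:
  assumes "c \<in> carrier (cell_relcycles deg bd p K L)"
  shows "inv\<^bsub>cell_relcycles deg bd p K L\<^esub> c = - c"
proof -
  interpret comm_group "cell_relcycles deg bd p K L" by (rule comm_group_cell_relcycles)
  have "- c \<in> carrier (cell_relcycles deg bd p K L)"
    using assms by (simp add: carrier_cell_relcycles frag_extend_minus)
  thus ?thesis using assms by (intro inv_equality) (simp_all add: cell_relcycles_simps)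
qed

lemma int_pow_cell_relcycles:
  assumes "c \<in> carrier (cell_relcycles deg bd p K L)"
  shows "c [^]\<^bsub>cell_relcycles deg bd p K L\<^esub> (k::int) = frag_cmul k c"
proof -
  let ?G = "cell_relcycles deg bd p K L"
  interpret comm_group ?G by (rule comm_group_cell_relcycles)
  have nat: "c [^]\<^bsub>?G\<^esub> (n::nat) = frag_cmul (int n) c" for n
    by (induction n) (simp_all add: cell_relcycles_simps frag_cmul_distrib add.commute)
  show ?thesis
  proof (cases k)
    case (nonneg n)
    show ?thesis unfolding nonneg int_pow_int by (rule nat)
  next
    case (neg n)
    have "frag_cmul (int (Suc n)) c \<in> carrier ?G"
      using nat_pow_closed[OF assms, of "Suc n"] by (simp only: nat)
    hence "inv\<^bsub>?G\<^esub> (frag_cmul (int (Suc n)) c) = frag_cmul (- int (Suc n)) c"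
      by (simp only: inv_cell_relcycles minus_frag_cmul)
    thus ?thesis unfolding neg int_pow_neg_int[OF assms] nat .
  qed
qed

definition cycles :: "'a set set \<Rightarrow> ('a set \<Rightarrow>\<^sub>0 int) set" where
  "cycles \<Gamma> = {c. keys c \<subseteq> edges \<Gamma> \<and> graph_boundary c = 0}"

definition prod_cycles :: "'a set set \<Rightarrow> ('a set \<times> 'a set \<Rightarrow>\<^sub>0 int) set" where
  "prod_cycles \<Gamma> = {c. keys c \<subseteq> edges \<Gamma> \<times> edges \<Gamma> \<and> prod_boundary c = 0}"

definition relative_cycles :: "'a set set \<Rightarrow> ('a set \<times> 'a set \<Rightarrow>\<^sub>0 int) set" where
  "relative_cycles \<Gamma> = {c. keys c \<subseteq> edges \<Gamma> \<times> edges \<Gamma> \<and> keys (prod_boundary c) \<subseteq> deleted_cells \<Gamma>}"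

definition deleted_chains :: "'a set set \<Rightarrow> ('a set \<times> 'a set \<Rightarrow>\<^sub>0 int) set" where
  "deleted_chains \<Gamma> = {c. keys c \<subseteq> deleted_cells \<Gamma> \<inter> edges \<Gamma> \<times> edges \<Gamma>}"

text \<open>The relative cycles that represent zero in the cokernel.\<close>

definition null_cycles :: "'a set set \<Rightarrow> ('a set \<times> 'a set \<Rightarrow>\<^sub>0 int) set" where
  "null_cycles \<Gamma> = {l + z | l z. l \<in> deleted_chains \<Gamma> \<and> z \<in> prod_cycles \<Gamma>}"

lemma chain_dimensions:
  assumes "simplicial_graph \<Gamma>"
  shows "{\<sigma> \<in> \<Gamma>. graph_dim \<sigma> = 1} = edges \<Gamma>" "{\<sigma> \<in> \<Gamma>. graph_dim \<sigma> = 2} = {}"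
    "{\<sigma> \<in> \<Gamma> \<times> \<Gamma>. prod_dim \<sigma> = 2} = edges \<Gamma> \<times> edges \<Gamma>" "{\<sigma> \<in> \<Gamma> \<times> \<Gamma>. prod_dim \<sigma> = Suc 2} = {}"
proof -
  have "card \<sigma> = 1 \<or> card \<sigma> = 2" if "\<sigma> \<in> \<Gamma>" for \<sigma>
    using that assms unfolding simplicial_graph_def by blast
  hence dim: "graph_dim \<sigma> = 0 \<and> card \<sigma> = 1 \<or> graph_dim \<sigma> = 1 \<and> card \<sigma> = 2" if "\<sigma> \<in> \<Gamma>" for \<sigma>
    using that by (fastforce simp: graph_dim_def)
  have d1: "graph_dim \<sigma> = 1 \<longleftrightarrow> card \<sigma> = 2" "graph_dim \<sigma> \<noteq> 2" if "\<sigma> \<in> \<Gamma>" for \<sigma>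
    using dim[OF that] by linarith+
  have d2: "prod_dim (\<sigma>, \<tau>) = 2 \<longleftrightarrow> card \<sigma> = 2 \<and> card \<tau> = 2" "prod_dim (\<sigma>, \<tau>) \<noteq> Suc 2"
    if "\<sigma> \<in> \<Gamma>" "\<tau> \<in> \<Gamma>" for \<sigma> \<tau>
    using dim[OF that(1)] dim[OF that(2)] unfolding prod_dim_def prod.case by linarith+
  show "{\<sigma> \<in> \<Gamma>. graph_dim \<sigma> = 1} = edges \<Gamma>" "{\<sigma> \<in> \<Gamma>. graph_dim \<sigma> = 2} = {}"
    unfolding edges_def using d1 by blast+
  show "{\<sigma> \<in> \<Gamma> \<times> \<Gamma>. prod_dim \<sigma> = 2} = edges \<Gamma> \<times> edges \<Gamma>" "{\<sigma> \<in> \<Gamma> \<times> \<Gamma>. prod_dim \<sigma> = Suc 2} = {}"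
    unfolding edges_def using d2 by blast+
qed

locale graph =
  fixes \<Gamma> :: "'a set set"
  assumes simplicial: "simplicial_graph \<Gamma>"
begin

lemmas dims = chain_dimensions[OF simplicial]

lemma carrier_Z1: "carrier (cell_relcycles graph_dim graph_bd 1 \<Gamma> {}) = cycles \<Gamma>"
  unfolding carrier_cell_relcycles dims cycles_def by simp

lemma carrier_Z2_prod: "carrier (Z2_prod \<Gamma>) = prod_cycles \<Gamma>"
  unfolding carrier_cell_relcycles dims prod_cycles_def by simp

lemma carrier_Z2_rel: "carrier (Z2_rel \<Gamma>) = relative_cycles \<Gamma>"
  unfolding carrier_cell_relcycles dims relative_cycles_def by simp

lemma B1_eq: "cell_relbds graph_dim graph_bd 1 \<Gamma> {} = {0}"
  unfolding cell_relbds_def cell_chains_def by (simp add: dims del: One_nat_def)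

lemma B2_prod_eq: "B2_prod \<Gamma> = {0}"
  unfolding cell_relbds_def cell_chains_def by (simp add: dims del: Suc_numeral)

lemma deleted_cells_subset: "deleted_cells \<Gamma> \<subseteq> \<Gamma> \<times> \<Gamma>"
  by (auto simp: deleted_cells_def)

lemma B2_rel_eq: "B2_rel \<Gamma> = deleted_chains \<Gamma>"
proof -
  have "{\<sigma> \<in> deleted_cells \<Gamma>. prod_dim \<sigma> = 2} = deleted_cells \<Gamma> \<inter> edges \<Gamma> \<times> edges \<Gamma>"
    using dims(3) deleted_cells_subset by blast
  thus ?thesis
    unfolding cell_relbds_def cell_chains_def deleted_chains_def by (simp add: dims del: Suc_numeral)
qed

lemma prod_boundary_deleted:
  assumes "l \<in> deleted_chains \<Gamma>"
  shows "keys (prod_boundary l) \<subseteq> deleted_cells \<Gamma>"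
proof -
  have "keys l \<subseteq> deleted_cells \<Gamma> \<inter> edges \<Gamma> \<times> edges \<Gamma>" using assms by (simp add: deleted_chains_def)
  thus ?thesis
  proof (induction l rule: frag_induction)
    case (one \<rho>)
    then obtain \<sigma> \<tau> where st: "\<rho> = (\<sigma>, \<tau>)" "\<sigma> \<in> edges \<Gamma>" "\<tau> \<in> edges \<Gamma>" "\<sigma> \<inter> \<tau> = {}"
      by (auto simp: deleted_cells_eq[OF simplicial])
    have bd: "keys (graph_bd \<sigma>) \<subseteq> {{x} | x. x \<in> \<sigma> \<and> {x} \<in> \<Gamma>}" if "\<sigma> \<in> edges \<Gamma>" for \<sigma>
    proof -
      have c: "card \<sigma> = 2" using that by (simp add: edges_def)
      have "edge_head \<sigma> \<in> \<sigma>" "edge_tail \<sigma> \<in> \<sigma>" using edge_ends(1)[OF c] by blast+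
      thus ?thesis using edge_ends_vertices[OF simplicial that] unfolding graph_bd_edge[OF c]
        by (intro keys_diff_subset) (auto simp: keys_frag_of vertices_def)
    qed
    have "keys (frag_of \<sigma>) \<subseteq> {\<sigma>. card \<sigma> = 2}" using st by (simp add: keys_frag_of edges_def)
    moreover have "keys (cross_chain (graph_bd \<sigma>) (frag_of \<tau>)) \<subseteq> deleted_cells \<Gamma>"
      "keys (cross_chain (frag_of \<sigma>) (graph_bd \<tau>)) \<subseteq> deleted_cells \<Gamma>"
      using bd[OF st(2)] bd[OF st(3)] st
      by (fastforce simp: keys_cross_chain keys_frag_of deleted_cells_eq[OF simplicial] edges_def)+
    ultimately show ?case
      using st by (simp add: prod_boundary_cross_edges keys_diff_subset flip: cross_chain_frag_of)
  qed (simp_all add: frag_extend_diff keys_diff_subset)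
qed

lemma deleted_chains_subset: "deleted_chains \<Gamma> \<subseteq> relative_cycles \<Gamma>"
  using prod_boundary_deleted by (auto simp: deleted_chains_def relative_cycles_def)

lemma prod_cycles_subset: "prod_cycles \<Gamma> \<subseteq> relative_cycles \<Gamma>"
  by (auto simp: prod_cycles_def relative_cycles_def)

lemma comm_group_Z2_rel: "comm_group (Z2_rel \<Gamma>)"
  by (rule comm_group_cell_relcycles)

lemma subgroup_Z2_rel:
  assumes "X \<subseteq> relative_cycles \<Gamma>" "0 \<in> X" "\<And>a b. a \<in> X \<Longrightarrow> b \<in> X \<Longrightarrow> a - b \<in> X"
  shows "subgroup X (Z2_rel \<Gamma>)"
proof -
  interpret comm_group "Z2_rel \<Gamma>" by (rule comm_group_Z2_rel)
  have minus: "- a \<in> X" if "a \<in> X" for a using assms(3)[OF assms(2) that] by simp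
  show ?thesis
  proof (rule subgroupI)
    fix a assume a: "a \<in> X"
    hence "a \<in> carrier (Z2_rel \<Gamma>)" using assms(1) carrier_Z2_rel by blast
    thus "inv\<^bsub>Z2_rel \<Gamma>\<^esub> a \<in> X" using minus[OF a] inv_cell_relcycles by metis
    fix b assume "b \<in> X"
    thus "a \<otimes>\<^bsub>Z2_rel \<Gamma>\<^esub> b \<in> X" using assms(3)[OF a minus] by (simp add: cell_relcycles_simps)
  qed (use assms in \<open>auto simp: carrier_Z2_rel\<close>)
qed

lemma subgroup_deleted_chains: "subgroup (deleted_chains \<Gamma>) (Z2_rel \<Gamma>)"
  by (rule subgroup_Z2_rel[OF deleted_chains_subset]) (simp_all add: deleted_chains_def keys_diff_subset)

lemma subgroup_prod_cycles: "subgroup (prod_cycles \<Gamma>) (Z2_rel \<Gamma>)"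
  by (rule subgroup_Z2_rel[OF prod_cycles_subset]) (simp_all add: prod_cycles_def keys_diff_subset frag_extend_diff)

text \<open>Without cells in the next dimension, a homology class is a single cycle.\<close>

lemma rcos_zero:
  "{0} #>\<^bsub>cell_relcycles deg bd p K L\<^esub> c = {c}"
  by (simp add: r_coset_def cell_relcycles_simps)

lemma carrier_H1: "carrier (H1 \<Gamma>) = (\<lambda>z. {z}) ` cycles \<Gamma>"
  unfolding cell_homology_def carrier_FactGroup carrier_Z1 B1_eq by (simp add: rcos_zero)

lemma H1_mult: "{z} \<otimes>\<^bsub>H1 \<Gamma>\<^esub> {w} = {z + w}"
  by (simp add: cell_homology_def set_mult_def cell_relcycles_simps)

lemmas H1_simps = carrier_H1 carrier_H1[unfolded One_nat_def] H1_mult H1_mult[unfolded One_nat_def]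

lemma homology_cross_singleton: "homology_cross \<Gamma> {z} {w} = {cross_chain z w}"
  by (simp add: homology_cross_def B2_prod_eq rcos_zero)

lemma cross_chain_in_prod_cycles:
  "z \<in> cycles \<Gamma> \<Longrightarrow> w \<in> cycles \<Gamma> \<Longrightarrow> cross_chain z w \<in> prod_cycles \<Gamma>"
  unfolding cycles_def prod_cycles_def
  using edges_subset[of \<Gamma>] by (auto simp: keys_cross_chain prod_boundary_cross_edges cross_chain_linear)

lemma subgroup_zero: "subgroup {0} (Z2_prod \<Gamma>)"
proof -
  interpret comm_group "Z2_prod \<Gamma>" by (rule comm_group_cell_relcycles)
  show ?thesis using triv_subgroup by (simp add: cell_relcycles_simps)
qed

lemma comm_group_H2_prod: "comm_group (H2_prod \<Gamma>)"
proof -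
  interpret comm_group "Z2_prod \<Gamma>" by (rule comm_group_cell_relcycles)
  show ?thesis unfolding cell_homology_def B2_prod_eq by (rule abelian_FactGroup[OF subgroup_zero])
qed

lemma singleton_hom: "group_hom (Z2_prod \<Gamma>) (H2_prod \<Gamma>) (\<lambda>z. {z})"
proof -
  interpret G: comm_group "Z2_prod \<Gamma>" by (rule comm_group_cell_relcycles)
  interpret H: comm_group "H2_prod \<Gamma>" by (rule comm_group_H2_prod)
  interpret normal "{0}" "Z2_prod \<Gamma>" by (rule G.subgroup_imp_normal[OF subgroup_zero])
  show ?thesis
    using r_coset_hom_Mod factorgroup_is_group G.is_group
    by (simp add: group_hom_def group_hom_axioms_def rcos_zero cell_homology_def B2_prod_eq)
qed

lemma singleton_pow:
  assumes "c \<in> prod_cycles \<Gamma>"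
  shows "{c} [^]\<^bsub>H2_prod \<Gamma>\<^esub> k = {frag_cmul k c}" "frag_cmul k c \<in> prod_cycles \<Gamma>"
    "{c} \<in> carrier (H2_prod \<Gamma>)"
proof -
  interpret s: group_hom "Z2_prod \<Gamma>" "H2_prod \<Gamma>" "\<lambda>z. {z}" by (rule singleton_hom)
  have c: "c \<in> carrier (Z2_prod \<Gamma>)" using assms by (simp only: carrier_Z2_prod)
  show "{c} [^]\<^bsub>H2_prod \<Gamma>\<^esub> k = {frag_cmul k c}"
    using s.hom_int_pow[OF c, of k] by (simp only: int_pow_cell_relcycles[OF c])
  show "frag_cmul k c \<in> prod_cycles \<Gamma>"
    using s.G.int_pow_closed[OF c, of k] by (simp only: int_pow_cell_relcycles[OF c] carrier_Z2_prod)
  show "{c} \<in> carrier (H2_prod \<Gamma>)" by (rule s.hom_closed[OF c])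
qed

lemma finprod_singletons:
  assumes "finite A" "\<And>i. i \<in> A \<Longrightarrow> z i \<in> prod_cycles \<Gamma>"
  shows "finprod (H2_prod \<Gamma>) (\<lambda>i. {z i} [^]\<^bsub>H2_prod \<Gamma>\<^esub> (n i :: int)) A = {\<Sum>i\<in>A. frag_cmul (n i) (z i)}
    \<and> (\<Sum>i\<in>A. frag_cmul (n i) (z i)) \<in> prod_cycles \<Gamma>"
proof -
  interpret H: comm_group "H2_prod \<Gamma>" by (rule comm_group_H2_prod)
  interpret s: group_hom "Z2_prod \<Gamma>" "H2_prod \<Gamma>" "\<lambda>z. {z}" by (rule singleton_hom)
  note pow = singleton_pow
  show ?thesis using assms
  proof (induction A rule: finite_induct)
    case empty
    show ?case using s.hom_one s.G.one_closed unfolding carrier_Z2_prod by (simp add: cell_relcycles_simps)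
  next
    case (insert i A)
    let ?S = "\<Sum>i\<in>A. frag_cmul (n i) (z i)"
    have IH: "finprod (H2_prod \<Gamma>) (\<lambda>i. {z i} [^]\<^bsub>H2_prod \<Gamma>\<^esub> n i) A = {?S}" "?S \<in> prod_cycles \<Gamma>"
      using insert by auto
    have "finprod (H2_prod \<Gamma>) (\<lambda>i. {z i} [^]\<^bsub>H2_prod \<Gamma>\<^esub> n i) (insert i A)
        = {frag_cmul (n i) (z i)} \<otimes>\<^bsub>H2_prod \<Gamma>\<^esub> {?S}"
      using insert pow IH by (subst H.finprod_insert) auto
    also have "\<dots> = {frag_cmul (n i) (z i) + ?S}"
      using s.hom_mult[of "frag_cmul (n i) (z i)" ?S] pow(2)[of "z i" "n i"] insert.prems IH(2)
      unfolding carrier_Z2_prod by (simp add: cell_relcycles_simps)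
    finally show ?case
      using insert s.G.m_closed[of "frag_cmul (n i) (z i)" ?S] pow(2)[of "z i" "n i"] IH(2)
      unfolding carrier_Z2_prod by (simp add: cell_relcycles_simps)
  qed
qed

subsection \<open>The Kuenneth map and the cokernel\<close>

text \<open>On representatives the Kuenneth map sends \<open>z \<otimes> w\<close> to \<open>z \<times> w\<close>.\<close>

definition cross_lift ::
    "(('a set \<Rightarrow>\<^sub>0 int) set \<times> ('a set \<Rightarrow>\<^sub>0 int) set \<Rightarrow>\<^sub>0 int) \<Rightarrow> ('a set \<times> 'a set \<Rightarrow>\<^sub>0 int)" where
  "cross_lift = frag_extend (\<lambda>(Z, W). cross_chain (the_elem Z) (the_elem W))"

text \<open>Homology classes are singletons here, so the product of powers in the homology group is the
  corresponding linear combination of cycles.\<close>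

lemma finprod_homology_cross:
  assumes "keys c \<subseteq> carrier (H1 \<Gamma>) \<times> carrier (H1 \<Gamma>)"
  shows "finprod (H2_prod \<Gamma>) (\<lambda>(x, y). homology_cross \<Gamma> x y [^]\<^bsub>H2_prod \<Gamma>\<^esub> lookup c (x, y)) (keys c)
      = {cross_lift c}" (is ?eq)
    and "cross_lift c \<in> prod_cycles \<Gamma>"
proof -
  interpret H: comm_group "H2_prod \<Gamma>" by (rule comm_group_H2_prod)
  define z where "z = (\<lambda>p. cross_chain (the_elem (fst p)) (the_elem (snd p)) :: 'a set \<times> 'a set \<Rightarrow>\<^sub>0 int)"
  have z: "homology_cross \<Gamma> (fst p) (snd p) = {z p}" "z p \<in> prod_cycles \<Gamma>" if "p \<in> keys c" for p
  proof -
    obtain x y where p: "p = ({x}, {y})" "x \<in> cycles \<Gamma>" "y \<in> cycles \<Gamma>"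
    proof -
      have "p \<in> (\<lambda>z. {z}) ` cycles \<Gamma> \<times> (\<lambda>z. {z}) ` cycles \<Gamma>"
        using \<open>p \<in> keys c\<close> assms unfolding carrier_H1 by blast
      with that show ?thesis by blast
    qed
    thus "homology_cross \<Gamma> (fst p) (snd p) = {z p}" "z p \<in> prod_cycles \<Gamma>"
      by (simp_all add: homology_cross_singleton z_def cross_chain_in_prod_cycles)
  qed
  note fp = finprod_singletons[of "keys c" z "lookup c", OF finite_keys z(2)]
  have lift: "cross_lift c = (\<Sum>p\<in>keys c. frag_cmul (lookup c p) (z p))"
    by (simp add: cross_lift_def frag_extend_def z_def case_prod_unfold)
  have "{z p} [^]\<^bsub>H2_prod \<Gamma>\<^esub> lookup c p \<in> carrier (H2_prod \<Gamma>)" if "p \<in> keys c" for p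
    by (intro H.int_pow_closed singleton_pow(3) z(2) that)
  hence "finprod (H2_prod \<Gamma>) (\<lambda>(x, y). homology_cross \<Gamma> x y [^]\<^bsub>H2_prod \<Gamma>\<^esub> lookup c (x, y)) (keys c)
      = finprod (H2_prod \<Gamma>) (\<lambda>p. {z p} [^]\<^bsub>H2_prod \<Gamma>\<^esub> lookup c p) (keys c)"
    using z(1) by (intro H.finprod_cong') (auto simp: case_prod_unfold)
  thus ?eq using fp lift by simp
  show "cross_lift c \<in> prod_cycles \<Gamma>" using fp lift by simp
qed

lemma cross_lift_tensor_relations:
  assumes "r \<in> tensor_relations (H1 \<Gamma>) (H1 \<Gamma>)"
  shows "cross_lift r = 0"
  using assms unfolding tensor_relations_def
  by (auto simp: cross_lift_def frag_extend_diff H1_simps cross_chain_linear)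

lemma kuenneth_rcos:
  fixes F defines "F \<equiv> free_Abelian_group (carrier (H1 \<Gamma>) \<times> carrier (H1 \<Gamma>))"
  assumes c: "c \<in> carrier F"
  shows "kuenneth \<Gamma> (generate F (tensor_relations (H1 \<Gamma>) (H1 \<Gamma>)) #>\<^bsub>F\<^esub> c) = {cross_lift c}"
proof -
  let ?N = "generate F (tensor_relations (H1 \<Gamma>) (H1 \<Gamma>))"
  interpret F: group F by (simp add: F_def)
  have mult: "x \<otimes>\<^bsub>H1 \<Gamma>\<^esub> y \<in> carrier (H1 \<Gamma>)"
    if "x \<in> carrier (H1 \<Gamma>)" "y \<in> carrier (H1 \<Gamma>)" for x y
    using that by (auto simp: H1_simps cycles_def keys_add_subset frag_extend_add)
  have rel: "tensor_relations (H1 \<Gamma>) (H1 \<Gamma>) \<subseteq> carrier F"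
  proof
    fix r assume "r \<in> tensor_relations (H1 \<Gamma>) (H1 \<Gamma>)"
    then consider
        x x' y where "r = frag_of (x \<otimes>\<^bsub>H1 \<Gamma>\<^esub> x', y) - frag_of (x, y) - frag_of (x', y)"
          "x \<in> carrier (H1 \<Gamma>)" "x' \<in> carrier (H1 \<Gamma>)" "y \<in> carrier (H1 \<Gamma>)"
      | x y y' where "r = frag_of (x, y \<otimes>\<^bsub>H1 \<Gamma>\<^esub> y') - frag_of (x, y) - frag_of (x, y')"
          "x \<in> carrier (H1 \<Gamma>)" "y \<in> carrier (H1 \<Gamma>)" "y' \<in> carrier (H1 \<Gamma>)"
      unfolding tensor_relations_def by blast
    thus "r \<in> carrier F"
      by cases (simp_all add: F_def keys_diff_subset keys_frag_of mult del: One_nat_def)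
  qed
  have N: "n \<in> carrier F \<and> cross_lift n = 0" if "n \<in> ?N" for n
    using that
  proof (induction rule: generate.induct)
    case one
    show ?case by (simp add: F_def cross_lift_def)
  next
    case (incl h)
    thus ?case using rel cross_lift_tensor_relations by auto
  next
    case (inv h)
    hence "h \<in> carrier F" using rel by auto
    thus ?case using inv cross_lift_tensor_relations[of h]
      by (simp add: F_def cross_lift_def frag_extend_minus)
  next
    case (eng h1 h2)
    thus ?case by (simp add: F_def cross_lift_def frag_extend_add keys_add_subset)
  qed
  have "finprod (H2_prod \<Gamma>) (\<lambda>(x, y). homology_cross \<Gamma> x y [^]\<^bsub>H2_prod \<Gamma>\<^esub> lookup d (x, y)) (keys d)
      = {cross_lift c}" if d: "d \<in> ?N #>\<^bsub>F\<^esub> c" for d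
  proof -
    obtain n where n: "n \<in> ?N" "d = n + c" using d by (auto simp: r_coset_def F_def)
    hence "keys d \<subseteq> carrier (H1 \<Gamma>) \<times> carrier (H1 \<Gamma>)"
      using N[OF n(1)] c by (simp add: F_def keys_add_subset)
    moreover have "cross_lift d = cross_lift c"
      using N[OF n(1)] n(2) by (simp add: cross_lift_def frag_extend_add)
    ultimately show ?thesis using finprod_homology_cross(1)[of d] by simp
  qed
  moreover have "c \<in> ?N #>\<^bsub>F\<^esub> c"
    using F.rcos_self[OF c F.generate_is_subgroup[OF rel]] .
  ultimately have "(\<lambda>c. finprod (H2_prod \<Gamma>) (\<lambda>(x, y). homology_cross \<Gamma> x y [^]\<^bsub>H2_prod \<Gamma>\<^esub> lookup c (x, y))
      (keys c)) ` (?N #>\<^bsub>F\<^esub> c) = {{cross_lift c}}"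
    by (auto simp: image_iff)
  thus ?thesis unfolding kuenneth_def tensor_lift_def by simp
qed

end

locale connected_graph = graph +
  assumes reach: "x \<in> vertices \<Gamma> \<Longrightarrow> y \<in> vertices \<Gamma> \<Longrightarrow> (x, y) \<in> reachable \<Gamma>"
begin

text \<open>Every cycle of the square is reached, by \<open>prod_cycle_decomposition\<close>.\<close>

lemma kuenneth_image:
  "kuenneth \<Gamma> ` carrier (tensor_group (H1 \<Gamma>) (H1 \<Gamma>)) = (\<lambda>z. {z}) ` prod_cycles \<Gamma>"
proof -
  define F where "F = free_Abelian_group (carrier (H1 \<Gamma>) \<times> carrier (H1 \<Gamma>))"
  have "kuenneth \<Gamma> ` carrier (tensor_group (H1 \<Gamma>) (H1 \<Gamma>)) = (\<lambda>z. {z}) ` cross_lift ` carrier F"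
    unfolding tensor_group_def F_def[symmetric] carrier_FactGroup image_image
    using kuenneth_rcos by (simp add: F_def)
  moreover have "cross_lift ` carrier F = prod_cycles \<Gamma>"
  proof
    show "cross_lift ` carrier F \<subseteq> prod_cycles \<Gamma>"
      using finprod_homology_cross(2) by (auto simp: F_def)
    obtain P where P: "\<And>\<sigma>. \<sigma> \<in> edges \<Gamma> \<Longrightarrow> keys (P \<sigma>) \<subseteq> edges \<Gamma> \<and> graph_boundary (P \<sigma>) = 0"
      "\<And>c. keys c \<subseteq> edges \<Gamma> \<times> edges \<Gamma> \<Longrightarrow> prod_boundary c = 0 \<Longrightarrow> tensor_map P P c = c"
      using prod_cycle_decomposition[OF simplicial reach] by blast
    show "prod_cycles \<Gamma> \<subseteq> cross_lift ` carrier F"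
    proof
      fix c assume c: "c \<in> prod_cycles \<Gamma>"
      let ?d = "frag_extend (\<lambda>(\<sigma>, \<tau>). frag_of ({P \<sigma>}, {P \<tau>})) c"
      have "cross_lift ?d = tensor_map P P c"
        using subset_UNIV[of "keys c"]
        by (induction c rule: frag_induction)
           (auto simp: cross_lift_def tensor_map_def frag_extend_diff)
      moreover have "?d \<in> carrier F"
        unfolding F_def carrier_free_Abelian_group_iff
      proof (rule keys_frag_extend_subset)
        show "keys c \<subseteq> edges \<Gamma> \<times> edges \<Gamma>" using c by (simp add: prod_cycles_def)
      qed (use P(1) in \<open>auto simp: keys_frag_of H1_simps cycles_def\<close>)
      ultimately show "c \<in> cross_lift ` carrier F"
        using c P(2)[of c] by (auto simp: prod_cycles_def image_iff intro!: bexI[of _ ?d])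
    qed
  qed
  ultimately show ?thesis by (simp only:)
qed

lemma intersection_image_eq:
  "intersection_image \<Gamma> = (\<lambda>z. B2_rel \<Gamma> #>\<^bsub>Z2_rel \<Gamma>\<^esub> z) ` prod_cycles \<Gamma>"
  unfolding intersection_image_def intersection_form_def image_comp[symmetric] kuenneth_image
  by (simp add: image_image induced_map_def)

lemma subgroup_intersection_image: "subgroup (intersection_image \<Gamma>) (H2_rel \<Gamma>)"
proof -
  interpret comm_group "Z2_rel \<Gamma>" by (rule comm_group_Z2_rel)
  interpret normal "deleted_chains \<Gamma>" "Z2_rel \<Gamma>" by (rule subgroup_imp_normal[OF subgroup_deleted_chains])
  have "group_hom (Z2_rel \<Gamma>) (H2_rel \<Gamma>) (\<lambda>z. B2_rel \<Gamma> #>\<^bsub>Z2_rel \<Gamma>\<^esub> z)"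
    unfolding cell_homology_def B2_rel_eq
    using r_coset_hom_Mod factorgroup_is_group by (simp add: group_hom_def group_hom_axioms_def)
  from group_hom.subgroup_img_is_subgroup[OF this subgroup_prod_cycles]
  show ?thesis by (simp add: intersection_image_eq)
qed

lemma
  shows comm_group_Q: "comm_group (Q \<Gamma>)"
    and Q_class_hom: "Q_class \<Gamma> \<in> hom (Z2_rel \<Gamma>) (Q \<Gamma>)"
    and carrier_Q: "carrier (Q \<Gamma>) = Q_class \<Gamma> ` relative_cycles \<Gamma>"
    and Q_class_eq_iff: "\<And>c d. c \<in> relative_cycles \<Gamma> \<Longrightarrow> d \<in> relative_cycles \<Gamma> \<Longrightarrow>
      Q_class \<Gamma> c = Q_class \<Gamma> d \<longleftrightarrow> c - d \<in> null_cycles \<Gamma>"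
proof -
  interpret comm_group "Z2_rel \<Gamma>" by (rule comm_group_Z2_rel)
  note dq = double_quotient[of "B2_rel \<Gamma>" "intersection_image \<Gamma>", folded cell_homology_def Q_def Q_class_def,
      OF subgroup_deleted_chains[folded B2_rel_eq] subgroup_intersection_image]
  show "comm_group (Q \<Gamma>)" by (rule dq(1))
  show "Q_class \<Gamma> \<in> hom (Z2_rel \<Gamma>) (Q \<Gamma>)" using dq(2) unfolding Q_class_def[abs_def] .
  show "carrier (Q \<Gamma>) = Q_class \<Gamma> ` relative_cycles \<Gamma>" 
    using dq(3) unfolding Q_class_def[abs_def] carrier_Z2_rel .
  fix c d assume cd: "c \<in> relative_cycles \<Gamma>" "d \<in> relative_cycles \<Gamma>"
  have minus: "x \<otimes>\<^bsub>Z2_rel \<Gamma>\<^esub> inv\<^bsub>Z2_rel \<Gamma>\<^esub> y = x - y" "x - y \<in> carrier (Z2_rel \<Gamma>)"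
    if "x \<in> relative_cycles \<Gamma>" "y \<in> relative_cycles \<Gamma>" for x y
  proof -
    have "inv\<^bsub>Z2_rel \<Gamma>\<^esub> y = - y" using that by (intro inv_cell_relcycles) (simp add: carrier_Z2_rel)
    thus *: "x \<otimes>\<^bsub>Z2_rel \<Gamma>\<^esub> inv\<^bsub>Z2_rel \<Gamma>\<^esub> y = x - y" by (simp add: cell_relcycles_simps)
    have "x \<in> carrier (Z2_rel \<Gamma>)" "y \<in> carrier (Z2_rel \<Gamma>)" using that by (simp_all add: carrier_Z2_rel)
    from m_closed[OF this(1) inv_closed[OF this(2)]] show "x - y \<in> carrier (Z2_rel \<Gamma>)" by (simp only: *)
  qed
  have "Q_class \<Gamma> c = Q_class \<Gamma> d \<longleftrightarrow> B2_rel \<Gamma> #>\<^bsub>Z2_rel \<Gamma>\<^esub> (c - d) \<in> intersection_image \<Gamma>"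
    using dq(4)[of c d] cd minus by (simp add: carrier_Z2_rel Q_class_def)
  also have "\<dots> \<longleftrightarrow> (\<exists>z\<in>prod_cycles \<Gamma>. B2_rel \<Gamma> #>\<^bsub>Z2_rel \<Gamma>\<^esub> (c - d) = B2_rel \<Gamma> #>\<^bsub>Z2_rel \<Gamma>\<^esub> z)"
    by (auto simp: intersection_image_eq)
  also have "\<dots> \<longleftrightarrow> (\<exists>z\<in>prod_cycles \<Gamma>. (c - d) - z \<in> deleted_chains \<Gamma>)"
  proof (rule bex_cong[OF refl])
    fix z assume "z \<in> prod_cycles \<Gamma>"
    hence z: "z \<in> relative_cycles \<Gamma>" using prod_cycles_subset by blast
    have cd': "c - d \<in> relative_cycles \<Gamma>" using minus(2)[OF cd] by (simp add: carrier_Z2_rel)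
    show "(B2_rel \<Gamma> #>\<^bsub>Z2_rel \<Gamma>\<^esub> (c - d) = B2_rel \<Gamma> #>\<^bsub>Z2_rel \<Gamma>\<^esub> z) = (c - d - z \<in> deleted_chains \<Gamma>)"
      using rcos_eq_iff[OF subgroup_deleted_chains, of "c - d" z] z cd' minus(1)[OF cd' z]
      by (simp add: carrier_Z2_rel B2_rel_eq)
  qed
  also have "\<dots> \<longleftrightarrow> c - d \<in> null_cycles \<Gamma>"
  proof
    assume "\<exists>z\<in>prod_cycles \<Gamma>. c - d - z \<in> deleted_chains \<Gamma>"
    then obtain z where "z \<in> prod_cycles \<Gamma>" "c - d - z \<in> deleted_chains \<Gamma>" by blast
    thus "c - d \<in> null_cycles \<Gamma>"
      unfolding null_cycles_def by (intro CollectI exI[of _ "c - d - z"] exI[of _ z]) simp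
  next
    assume "c - d \<in> null_cycles \<Gamma>"
    then obtain l z where "c - d = l + z" "l \<in> deleted_chains \<Gamma>" "z \<in> prod_cycles \<Gamma>"
      unfolding null_cycles_def by blast
    thus "\<exists>z\<in>prod_cycles \<Gamma>. c - d - z \<in> deleted_chains \<Gamma>" by (intro bexI[of _ z]) simp_all
  qed
  finally show "Q_class \<Gamma> c = Q_class \<Gamma> d \<longleftrightarrow> c - d \<in> null_cycles \<Gamma>" .
qed

end

text \<open>A chain map of pairs is evaluated on representatives. The group \<open>H\<^sub>2\<close> and the cokernel are reached by
  applying \<open>induced_map_rcos\<close> twice.\<close>

lemma Q_map_Q_class:
  assumes "connected_graph \<Gamma>" "connected_graph \<Gamma>'"
    and add: "\<And>c d. f (c + d) = f c + f d"
    and rel: "f ` relative_cycles \<Gamma> \<subseteq> relative_cycles \<Gamma>'"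
    and del: "f ` deleted_chains \<Gamma> \<subseteq> deleted_chains \<Gamma>'"
    and cyc: "f ` prod_cycles \<Gamma> \<subseteq> prod_cycles \<Gamma>'"
    and c: "c \<in> relative_cycles \<Gamma>"
  shows "Q_map \<Gamma>' f (Q_class \<Gamma> c) = Q_class \<Gamma>' (f c)"
proof -
  interpret G: connected_graph \<Gamma> by fact
  interpret G': connected_graph \<Gamma>' by fact
  let ?F = "induced_map (Z2_rel \<Gamma>') (B2_rel \<Gamma>') f"
  interpret Z: comm_group "Z2_rel \<Gamma>" by (rule G.comm_group_Z2_rel)
  interpret Z': comm_group "Z2_rel \<Gamma>'" by (rule G'.comm_group_Z2_rel)
  have f: "group_hom (Z2_rel \<Gamma>) (Z2_rel \<Gamma>') f"
    using rel add
    by (auto simp: group_hom_def group_hom_axioms_def hom_def Z.is_group Z'.is_group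
        G.carrier_Z2_rel G'.carrier_Z2_rel cell_relcycles_simps)
  have F: "?F (B2_rel \<Gamma> #>\<^bsub>Z2_rel \<Gamma>\<^esub> x) = B2_rel \<Gamma>' #>\<^bsub>Z2_rel \<Gamma>'\<^esub> f x" if "x \<in> relative_cycles \<Gamma>" for x
    unfolding G.B2_rel_eq G'.B2_rel_eq
    by (rule induced_map_rcos[OF f G.subgroup_deleted_chains G'.subgroup_deleted_chains del])
       (simp add: that G.carrier_Z2_rel)
  interpret N: normal "deleted_chains \<Gamma>" "Z2_rel \<Gamma>" by (rule Z.subgroup_imp_normal[OF G.subgroup_deleted_chains])
  interpret N': normal "deleted_chains \<Gamma>'" "Z2_rel \<Gamma>'" by (rule Z'.subgroup_imp_normal[OF G'.subgroup_deleted_chains])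
  have H: "carrier (H2_rel \<Gamma>) = (\<lambda>x. B2_rel \<Gamma> #>\<^bsub>Z2_rel \<Gamma>\<^esub> x) ` relative_cycles \<Gamma>"
    by (simp add: cell_homology_def carrier_FactGroup G.carrier_Z2_rel)
  have H': "carrier (H2_rel \<Gamma>') = (\<lambda>x. B2_rel \<Gamma>' #>\<^bsub>Z2_rel \<Gamma>'\<^esub> x) ` relative_cycles \<Gamma>'"
    by (simp add: cell_homology_def carrier_FactGroup G'.carrier_Z2_rel)
  have sum: "(B2_rel \<Gamma> #>\<^bsub>Z2_rel \<Gamma>\<^esub> x) \<otimes>\<^bsub>H2_rel \<Gamma>\<^esub> (B2_rel \<Gamma> #>\<^bsub>Z2_rel \<Gamma>\<^esub> y) = B2_rel \<Gamma> #>\<^bsub>Z2_rel \<Gamma>\<^esub> (x + y)"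
    if "x \<in> relative_cycles \<Gamma>" "y \<in> relative_cycles \<Gamma>" for x y
    using N.rcos_sum[of x y] that by (simp add: cell_homology_def G.B2_rel_eq G.carrier_Z2_rel cell_relcycles_simps)
  have sum': "(B2_rel \<Gamma>' #>\<^bsub>Z2_rel \<Gamma>'\<^esub> x) \<otimes>\<^bsub>H2_rel \<Gamma>'\<^esub> (B2_rel \<Gamma>' #>\<^bsub>Z2_rel \<Gamma>'\<^esub> y) = B2_rel \<Gamma>' #>\<^bsub>Z2_rel \<Gamma>'\<^esub> (x + y)"
    if "x \<in> relative_cycles \<Gamma>'" "y \<in> relative_cycles \<Gamma>'" for x y
    using N'.rcos_sum[of x y] that by (simp add: cell_homology_def G'.B2_rel_eq G'.carrier_Z2_rel cell_relcycles_simps)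
  have closed: "x + y \<in> relative_cycles \<Gamma>" if "x \<in> relative_cycles \<Gamma>" "y \<in> relative_cycles \<Gamma>" for x y
    using that Z.m_closed[of x y] by (simp add: G.carrier_Z2_rel cell_relcycles_simps)
  have "group_hom (H2_rel \<Gamma>) (H2_rel \<Gamma>') ?F"
  proof (rule group_hom.intro)
    show "group (H2_rel \<Gamma>)" "group (H2_rel \<Gamma>')"
      unfolding cell_homology_def G.B2_rel_eq G'.B2_rel_eq
      by (rule N.factorgroup_is_group N'.factorgroup_is_group)+
    show "group_hom_axioms (H2_rel \<Gamma>) (H2_rel \<Gamma>') ?F"
    proof (rule group_hom_axioms.intro, rule homI)
      fix X assume "X \<in> carrier (H2_rel \<Gamma>)"
      then obtain x where x: "x \<in> relative_cycles \<Gamma>" "X = B2_rel \<Gamma> #>\<^bsub>Z2_rel \<Gamma>\<^esub> x" by (auto simp: H)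
      hence fx: "f x \<in> relative_cycles \<Gamma>'" using rel by blast
      thus "?F X \<in> carrier (H2_rel \<Gamma>')" using x by (simp add: F H')
      fix Y assume "Y \<in> carrier (H2_rel \<Gamma>)"
      then obtain y where y: "y \<in> relative_cycles \<Gamma>" "Y = B2_rel \<Gamma> #>\<^bsub>Z2_rel \<Gamma>\<^esub> y" by (auto simp: H)
      hence "f y \<in> relative_cycles \<Gamma>'" using rel by blast
      thus "?F (X \<otimes>\<^bsub>H2_rel \<Gamma>\<^esub> Y) = ?F X \<otimes>\<^bsub>H2_rel \<Gamma>'\<^esub> ?F Y"
        by (simp only: x(2) y(2) sum[OF x(1) y(1)] F[OF closed[OF x(1) y(1)]] F[OF x(1)] F[OF y(1)]
            sum'[OF fx] add)
    qed
  qed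
  moreover have "?F ` intersection_image \<Gamma> \<subseteq> intersection_image \<Gamma>'"
  proof -
    have "?F (B2_rel \<Gamma> #>\<^bsub>Z2_rel \<Gamma>\<^esub> z) \<in> intersection_image \<Gamma>'" if "z \<in> prod_cycles \<Gamma>" for z
    proof -
      have "z \<in> relative_cycles \<Gamma>" using that G.prod_cycles_subset by blast
      moreover have "f z \<in> prod_cycles \<Gamma>'" using that cyc by blast
      ultimately show ?thesis by (simp add: F G'.intersection_image_eq)
    qed
    thus ?thesis unfolding G.intersection_image_eq by blast
  qed
  ultimately have "Q_map \<Gamma>' f (Q_class \<Gamma> c) = intersection_image \<Gamma>' #>\<^bsub>H2_rel \<Gamma>'\<^esub> ?F (B2_rel \<Gamma> #>\<^bsub>Z2_rel \<Gamma>\<^esub> c)"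
    unfolding Q_map_def Q_class_def
    using c by (intro induced_map_rcos G.subgroup_intersection_image G'.subgroup_intersection_image) (auto simp: H)
  thus ?thesis by (simp add: F[OF c] Q_class_def)
qed

section \<open>The exact sequence on the level of chains\<close>

subsection \<open>Null cycles and the involution\<close>

context graph
begin

lemma null_cyclesI: "l \<in> deleted_chains \<Gamma> \<Longrightarrow> z \<in> prod_cycles \<Gamma> \<Longrightarrow> l + z \<in> null_cycles \<Gamma>"
  unfolding null_cycles_def by blast

lemma deleted_chains_add:
  "l \<in> deleted_chains \<Gamma> \<Longrightarrow> l' \<in> deleted_chains \<Gamma> \<Longrightarrow> l + l' \<in> deleted_chains \<Gamma>"
  by (simp add: deleted_chains_def keys_add_subset)

lemma prod_cycles_add:
  "z \<in> prod_cycles \<Gamma> \<Longrightarrow> z' \<in> prod_cycles \<Gamma> \<Longrightarrow> z + z' \<in> prod_cycles \<Gamma>"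
  by (simp add: prod_cycles_def keys_add_subset frag_extend_add)

lemma null_cycles_add:
  assumes "c \<in> null_cycles \<Gamma>" "d \<in> null_cycles \<Gamma>"
  shows "c + d \<in> null_cycles \<Gamma>"
proof -
  obtain l z l' z' where *: "c = l + z" "d = l' + z'" "l \<in> deleted_chains \<Gamma>" "l' \<in> deleted_chains \<Gamma>"
    "z \<in> prod_cycles \<Gamma>" "z' \<in> prod_cycles \<Gamma>" using assms unfolding null_cycles_def by blast
  have "c + d = (l + l') + (z + z')" by (simp add: *)
  also have "\<dots> \<in> null_cycles \<Gamma>" using * by (intro null_cyclesI deleted_chains_add prod_cycles_add)
  finally show ?thesis .
qed

lemma relative_cycles_add:
  "c \<in> relative_cycles \<Gamma> \<Longrightarrow> d \<in> relative_cycles \<Gamma> \<Longrightarrow> c + d \<in> relative_cycles \<Gamma>"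
  by (simp add: relative_cycles_def keys_add_subset frag_extend_add)

lemma relative_cycles_diff:
  "c \<in> relative_cycles \<Gamma> \<Longrightarrow> d \<in> relative_cycles \<Gamma> \<Longrightarrow> c - d \<in> relative_cycles \<Gamma>"
  by (simp add: relative_cycles_def keys_diff_subset frag_extend_diff)

lemma edge_products_subset: "keys c \<subseteq> edges \<Gamma> \<times> edges \<Gamma> \<Longrightarrow> keys c \<subseteq> {\<sigma>. card \<sigma> = 2} \<times> {\<tau>. card \<tau> = 2}"
  using edges_subset[of \<Gamma>] by blast

lemma keys_swap_chain: "keys (swap_chain c) \<subseteq> prod.swap ` keys c"
proof -
  have "keys (swap_chain c) \<subseteq> (\<Union>\<rho>\<in>keys c. {prod.swap \<rho>})"
    unfolding swap_chain_def
    by (rule order_trans[OF keys_frag_extend]) (auto simp: keys_frag_of split: if_splits)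
  thus ?thesis by blast
qed

lemma swap_deleted_cells: "prod.swap ` deleted_cells \<Gamma> = deleted_cells \<Gamma>"
  by (force simp: deleted_cells_eq[OF simplicial] image_iff)

lemma swap_keys:
  assumes "keys c \<subseteq> X" "prod.swap ` X \<subseteq> X" shows "keys (swap_chain c) \<subseteq> X"
  using keys_swap_chain[of c] assms by blast

lemma swap_edge_products: "keys c \<subseteq> edges \<Gamma> \<times> edges \<Gamma> \<Longrightarrow> keys (swap_chain c) \<subseteq> edges \<Gamma> \<times> edges \<Gamma>"
  by (rule swap_keys) auto

lemma swap_relative_cycles:
  assumes "c \<in> relative_cycles \<Gamma>" shows "swap_chain c \<in> relative_cycles \<Gamma>"
proof -
  have k: "keys c \<subseteq> edges \<Gamma> \<times> edges \<Gamma>" and b: "keys (prod_boundary c) \<subseteq> deleted_cells \<Gamma>"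
    using assms by (simp_all add: relative_cycles_def)
  have "keys (prod_boundary (swap_chain c)) \<subseteq> deleted_cells \<Gamma>"
    unfolding prod_boundary_swap[OF edge_products_subset[OF k]]
    by (rule swap_keys[OF b]) (simp add: swap_deleted_cells)
  with swap_edge_products[OF k] show ?thesis by (simp add: relative_cycles_def)
qed

lemma swap_deleted_chains: "c \<in> deleted_chains \<Gamma> \<Longrightarrow> swap_chain c \<in> deleted_chains \<Gamma>"
  unfolding deleted_chains_def
proof (intro CollectI, drule CollectD, rule swap_keys)
  show "prod.swap ` (deleted_cells \<Gamma> \<inter> edges \<Gamma> \<times> edges \<Gamma>) \<subseteq> deleted_cells \<Gamma> \<inter> edges \<Gamma> \<times> edges \<Gamma>"
    using swap_deleted_cells by auto
qed

lemma swap_prod_cycles: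
  assumes "c \<in> prod_cycles \<Gamma>" shows "swap_chain c \<in> prod_cycles \<Gamma>"
proof -
  have k: "keys c \<subseteq> edges \<Gamma> \<times> edges \<Gamma>" and b: "prod_boundary c = 0"
    using assms by (simp_all add: prod_cycles_def)
  have "prod_boundary (swap_chain c) = 0"
    by (simp add: prod_boundary_swap[OF edge_products_subset[OF k]] b swap_chain_linear)
  with swap_edge_products[OF k] show ?thesis by (simp add: prod_cycles_def)
qed

end

subsection \<open>Slices of chains on the square\<close>

lemma slice_swap_chain:
  assumes "keys c \<subseteq> {\<sigma>. card \<sigma> = 2} \<times> {\<tau>. card \<tau> = 2}"
  shows "left_slice e (swap_chain c) = - right_slice e c"
    and "right_slice e (swap_chain c) = - left_slice e c"
proof -
  have "left_slice e (swap_chain c) = - right_slice e c \<and> right_slice e (swap_chain c) = - left_slice e c"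
    using assms
  proof (induction c rule: prod_chain_induct)
    case (cross \<sigma> \<tau>)
    hence "keys (frag_of \<sigma>) \<subseteq> {\<sigma>. card \<sigma> = Suc 1}" "keys (frag_of \<tau>) \<subseteq> {\<sigma>. card \<sigma> = Suc 1}"
      by (simp_all add: keys_frag_of)
    from swap_chain_cross[OF this]
    have "swap_chain (cross_chain (frag_of \<sigma>) (frag_of \<tau>)) = - cross_chain (frag_of \<tau>) (frag_of \<sigma>)"
      by simp
    thus ?case by (simp add: slice_linear slice_cross_chain)
  qed (simp_all add: slice_linear swap_chain_linear)
  thus "left_slice e (swap_chain c) = - right_slice e c" "right_slice e (swap_chain c) = - left_slice e c"
    by simp_all
qed

text \<open>Only the factor that is not sliced contributes, since the boundary of a \<open>1\<close>-chain contains no edge.\<close>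

lemma slice_prod_boundary:
  assumes "keys c \<subseteq> {\<sigma>. card \<sigma> = 2} \<times> {\<tau>. card \<tau> = 2}" and e: "card e = 2"
  shows "left_slice e (prod_boundary c) = - graph_boundary (left_slice e c)"
    and "right_slice e (prod_boundary c) = graph_boundary (right_slice e c)"
proof -
  have bd: "lookup (graph_bd \<sigma>) e = 0" if "card \<sigma> = 2" for \<sigma> :: "'a set"
    using that e by (auto simp: graph_bd_edge lookup_minus)
  have "left_slice e (prod_boundary c) = - graph_boundary (left_slice e c) \<and>
      right_slice e (prod_boundary c) = graph_boundary (right_slice e c)"
    using assms(1)
  proof (induction c rule: prod_chain_induct)
    case (cross \<sigma> \<tau>)
    hence "keys (frag_of \<sigma>) \<subseteq> {\<sigma>. card \<sigma> = 2}" by (simp add: keys_frag_of)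
    from prod_boundary_cross_edges[OF this, of "frag_of \<tau>"] show ?case
      using cross by (simp add: slice_linear slice_cross_chain bd frag_extend_cmul)
  qed (simp_all add: slice_linear frag_extend_diff)
  thus "left_slice e (prod_boundary c) = - graph_boundary (left_slice e c)"
    "right_slice e (prod_boundary c) = graph_boundary (right_slice e c)" by simp_all
qed

subsection \<open>Adding an edge\<close>

locale edge_addition = connected_graph \<Gamma> for \<Gamma> :: "'a set set" +
  fixes u v :: 'a
  assumes ends: "{u} \<in> \<Gamma>" "{v} \<in> \<Gamma>" "u \<noteq> v" and new: "{u, v} \<notin> \<Gamma>"
begin

abbreviation e :: "'a set" where "e \<equiv> {u, v}"
abbreviation \<Gamma>' :: "'a set set" where "\<Gamma>' \<equiv> add_edge \<Gamma> u v"
abbreviation \<Gamma>\<^sub>0 :: "'a set set" where "\<Gamma>\<^sub>0 \<equiv> remove_stars \<Gamma> u v"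

lemma card_e: "card e = 2" using ends by simp

lemma simplicial': "simplicial_graph \<Gamma>'"
proof -
  have "\<rho> \<in> \<Gamma>'" if "\<rho> \<noteq> {}" "\<rho> \<subseteq> e" for \<rho>
  proof -
    have "\<rho> = {u} \<or> \<rho> = {v} \<or> \<rho> = e" using that by blast
    thus ?thesis using ends by (auto simp: add_edge_def)
  qed
  thus ?thesis
    using simplicial card_e unfolding simplicial_graph_def add_edge_def by (simp; blast)
qed

lemma simplicial0: "simplicial_graph \<Gamma>\<^sub>0"
  using simplicial unfolding simplicial_graph_def remove_stars_def by (auto; blast)

lemma edges': "edges \<Gamma>' = insert e (edges \<Gamma>)" and nodes': "nodes \<Gamma>' = nodes \<Gamma>"
  and vertices': "vertices \<Gamma>' = vertices \<Gamma>"
  using card_e ends by (auto simp: edges_def nodes_def vertices_def add_edge_def singleton_insert_inj_eq)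

lemma edges0: "edges \<Gamma>\<^sub>0 = {\<sigma> \<in> edges \<Gamma>. \<sigma> \<inter> e = {}}" and nodes0: "nodes \<Gamma>\<^sub>0 = {\<sigma> \<in> nodes \<Gamma>. \<sigma> \<inter> e = {}}"
  and vertices0: "vertices \<Gamma>\<^sub>0 = vertices \<Gamma> - e"
  by (auto simp: edges_def nodes_def vertices_def remove_stars_def)

lemma e_notin: "e \<notin> edges \<Gamma>" "e \<notin> nodes \<Gamma>" "e \<notin> edges \<Gamma>\<^sub>0"
  using new by (auto simp: edges_def nodes_def remove_stars_def)

sublocale new: connected_graph \<Gamma>'
proof
  have "{(x, y). {x, y} \<in> \<Gamma>} \<subseteq> {(x, y). {x, y} \<in> \<Gamma>'}" by (auto simp: add_edge_def)
  hence "reachable \<Gamma> \<subseteq> reachable \<Gamma>'" unfolding reachable_def by (rule rtrancl_mono)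
  thus "(x, y) \<in> reachable \<Gamma>'" if "x \<in> vertices \<Gamma>'" "y \<in> vertices \<Gamma>'" for x y
    using reach that vertices' by blast
qed (rule simplicial')

sublocale removed: graph \<Gamma>\<^sub>0
  by unfold_locales (rule simplicial0)

lemma deleted_cells_new: "deleted_cells \<Gamma>' = deleted_cells \<Gamma> \<union> {e} \<times> \<Gamma>\<^sub>0 \<union> \<Gamma>\<^sub>0 \<times> {e}"
  unfolding deleted_cells_eq[OF simplicial] deleted_cells_eq[OF simplicial']
  by (auto simp: add_edge_def remove_stars_def)

lemma deleted_cells_without_e:
  assumes "keys c \<subseteq> deleted_cells \<Gamma>'" "left_slice e c = 0" "right_slice e c = 0"
  shows "keys c \<subseteq> deleted_cells \<Gamma>"
proof -
  have "keys (left_slice e c) = {}" "keys (right_slice e c) = {}" using assms by simp_all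
  hence "(e, \<tau>) \<notin> keys c" "(\<tau>, e) \<notin> keys c" for \<tau>
    by (simp_all only: keys_left_slice keys_right_slice) blast+
  thus ?thesis using assms(1) deleted_cells_new by fastforce
qed

lemma slice_eq_0:
  assumes "keys c \<subseteq> edges \<Gamma> \<times> edges \<Gamma>" shows "left_slice e c = 0" "right_slice e c = 0"
proof -
  have "keys (left_slice e c) = {}" "keys (right_slice e c) = {}"
    using assms e_notin unfolding keys_left_slice keys_right_slice by blast+
  thus "left_slice e c = 0" "right_slice e c = 0" by simp_all
qed

lemma slice_deleted_eq_0:
  assumes "keys c \<subseteq> deleted_cells \<Gamma>" shows "left_slice e c = 0" "right_slice e c = 0"
proof -
  have "keys (left_slice e c) = {}" "keys (right_slice e c) = {}"
    using assms new deleted_cells_subset unfolding keys_left_slice keys_right_slice by blast+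
  thus "left_slice e c = 0" "right_slice e c = 0" by simp_all
qed

lemma lookup_e_eq_0: "keys c \<subseteq> edges \<Gamma> \<Longrightarrow> lookup c e = 0"
  using e_notin by (auto simp: in_keys_iff)

lemma old_in_new:
  "edges \<Gamma> \<subseteq> edges \<Gamma>'" "edges \<Gamma>\<^sub>0 \<subseteq> edges \<Gamma>"
  "deleted_chains \<Gamma> \<subseteq> deleted_chains \<Gamma>'" "prod_cycles \<Gamma> \<subseteq> prod_cycles \<Gamma>'"
  "relative_cycles \<Gamma> \<subseteq> relative_cycles \<Gamma>'"
  using deleted_cells_new edges' edges0
  unfolding deleted_chains_def prod_cycles_def relative_cycles_def by blast+

lemma null_cycles_new: "null_cycles \<Gamma> \<subseteq> null_cycles \<Gamma>'"
  using old_in_new(3,4) unfolding null_cycles_def by blast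

text \<open>The new edge, oriented towards \<open>u\<close>.\<close>

abbreviation \<epsilon> :: "'a set \<Rightarrow>\<^sub>0 int" where "\<epsilon> \<equiv> edge_chain u v"

lemma \<epsilon>_boundary: "graph_boundary \<epsilon> = frag_of {u} - frag_of {v}"
  by (rule graph_boundary_edge_chain[OF ends(3)])

text \<open>The sign that compares the orientation chosen for \<open>e\<close> with the one towards \<open>u\<close>.\<close>

lemma orientation: obtains s where "s = 1 \<or> s = -1" "frag_of e = frag_cmul s \<epsilon>" "lookup \<epsilon> e = s"
proof (cases "edge_head e = u")
  case True
  thus ?thesis using that[of 1] by (simp add: edge_chain_def)
next
  case False
  thus ?thesis using that[of "-1"] by (simp add: edge_chain_def)
qed

lemma cross_\<epsilon>_deleted:
  assumes "keys c \<subseteq> edges \<Gamma>\<^sub>0"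
  shows "cross_chain \<epsilon> c \<in> deleted_chains \<Gamma>'" "cross_chain c \<epsilon> \<in> deleted_chains \<Gamma>'"
proof -
  have "keys c \<subseteq> \<Gamma>\<^sub>0" "keys c \<subseteq> edges \<Gamma>'" using assms old_in_new(1,2) by (auto simp: edges_def)
  thus "cross_chain \<epsilon> c \<in> deleted_chains \<Gamma>'" "cross_chain c \<epsilon> \<in> deleted_chains \<Gamma>'"
    unfolding deleted_chains_def deleted_cells_new by (auto simp: keys_cross_chain keys_edge_chain edges')
qed

text \<open>Splitting off the part of a chain of the deleted product that involves the new edge.\<close>

lemma split_deleted_chain:
  assumes d: "d \<in> deleted_chains \<Gamma>'"
  obtains c\<^sub>1 c\<^sub>2 where "keys c\<^sub>1 \<subseteq> edges \<Gamma>\<^sub>0" "keys c\<^sub>2 \<subseteq> edges \<Gamma>\<^sub>0"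
    "d - (cross_chain \<epsilon> c\<^sub>1 + cross_chain c\<^sub>2 \<epsilon>) \<in> deleted_chains \<Gamma>"
    "graph_boundary c\<^sub>1 = 0 \<longleftrightarrow> left_slice e (prod_boundary d) = 0"
    "graph_boundary c\<^sub>2 = 0 \<longleftrightarrow> right_slice e (prod_boundary d) = 0"
proof -
  obtain s where s: "s = 1 \<or> s = -1" "frag_of e = frag_cmul s \<epsilon>" "lookup \<epsilon> e = s" by (rule orientation)
  have dk: "keys d \<subseteq> deleted_cells \<Gamma>'" "keys d \<subseteq> edges \<Gamma>' \<times> edges \<Gamma>'" using d by (auto simp: deleted_chains_def)
  define c\<^sub>1 where "c\<^sub>1 = frag_cmul s (left_slice e d)"
  define c\<^sub>2 where "c\<^sub>2 = frag_cmul s (right_slice e d)"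
  have disj: "\<tau> \<in> edges \<Gamma>\<^sub>0" if "(e, \<tau>) \<in> keys d \<or> (\<tau>, e) \<in> keys d" for \<tau>
  proof -
    have "\<tau> \<inter> e = {}" "\<tau> \<in> edges \<Gamma>'"
      using that dk by (auto simp: deleted_cells_eq[OF simplicial'])
    moreover from this have "\<tau> \<noteq> e" by auto
    ultimately show ?thesis by (simp add: edges' edges0)
  qed
  have k: "keys c\<^sub>1 \<subseteq> edges \<Gamma>\<^sub>0" "keys c\<^sub>2 \<subseteq> edges \<Gamma>\<^sub>0"
    unfolding c\<^sub>1_def c\<^sub>2_def using disj by (auto intro!: keys_cmul_subset simp: keys_left_slice keys_right_slice)
  let ?d = "d - (cross_chain \<epsilon> c\<^sub>1 + cross_chain c\<^sub>2 \<epsilon>)"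
  have ee: "lookup d (e, e) = 0" using disj[of e] e_notin(3) by (auto simp: in_keys_iff)
  have "left_slice e ?d = 0" "right_slice e ?d = 0"
    using s(1) by (auto simp: slice_linear slice_cross_chain s(3) ee lookup_left_slice lookup_right_slice
        c\<^sub>1_def c\<^sub>2_def)
  moreover have d': "?d \<in> deleted_chains \<Gamma>'"
    using d cross_\<epsilon>_deleted(1)[OF k(1)] cross_\<epsilon>_deleted(2)[OF k(2)]
    unfolding deleted_chains_def by (simp add: keys_diff_subset keys_add_subset)
  ultimately have "keys ?d \<subseteq> deleted_cells \<Gamma>"
    by (intro deleted_cells_without_e) (simp_all add: deleted_chains_def)
  moreover have "keys ?d \<subseteq> edges \<Gamma> \<times> edges \<Gamma>"
    using calculation d' deleted_cells_subset new unfolding deleted_chains_def edges' by blast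
  ultimately have "?d \<in> deleted_chains \<Gamma>" by (simp add: deleted_chains_def)
  moreover have "graph_boundary c\<^sub>1 = 0 \<longleftrightarrow> left_slice e (prod_boundary d) = 0"
    "graph_boundary c\<^sub>2 = 0 \<longleftrightarrow> right_slice e (prod_boundary d) = 0"
    using s(1) slice_prod_boundary[OF new.edge_products_subset[OF dk(2)] card_e]
    by (auto simp: c\<^sub>1_def c\<^sub>2_def frag_extend_cmul)
  ultimately show ?thesis using k that by blast
qed

subsection \<open>The kernel\<close>

lemma loop_cycle:
  assumes "keys a \<subseteq> edges \<Gamma>" "graph_boundary a = frag_of {u} - frag_of {v}"
  shows "a - \<epsilon> \<in> cycles \<Gamma>'"
proof -
  have "keys (a - \<epsilon>) \<subseteq> edges \<Gamma>'"
    using assms(1) by (intro keys_diff_subset) (auto simp: keys_edge_chain edges')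
  with assms(2) show ?thesis by (simp add: cycles_def frag_extend_diff \<epsilon>_boundary)
qed

lemma old_cycles: "cycles \<Gamma>\<^sub>0 \<subseteq> cycles \<Gamma>'"
  using old_in_new(1,2) unfolding cycles_def by blast

text \<open>The new edge turns \<open>a\<close> into the cycle \<open>a - e\<close>. Hence \<open>a \<times> c\<close> is the sum of the product cycle
  \<open>(a - e) \<times> c\<close> and the chain \<open>e \<times> c\<close> of the deleted product.\<close>

lemma linking_chain_relative_cycle:
  assumes a: "keys a \<subseteq> edges \<Gamma>" "graph_boundary a = frag_of {u} - frag_of {v}"
    and c: "c \<in> cycles \<Gamma>\<^sub>0"
  shows "cross_chain a c \<in> relative_cycles \<Gamma>" "cross_chain c a \<in> relative_cycles \<Gamma>"
    "cross_chain a c \<in> null_cycles \<Gamma>'" "cross_chain c a \<in> null_cycles \<Gamma>'"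
proof -
  have ck: "keys c \<subseteq> edges \<Gamma>\<^sub>0" "keys c \<subseteq> edges \<Gamma>" "graph_boundary c = 0"
    using c old_in_new by (auto simp: cycles_def)
  have "{u} \<noteq> {v}" using ends by simp
  hence uv: "keys (frag_of {u} - frag_of {v}) = {{u}, {v}}" "keys (frag_of {v} - frag_of {u}) = {{u}, {v}}"
    by (auto simp: in_keys_iff lookup_minus split: if_splits)
  have a2: "keys a \<subseteq> {\<sigma>. card \<sigma> = 2}" "keys c \<subseteq> {\<sigma>. card \<sigma> = 2}" using a ck edges_subset by blast+
  have "prod_boundary (cross_chain a c) = cross_chain (frag_of {u} - frag_of {v}) c"
    using a ck by (simp add: prod_boundary_cross_edges[OF a2(1)] cross_chain_linear)
  moreover have "prod_boundary (cross_chain c a) = cross_chain c (frag_of {v} - frag_of {u})"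
    using a ck by (simp add: prod_boundary_cross_edges[OF a2(2)] cross_chain_linear)
  moreover have "keys (cross_chain (frag_of {u} - frag_of {v}) c) \<subseteq> deleted_cells \<Gamma>"
    "keys (cross_chain c (frag_of {v} - frag_of {u})) \<subseteq> deleted_cells \<Gamma>"
    using ck(1) ends unfolding keys_cross_chain uv edges0 deleted_cells_eq[OF simplicial]
    by (auto simp: edges_def)
  moreover have "keys (cross_chain a c) \<subseteq> edges \<Gamma> \<times> edges \<Gamma>" "keys (cross_chain c a) \<subseteq> edges \<Gamma> \<times> edges \<Gamma>"
    using a(1) ck(2) unfolding keys_cross_chain by blast+
  ultimately show "cross_chain a c \<in> relative_cycles \<Gamma>" "cross_chain c a \<in> relative_cycles \<Gamma>"
    by (simp_all add: relative_cycles_def)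
  have "a - \<epsilon> \<in> cycles \<Gamma>'" "c \<in> cycles \<Gamma>'"
    using loop_cycle[OF a] old_cycles c by auto
  hence "cross_chain \<epsilon> c + cross_chain (a - \<epsilon>) c \<in> null_cycles \<Gamma>'"
    "cross_chain c \<epsilon> + cross_chain c (a - \<epsilon>) \<in> null_cycles \<Gamma>'"
    by (auto intro!: new.null_cyclesI cross_\<epsilon>_deleted ck(1) new.cross_chain_in_prod_cycles)
  thus "cross_chain a c \<in> null_cycles \<Gamma>'" "cross_chain c a \<in> null_cycles \<Gamma>'"
    by (simp_all add: cross_chain_linear)
qed

text \<open>The coefficients of \<open>e \<times> c\<^sub>1 + c\<^sub>2 \<times> e\<close> in \<open>d\<close> are cycles because the boundary of \<open>d\<close> is that of \<open>c\<close>,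
  which lies in the deleted product of \<open>\<Gamma>\<close>.\<close>

proposition kernel_chains:
  assumes a: "keys a \<subseteq> edges \<Gamma>" "graph_boundary a = frag_of {u} - frag_of {v}"
    and c: "c \<in> relative_cycles \<Gamma>"
  shows "c \<in> null_cycles \<Gamma>' \<longleftrightarrow>
    (\<exists>c\<^sub>1\<in>cycles \<Gamma>\<^sub>0. \<exists>c\<^sub>2\<in>cycles \<Gamma>\<^sub>0. c - (cross_chain a c\<^sub>1 + cross_chain c\<^sub>2 a) \<in> null_cycles \<Gamma>)"
proof
  assume "c \<in> null_cycles \<Gamma>'"
  then obtain d z where dz: "c = d + z" "d \<in> deleted_chains \<Gamma>'" "z \<in> prod_cycles \<Gamma>'"
    unfolding null_cycles_def by blast
  obtain c\<^sub>1 c\<^sub>2 where k: "keys c\<^sub>1 \<subseteq> edges \<Gamma>\<^sub>0" "keys c\<^sub>2 \<subseteq> edges \<Gamma>\<^sub>0"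
    and d: "d - (cross_chain \<epsilon> c\<^sub>1 + cross_chain c\<^sub>2 \<epsilon>) \<in> deleted_chains \<Gamma>" (is "?d \<in> _")
    and bd: "graph_boundary c\<^sub>1 = 0 \<longleftrightarrow> left_slice e (prod_boundary d) = 0"
      "graph_boundary c\<^sub>2 = 0 \<longleftrightarrow> right_slice e (prod_boundary d) = 0"
    by (rule split_deleted_chain[OF dz(2)])
  have "prod_boundary d = prod_boundary c"
    using dz by (simp add: frag_extend_add prod_cycles_def)
  moreover have "keys (prod_boundary c) \<subseteq> deleted_cells \<Gamma>" using c by (simp add: relative_cycles_def)
  ultimately have cyc: "c\<^sub>1 \<in> cycles \<Gamma>\<^sub>0" "c\<^sub>2 \<in> cycles \<Gamma>\<^sub>0"
    using k bd slice_deleted_eq_0 by (simp_all add: cycles_def)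
  \<comment> \<open>the difference is a cycle, since it only exchanges \<open>e\<close> for \<open>a\<close>, and it does not involve \<open>e\<close>\<close>
  let ?w = "c - (cross_chain a c\<^sub>1 + cross_chain c\<^sub>2 a) - ?d"
  have "?w = z - (cross_chain (a - \<epsilon>) c\<^sub>1 + cross_chain c\<^sub>2 (a - \<epsilon>))"
    by (simp add: dz cross_chain_linear)
  moreover have "a - \<epsilon> \<in> cycles \<Gamma>'" "c\<^sub>1 \<in> cycles \<Gamma>'" "c\<^sub>2 \<in> cycles \<Gamma>'"
    using loop_cycle[OF a] cyc old_cycles by auto
  hence "prod_boundary (cross_chain (a - \<epsilon>) c\<^sub>1) = 0" "prod_boundary (cross_chain c\<^sub>2 (a - \<epsilon>)) = 0"
    using new.cross_chain_in_prod_cycles unfolding prod_cycles_def by blast+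
  moreover have "prod_boundary z = 0" using dz(3) by (simp add: prod_cycles_def)
  ultimately have "prod_boundary ?w = 0" by (simp only: frag_extend_linear) simp
  moreover have "keys c \<subseteq> edges \<Gamma> \<times> edges \<Gamma>" "keys ?d \<subseteq> edges \<Gamma> \<times> edges \<Gamma>"
    "keys (cross_chain a c\<^sub>1) \<subseteq> edges \<Gamma> \<times> edges \<Gamma>" "keys (cross_chain c\<^sub>2 a) \<subseteq> edges \<Gamma> \<times> edges \<Gamma>"
    using c d a(1) k old_in_new(2) unfolding keys_cross_chain relative_cycles_def deleted_chains_def by blast+
  hence "keys ?w \<subseteq> edges \<Gamma> \<times> edges \<Gamma>"
    by (intro keys_diff_subset[OF keys_diff_subset[OF _ keys_add_subset]])
  ultimately have "?w \<in> prod_cycles \<Gamma>" by (simp add: prod_cycles_def)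
  from null_cyclesI[OF d this] have "c - (cross_chain a c\<^sub>1 + cross_chain c\<^sub>2 a) \<in> null_cycles \<Gamma>" by simp
  with cyc show "\<exists>c\<^sub>1\<in>cycles \<Gamma>\<^sub>0. \<exists>c\<^sub>2\<in>cycles \<Gamma>\<^sub>0. c - (cross_chain a c\<^sub>1 + cross_chain c\<^sub>2 a) \<in> null_cycles \<Gamma>"
    by blast
next
  assume "\<exists>c\<^sub>1\<in>cycles \<Gamma>\<^sub>0. \<exists>c\<^sub>2\<in>cycles \<Gamma>\<^sub>0. c - (cross_chain a c\<^sub>1 + cross_chain c\<^sub>2 a) \<in> null_cycles \<Gamma>"
  then obtain c\<^sub>1 c\<^sub>2 where *: "c\<^sub>1 \<in> cycles \<Gamma>\<^sub>0" "c\<^sub>2 \<in> cycles \<Gamma>\<^sub>0"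
    "c - (cross_chain a c\<^sub>1 + cross_chain c\<^sub>2 a) \<in> null_cycles \<Gamma>'" using null_cycles_new by blast
  have "cross_chain a c\<^sub>1 + cross_chain c\<^sub>2 a \<in> null_cycles \<Gamma>'"
    by (intro new.null_cycles_add linking_chain_relative_cycle[OF a] *)
  from new.null_cycles_add[OF *(3) this] show "c \<in> null_cycles \<Gamma>'" by simp
qed

end

lemma finite_vertex_classes:
  assumes "simplicial_graph \<Gamma>" shows "finite (vertex_classes \<Gamma>)"
  unfolding vertex_classes_def using finite_vertices[OF assms] by simp

text \<open>The condition on the coefficient sum forces the last coefficient to vanish with the others.\<close>

lemma frag_eq_0_if_truncation_eq_0:
  fixes n :: nat
  assumes "keys m \<subseteq> {..<n}" and sum: "frag_extend (\<lambda>_. frag_of ()) m = 0"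
    and trunc: "frag_extend (\<lambda>i. if i < n - 1 then frag_of i else 0) m = 0"
  shows "m = 0"
proof -
  have "lookup (frag_extend (\<lambda>i. if i < n - 1 then frag_of i else 0) m) j = (if j < n - 1 then lookup m j else 0)" for j
    using subset_UNIV[of "keys m"]
    by (induction m rule: frag_induction) (auto simp: frag_extend_diff lookup_minus)
  hence "lookup m j = 0" if "j < n - 1" for j using trunc that by (metis lookup_zero)
  note zero = this
  have "keys m \<subseteq> {n - 1}"
  proof
    fix j assume j: "j \<in> keys m"
    hence "\<not> j < n - 1" using zero by (auto simp: in_keys_iff)
    moreover have "j < n" using j assms(1) by blast
    ultimately show "j \<in> {n - 1}" by simp
  qed
  hence m: "m = frag_cmul (lookup m (n - 1)) (frag_of (n - 1))"
    by (intro poly_mapping_eqI) (auto simp: in_keys_iff)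
  have "frag_cmul (lookup m (n - 1)) (frag_of ()) = 0"
    using sum by (subst (asm) m) (simp add: frag_extend_cmul)
  thus ?thesis using m by simp
qed

context edge_addition
begin

subsection \<open>The cokernel\<close>

text \<open>An enumeration of the components of \<open>\<Gamma>\<^sub>0\<close>.\<close>

definition class_index :: "'a set \<Rightarrow> nat" where
  "class_index = (SOME f. bij_betw f (vertex_classes \<Gamma>\<^sub>0) {..<b0 \<Gamma>\<^sub>0})"

definition index :: "'a set \<Rightarrow> nat" where
  "index \<sigma> = class_index (reachable \<Gamma>\<^sub>0 `` \<sigma>)"

definition representative :: "nat \<Rightarrow> 'a" where
  "representative i = (SOME w. w \<in> vertices \<Gamma>\<^sub>0 \<and> index {w} = i)"

lemma bij_class_index: "bij_betw class_index (vertex_classes \<Gamma>\<^sub>0) {..<b0 \<Gamma>\<^sub>0}"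
proof -
  have "\<exists>f. bij_betw f (vertex_classes \<Gamma>\<^sub>0) {..<b0 \<Gamma>\<^sub>0}"
    unfolding b0_eq[OF simplicial0] lessThan_atLeast0
    by (rule ex_bij_betw_finite_nat[OF finite_vertex_classes[OF simplicial0]])
  thus ?thesis unfolding class_index_def by (rule someI_ex)
qed

lemma class_in_vertex_classes: "w \<in> vertices \<Gamma>\<^sub>0 \<Longrightarrow> reachable \<Gamma>\<^sub>0 `` {w} \<in> vertex_classes \<Gamma>\<^sub>0"
  by (simp add: vertex_classes_def)

lemma index_less: "w \<in> vertices \<Gamma>\<^sub>0 \<Longrightarrow> index {w} < b0 \<Gamma>\<^sub>0"
  using bij_betwE[OF bij_class_index] class_in_vertex_classes by (auto simp: index_def)

lemma index_eq_iff:
  assumes "w \<in> vertices \<Gamma>\<^sub>0" "w' \<in> vertices \<Gamma>\<^sub>0"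
  shows "index {w} = index {w'} \<longleftrightarrow> (w, w') \<in> reachable \<Gamma>\<^sub>0"
proof -
  have "index {w} = index {w'} \<longleftrightarrow> reachable \<Gamma>\<^sub>0 `` {w} = reachable \<Gamma>\<^sub>0 `` {w'}"
    unfolding index_def
    using bij_class_index class_in_vertex_classes[OF assms(1)] class_in_vertex_classes[OF assms(2)]
    by (auto simp: bij_betw_def inj_on_eq_iff)
  thus ?thesis by (simp only: reachable_class_eq_iff)
qed

lemma representative:
  assumes "i < b0 \<Gamma>\<^sub>0"
  shows "representative i \<in> vertices \<Gamma>\<^sub>0" "index {representative i} = i"
proof -
  have "i \<in> class_index ` vertex_classes \<Gamma>\<^sub>0"
    using assms bij_class_index by (simp add: bij_betw_def)
  then obtain w where "w \<in> vertices \<Gamma>\<^sub>0" "index {w} = i"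
    unfolding index_def vertex_classes_def by blast
  hence "\<exists>w. w \<in> vertices \<Gamma>\<^sub>0 \<and> index {w} = i" by blast
  hence "representative i \<in> vertices \<Gamma>\<^sub>0 \<and> index {representative i} = i"
    unfolding representative_def by (rule someI_ex)
  thus "representative i \<in> vertices \<Gamma>\<^sub>0" "index {representative i} = i" by simp_all
qed

lemma index_edge:
  assumes "\<sigma> \<in> edges \<Gamma>\<^sub>0" shows "index {edge_head \<sigma>} = index {edge_tail \<sigma>}"
proof -
  have "card \<sigma> = 2" "\<sigma> \<in> \<Gamma>\<^sub>0" using assms by (simp_all add: edges_def)
  hence "{edge_head \<sigma>, edge_tail \<sigma>} \<in> \<Gamma>\<^sub>0" using edge_ends(1)[of \<sigma>] by (metis insert_commute)
  hence "(edge_head \<sigma>, edge_tail \<sigma>) \<in> reachable \<Gamma>\<^sub>0" unfolding reachable_def by blast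
  thus ?thesis using index_eq_iff edge_ends_vertices[OF simplicial0 assms] by blast
qed

text \<open>The last component is dropped: on the chains that occur the coefficients add up to zero.\<close>

definition label :: "nat \<Rightarrow> 'a set \<Rightarrow> (nat \<Rightarrow>\<^sub>0 int)" where
  "label k \<sigma> = (if index \<sigma> < b0 \<Gamma>\<^sub>0 - 1 then frag_of (k + index \<sigma>) else 0)"

text \<open>The boundary of \<open>c\<close> contains \<open>- e \<times> \<partial> (left_slice e c)\<close> and \<open>\<partial> (right_slice e c) \<times> e\<close>, with the labels
  counting the components in \<open>\<Gamma>\<^sub>0\<close> of the other factors. The two counts use disjoint ranges of labels.\<close>

definition crossing :: "('a set \<times> 'a set \<Rightarrow>\<^sub>0 int) \<Rightarrow> (nat \<Rightarrow>\<^sub>0 int)" where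
  "crossing c = frag_extend (label (b0 \<Gamma>\<^sub>0 - 1)) (graph_boundary (right_slice e c))
     - frag_extend (label 0) (graph_boundary (left_slice e c))"

lemma crossing_add: "crossing (c + d) = crossing c + crossing d"
  and crossing_diff: "crossing (c - d) = crossing c - crossing d"
  by (simp_all add: crossing_def slice_linear frag_extend_linear)

lemma keys_label: "keys (frag_extend (label k) p) \<subseteq> {k..<k + (b0 \<Gamma>\<^sub>0 - 1)}"
  by (rule keys_frag_extend_subset[OF subset_UNIV]) (auto simp: label_def keys_frag_of)

lemma keys_crossing: "keys (crossing c) \<subseteq> {..<2 * b0 \<Gamma>\<^sub>0 - 2}"
  unfolding crossing_def
  by (intro keys_diff_subset order_trans[OF keys_label]) auto

lemma crossing_old: "keys c \<subseteq> edges \<Gamma> \<times> edges \<Gamma> \<Longrightarrow> crossing c = 0"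
  by (simp add: crossing_def slice_eq_0)

text \<open>In the deleted product the slices are chains of \<open>\<Gamma>\<^sub>0\<close>, whose boundaries have sum zero on each
  component; the slices of a cycle are cycles.\<close>

lemma crossing_null:
  assumes "c \<in> null_cycles \<Gamma>'" shows "crossing c = 0"
proof -
  obtain l z where lz: "c = l + z" "l \<in> deleted_chains \<Gamma>'" "z \<in> prod_cycles \<Gamma>'"
    using assms unfolding null_cycles_def by blast
  have "keys z \<subseteq> edges \<Gamma>' \<times> edges \<Gamma>'" "prod_boundary z = 0" using lz(3) by (simp_all add: prod_cycles_def)
  hence "graph_boundary (left_slice e z) = 0" "graph_boundary (right_slice e z) = 0"
    using slice_prod_boundary[OF new.edge_products_subset card_e, of z] by (simp_all add: slice_linear)
  moreover have "keys (left_slice e l) \<subseteq> edges \<Gamma>\<^sub>0" "keys (right_slice e l) \<subseteq> edges \<Gamma>\<^sub>0"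
    using lz(2) unfolding deleted_chains_def deleted_cells_new keys_left_slice keys_right_slice edges0 edges'
    using deleted_cells_subset new by (auto simp: remove_stars_def)
  hence "frag_extend (label k) (graph_boundary (left_slice e l)) = 0"
    "frag_extend (label k) (graph_boundary (right_slice e l)) = 0" for k
    by (auto intro!: frag_extend_graph_boundary_eq_0 simp: label_def index_edge)
  ultimately show ?thesis by (simp add: crossing_def lz(1) slice_linear frag_extend_linear)
qed

text \<open>A slice of a relative cycle has its boundary in \<open>\<Gamma>\<^sub>0\<close>, and the sum over each component decides
  whether it bounds there.\<close>

lemma slice_boundary_in_removed:
  assumes c: "c \<in> relative_cycles \<Gamma>'"
  shows "keys (left_slice e c) \<subseteq> edges \<Gamma>'" "keys (right_slice e c) \<subseteq> edges \<Gamma>'"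
    "keys (graph_boundary (left_slice e c)) \<subseteq> nodes \<Gamma>\<^sub>0" "keys (graph_boundary (right_slice e c)) \<subseteq> nodes \<Gamma>\<^sub>0"
proof -
  have k: "keys c \<subseteq> edges \<Gamma>' \<times> edges \<Gamma>'" "keys (prod_boundary c) \<subseteq> deleted_cells \<Gamma>'"
    using c by (simp_all add: relative_cycles_def)
  show s: "keys (left_slice e c) \<subseteq> edges \<Gamma>'" "keys (right_slice e c) \<subseteq> edges \<Gamma>'"
    using k(1) unfolding keys_left_slice keys_right_slice by blast+
  have l: "left_slice e (prod_boundary c) = - graph_boundary (left_slice e c)"
    and r: "right_slice e (prod_boundary c) = graph_boundary (right_slice e c)"
    using slice_prod_boundary[OF new.edge_products_subset[OF k(1)] card_e] by simp_all
  have n: "\<tau> \<in> nodes \<Gamma>\<^sub>0"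
    if "\<tau> \<in> nodes \<Gamma>'" "(e, \<tau>) \<in> keys (prod_boundary c) \<or> (\<tau>, e) \<in> keys (prod_boundary c)" for \<tau>
  proof -
    have "e \<inter> \<tau> = {}" using that(2) k(2) by (auto simp: deleted_cells_eq[OF simplicial'])
    thus ?thesis using that(1) by (auto simp: nodes' nodes0)
  qed
  have "keys (graph_boundary (left_slice e c)) = keys (left_slice e (prod_boundary c))" by (simp add: l)
  moreover have "keys (graph_boundary (left_slice e c)) \<subseteq> nodes \<Gamma>'"
    by (rule graph_boundary_in_nodes[OF simplicial' s(1)])
  ultimately show "keys (graph_boundary (left_slice e c)) \<subseteq> nodes \<Gamma>\<^sub>0"
    using n by (auto simp: keys_left_slice)
  have "keys (graph_boundary (right_slice e c)) \<subseteq> nodes \<Gamma>'"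
    by (rule graph_boundary_in_nodes[OF simplicial' s(2)])
  thus "keys (graph_boundary (right_slice e c)) \<subseteq> nodes \<Gamma>\<^sub>0"
    using n by (auto simp: keys_right_slice simp flip: r)
qed

text \<open>The total coefficient sum of a boundary is zero, so the dropped label vanishes with the others.\<close>

lemma boundary_if_labels_vanish:
  assumes q: "keys q \<subseteq> edges \<Gamma>'" and p: "keys (graph_boundary q) \<subseteq> nodes \<Gamma>\<^sub>0"
    and zero: "frag_extend (label k) (graph_boundary q) = 0"
  obtains c where "keys c \<subseteq> edges \<Gamma>\<^sub>0" "graph_boundary c = graph_boundary q"
proof -
  let ?p = "graph_boundary q"
  define m where "m = frag_extend (\<lambda>\<sigma>. frag_of (index \<sigma>)) ?p"
  have "keys m \<subseteq> {..<b0 \<Gamma>\<^sub>0}"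
    unfolding m_def by (rule keys_frag_extend_subset[OF p]) (auto simp: keys_frag_of nodes_eq index_less)
  moreover have "frag_extend (\<lambda>_. frag_of ()) m = frag_extend (\<lambda>_. frag_of ()) ?p"
    using subset_UNIV[of "keys ?p"] unfolding m_def
    by (induction rule: frag_induction) (simp_all add: frag_extend_linear)
  moreover have "frag_extend (\<lambda>_. frag_of ()) ?p = 0"
    by (rule frag_extend_graph_boundary_eq_0[OF q]) simp
  moreover have "frag_extend (\<lambda>i. if i < b0 \<Gamma>\<^sub>0 - 1 then frag_of i else 0) m = 0"
  proof -
    have "frag_extend (\<lambda>i. if k \<le> i then frag_of (i - k) else 0) (frag_extend (label k) x)
        = frag_extend (\<lambda>i. if i < b0 \<Gamma>\<^sub>0 - 1 then frag_of i else 0) (frag_extend (\<lambda>\<sigma>. frag_of (index \<sigma>)) x)" for x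
      using subset_UNIV[of "keys x"]
      by (induction x rule: frag_induction) (simp_all add: frag_extend_linear label_def)
    from this[of ?p] show ?thesis by (simp add: m_def zero)
  qed
  ultimately have "m = 0" by (intro frag_eq_0_if_truncation_eq_0[of m]) simp_all
  moreover have "frag_extend (\<lambda>\<sigma>. frag_of {representative (index {the_elem \<sigma>})}) ?p
      = frag_extend (\<lambda>i. frag_of {representative i}) m"
    using p unfolding m_def
    by (induction rule: frag_induction) (auto simp: frag_extend_linear nodes_eq)
  ultimately have "frag_extend (\<lambda>\<sigma>. frag_of {representative (index {the_elem \<sigma>})}) ?p = 0" by simp
  moreover have "(representative (index {w}), w) \<in> reachable \<Gamma>\<^sub>0" if "w \<in> vertices \<Gamma>\<^sub>0" for w
    using representative[OF index_less[OF that]] index_eq_iff that by blast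
  ultimately show ?thesis
    using boundary_if_representatives_vanish[of \<Gamma>\<^sub>0 "\<lambda>w. representative (index {w})", OF _ p] that by blast
qed

text \<open>Replacing the new edge by a path in \<open>\<Gamma>\<close> retracts the chains of \<open>\<Gamma>'\<close> onto those of \<open>\<Gamma>\<close>.\<close>

lemma retract_to_old:
  assumes c: "keys c \<subseteq> edges \<Gamma>' \<times> edges \<Gamma>'" and bd: "keys (prod_boundary c) \<subseteq> deleted_cells \<Gamma>"
  obtains c\<^sub>0 where "c\<^sub>0 \<in> relative_cycles \<Gamma>" "c - c\<^sub>0 \<in> prod_cycles \<Gamma>'"
proof -
  have vv: "u \<in> vertices \<Gamma>" "v \<in> vertices \<Gamma>" using ends by (simp_all add: vertices_def)
  obtain a where a: "keys a \<subseteq> edges \<Gamma>" "graph_boundary a = frag_of {u} - frag_of {v}"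
    using path_chain[OF reach[OF vv(2,1)]] by blast
  obtain s where s: "s = 1 \<or> s = -1" "frag_of e = frag_cmul s \<epsilon>" by (rule orientation)
  define f where "f = (\<lambda>\<sigma>. if \<sigma> = e then frag_cmul s a else frag_of \<sigma>)"
  have f_edges: "keys (f \<sigma>) \<subseteq> edges \<Gamma>" if "\<sigma> \<in> edges \<Gamma>'" for \<sigma>
    using that a(1) keys_cmul_subset[OF a(1)] by (auto simp: f_def edges' keys_frag_of)
  have "graph_boundary (frag_of e) = frag_cmul s (graph_boundary a)"
    unfolding s(2) frag_extend_cmul \<epsilon>_boundary a(2) ..
  hence f_bd: "graph_boundary (f \<sigma>) = graph_bd \<sigma>" for \<sigma> by (simp add: f_def frag_extend_cmul)
  have f_old: "frag_extend f x = x" if "e \<notin> keys x" for x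
  proof -
    have "frag_extend f x = frag_extend frag_of x" using that by (intro frag_extend_eq) (auto simp: f_def)
    thus ?thesis using frag_expansion[of x] by simp
  qed
  have chain_map: "prod_boundary (tensor_map f f x) = tensor_map f f (prod_boundary x)"
    if "keys x \<subseteq> edges \<Gamma>' \<times> edges \<Gamma>'" for x
    using that
  proof (induction x rule: prod_chain_induct)
    case (cross \<sigma> \<tau>)
    have "e \<notin> keys (graph_bd \<rho>)" if "\<rho> \<in> edges \<Gamma>'" for \<rho>
      using graph_bd_in_nodes[OF simplicial' that] e_notin(2) nodes' by blast
    hence bd: "frag_extend f (graph_bd \<sigma>) = graph_bd \<sigma>" "frag_extend f (graph_bd \<tau>) = graph_bd \<tau>"
      using cross f_old by blast+
    have 2: "keys (frag_of \<sigma>) \<subseteq> {\<sigma>. card \<sigma> = 2}" "keys (f \<sigma>) \<subseteq> {\<sigma>. card \<sigma> = 2}"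
      using cross(1) f_edges[OF cross(1)] edges_subset by (auto simp: keys_frag_of edges_def)
    show ?case
      by (simp add: tensor_map_cross_chain prod_boundary_cross_edges[OF 2(1)]
          prod_boundary_cross_edges[OF 2(2)] tensor_map_linear f_bd bd)
  qed (simp_all add: tensor_map_linear frag_extend_diff)
  have "tensor_map f f (prod_boundary c) = tensor_map frag_of frag_of (prod_boundary c)"
    unfolding tensor_map_def
  proof (rule frag_extend_eq)
    fix \<rho> assume "\<rho> \<in> keys (prod_boundary c)"
    hence "fst \<rho> \<noteq> e" "snd \<rho> \<noteq> e" using bd deleted_cells_subset new by auto
    thus "(case \<rho> of (\<sigma>, \<tau>) \<Rightarrow> cross_chain (f \<sigma>) (f \<tau>)) = (case \<rho> of (\<sigma>, \<tau>) \<Rightarrow> cross_chain (frag_of \<sigma>) (frag_of \<tau>))"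
      by (simp add: f_def case_prod_unfold)
  qed
  hence bd_eq: "prod_boundary (tensor_map f f c) = prod_boundary c"
    by (simp add: chain_map[OF c] tensor_map_frag_of)
  have k: "keys (tensor_map f f c) \<subseteq> edges \<Gamma> \<times> edges \<Gamma>"
    by (rule keys_tensor_map[OF c f_edges f_edges])
  have "keys (c - tensor_map f f c) \<subseteq> edges \<Gamma>' \<times> edges \<Gamma>'"
    using k old_in_new(1) by (intro keys_diff_subset[OF c]) blast
  thus ?thesis
    using that[of "tensor_map f f c"] k bd by (simp add: relative_cycles_def prod_cycles_def bd_eq frag_extend_diff)
qed

text \<open>When all labels vanish, the slices of \<open>c\<close> have the boundaries of chains \<open>c\<^sub>1\<close> and \<open>c\<^sub>2\<close> of \<open>\<Gamma>\<^sub>0\<close>.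
  Subtracting \<open>e \<times> c\<^sub>1 + c\<^sub>2 \<times> e\<close>, a chain of the deleted product, removes \<open>e\<close> from the boundary.\<close>

proposition image_chains:
  assumes c: "c \<in> relative_cycles \<Gamma>'"
  shows "crossing c = 0 \<longleftrightarrow> (\<exists>c\<^sub>0\<in>relative_cycles \<Gamma>. c - c\<^sub>0 \<in> null_cycles \<Gamma>')"
proof
  assume "\<exists>c\<^sub>0\<in>relative_cycles \<Gamma>. c - c\<^sub>0 \<in> null_cycles \<Gamma>'"
  then obtain c\<^sub>0 where "keys c\<^sub>0 \<subseteq> edges \<Gamma> \<times> edges \<Gamma>" "c - c\<^sub>0 \<in> null_cycles \<Gamma>'"
    by (auto simp: relative_cycles_def)
  thus "crossing c = 0" using crossing_null[of "c - c\<^sub>0"] by (simp add: crossing_diff crossing_old)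
next
  assume zero: "crossing c = 0"
  let ?l = "frag_extend (label 0) (graph_boundary (left_slice e c))"
  let ?r = "frag_extend (label (b0 \<Gamma>\<^sub>0 - 1)) (graph_boundary (right_slice e c))"
  have "?r = ?l" using zero by (simp add: crossing_def)
  hence "keys ?r \<subseteq> {0..<0 + (b0 \<Gamma>\<^sub>0 - 1)} \<inter> {b0 \<Gamma>\<^sub>0 - 1..<b0 \<Gamma>\<^sub>0 - 1 + (b0 \<Gamma>\<^sub>0 - 1)}"
    using keys_label by (metis Int_subset_iff)
  hence "keys ?r = {}" by fastforce
  hence "?r = 0" "?l = 0" using \<open>?r = ?l\<close> by simp_all
  note s = slice_boundary_in_removed[OF c]
  obtain c\<^sub>1 where c1: "keys c\<^sub>1 \<subseteq> edges \<Gamma>\<^sub>0" "graph_boundary c\<^sub>1 = graph_boundary (left_slice e c)"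
    by (rule boundary_if_labels_vanish[OF s(1,3) \<open>?l = 0\<close>])
  obtain c\<^sub>2 where c2: "keys c\<^sub>2 \<subseteq> edges \<Gamma>\<^sub>0" "graph_boundary c\<^sub>2 = graph_boundary (right_slice e c)"
    by (rule boundary_if_labels_vanish[OF s(2,4) \<open>?r = 0\<close>])
  obtain t where t: "t = 1 \<or> t = -1" "frag_of e = frag_cmul t \<epsilon>" by (rule orientation)
  define d where "d = cross_chain (frag_of e) c\<^sub>1 + cross_chain c\<^sub>2 (frag_of e)"
  have "d = cross_chain \<epsilon> (frag_cmul t c\<^sub>1) + cross_chain (frag_cmul t c\<^sub>2) \<epsilon>"
    by (simp add: d_def t(2) cross_chain_linear)
  hence d: "d \<in> deleted_chains \<Gamma>'"
    using cross_\<epsilon>_deleted keys_cmul_subset[OF c1(1)] keys_cmul_subset[OF c2(1)]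
    by (simp only: new.deleted_chains_add)
  have "lookup c\<^sub>1 e = 0" "lookup c\<^sub>2 e = 0" using c1(1) c2(1) old_in_new(2) by (auto intro!: lookup_e_eq_0)
  hence slices: "graph_boundary (left_slice e (c - d)) = 0" "graph_boundary (right_slice e (c - d)) = 0"
    using c1(2) c2(2) by (simp_all add: d_def slice_linear slice_cross_chain frag_extend_linear)
  have cd: "c - d \<in> relative_cycles \<Gamma>'"
    using c d new.deleted_chains_subset by (intro new.relative_cycles_diff) auto
  hence k: "keys (c - d) \<subseteq> edges \<Gamma>' \<times> edges \<Gamma>'" "keys (prod_boundary (c - d)) \<subseteq> deleted_cells \<Gamma>'"
    by (simp_all add: relative_cycles_def)
  have "left_slice e (prod_boundary (c - d)) = 0" "right_slice e (prod_boundary (c - d)) = 0"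
    using slice_prod_boundary[OF new.edge_products_subset[OF k(1)] card_e] slices by simp_all
  hence "keys (prod_boundary (c - d)) \<subseteq> deleted_cells \<Gamma>" by (rule deleted_cells_without_e[OF k(2)])
  from retract_to_old[OF k(1) this] obtain c\<^sub>0
    where c0: "c\<^sub>0 \<in> relative_cycles \<Gamma>" "(c - d) - c\<^sub>0 \<in> prod_cycles \<Gamma>'" .
  have "c - c\<^sub>0 = d + ((c - d) - c\<^sub>0)" by simp
  also have "\<dots> \<in> null_cycles \<Gamma>'" by (rule new.null_cyclesI[OF d c0(2)])
  finally show "\<exists>c\<^sub>0\<in>relative_cycles \<Gamma>. c - c\<^sub>0 \<in> null_cycles \<Gamma>'" using c0(1) by blast
qed

text \<open>The product of the new edge with a path to the last component, whose label is dropped. The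
  correction \<open>d\<close> pushes \<open>\<partial>e \<times> q\<close> off the diagonal and does not involve \<open>e\<close>.\<close>

lemma crossing_attains_generator:
  assumes branch: "b \<in> vertices \<Gamma>" "card (neighbours \<Gamma> b) \<ge> 3" and i: "i < b0 \<Gamma>\<^sub>0 - 1"
  obtains c where "c \<in> relative_cycles \<Gamma>'" "crossing c = frag_of i"
    "crossing (swap_chain c) = frag_of (b0 \<Gamma>\<^sub>0 - 1 + i)"
proof -
  define w where "w = representative i"
  define w' where "w' = representative (b0 \<Gamma>\<^sub>0 - 1)"
  have w: "w \<in> vertices \<Gamma>\<^sub>0" "index {w} = i" "w' \<in> vertices \<Gamma>\<^sub>0" "index {w'} = b0 \<Gamma>\<^sub>0 - 1"
    unfolding w_def w'_def by (rule representative; use i in linarith)+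
  hence wv: "w \<in> vertices \<Gamma>" "w' \<in> vertices \<Gamma>" "w \<notin> e" "w' \<notin> e" by (auto simp: vertices0)
  obtain q where q: "keys q \<subseteq> edges \<Gamma>" "graph_boundary q = frag_of {w'} - frag_of {w}"
    by (rule path_chain[OF reach[OF wv(1,2)]])
  let ?x = "cross_chain (graph_bd e) q"
  have bde: "keys (graph_bd e) \<subseteq> {{u}, {v}}"
    unfolding graph_bd_edge[OF card_e] using edge_ends(1)[OF card_e]
    by (intro keys_diff_subset) (auto simp: keys_frag_of doubleton_eq_iff)
  have "keys (graph_bd e) \<subseteq> nodes \<Gamma>" using bde ends by (auto simp: nodes_def)
  hence x: "keys ?x \<subseteq> edges \<Gamma> \<times> nodes \<Gamma> \<union> nodes \<Gamma> \<times> edges \<Gamma>"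
    using q(1) unfolding keys_cross_chain by blast
  have kw: "keys (frag_of {w'} - frag_of {w}) \<subseteq> {{w}, {w'}}"
    by (intro keys_diff_subset) (auto simp: keys_frag_of)
  have "prod_boundary ?x = cross_chain (graph_bd e) (frag_of {w'} - frag_of {w})"
    using bde by (subst prod_boundary_cross_vertices) (auto simp: q(2))
  moreover have "keys \<dots> \<subseteq> {{u}, {v}} \<times> {{w}, {w'}}"
    using bde kw unfolding keys_cross_chain by blast
  moreover have "\<dots> \<subseteq> deleted_cells \<Gamma>"
    using ends wv by (auto simp: deleted_cells_eq[OF simplicial] vertices_def)
  ultimately have "keys (prod_boundary ?x) \<subseteq> deleted_cells \<Gamma>" by (simp only: order_trans)
  from deformable_if_relative_cycle[OF simplicial reach branch x this]
  obtain d where d: "keys d \<subseteq> edges \<Gamma> \<times> edges \<Gamma>" "keys (?x - prod_boundary d) \<subseteq> deleted_cells \<Gamma>" by blast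
  let ?c = "cross_chain (frag_of e) q - d"
  have k: "keys ?c \<subseteq> edges \<Gamma>' \<times> edges \<Gamma>'"
    using d(1) q(1) by (intro keys_diff_subset) (auto simp: keys_cross_chain keys_frag_of edges')
  have "keys (frag_of e) \<subseteq> {\<sigma>. card \<sigma> = 2}" using card_e by (simp add: keys_frag_of)
  hence "prod_boundary ?c = (?x - prod_boundary d) - cross_chain (frag_of e) (frag_of {w'} - frag_of {w})"
    by (simp add: frag_extend_diff prod_boundary_cross_edges q(2))
  moreover have "keys (cross_chain (frag_of e) (frag_of {w'} - frag_of {w})) \<subseteq> deleted_cells \<Gamma>'"
  proof -
    have "{w} \<in> \<Gamma>\<^sub>0" "{w'} \<in> \<Gamma>\<^sub>0" using w by (simp_all add: vertices_def)
    hence "{e} \<times> {{w}, {w'}} \<subseteq> deleted_cells \<Gamma>'" unfolding deleted_cells_new by blast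
    thus ?thesis using kw unfolding keys_cross_chain keys_frag_of by blast
  qed
  moreover have "keys (?x - prod_boundary d) \<subseteq> deleted_cells \<Gamma>'"
    using d(2) deleted_cells_new by blast
  ultimately have "keys (prod_boundary ?c) \<subseteq> deleted_cells \<Gamma>'"
    by (simp only: keys_diff_subset)
  with k have c: "?c \<in> relative_cycles \<Gamma>'" by (simp add: relative_cycles_def)
  have slices: "left_slice e ?c = q" "right_slice e ?c = 0"
    using slice_eq_0[OF d(1)] lookup_e_eq_0[OF q(1)] by (simp_all add: slice_linear slice_cross_chain)
  have "label k {w} = frag_of (k + i)" "label k {w'} = 0" for k using w i by (simp_all add: label_def)
  hence "crossing ?c = frag_of i" "crossing (swap_chain ?c) = frag_of (b0 \<Gamma>\<^sub>0 - 1 + i)"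
    using slice_swap_chain[OF new.edge_products_subset[OF k], of e]
    by (simp_all add: crossing_def slices q(2) frag_extend_linear)
  with c show ?thesis using that by blast
qed

proposition crossing_surjective:
  assumes branch: "b \<in> vertices \<Gamma>" "card (neighbours \<Gamma> b) \<ge> 3" and m: "keys m \<subseteq> {..<2 * b0 \<Gamma>\<^sub>0 - 2}"
  shows "\<exists>c\<in>relative_cycles \<Gamma>'. crossing c = m"
  using m
proof (induction m rule: frag_induction)
  case zero
  show ?case by (rule bexI[of _ 0]) (simp_all add: crossing_old relative_cycles_def)
next
  case (one i)
  show ?case
  proof (cases "i < b0 \<Gamma>\<^sub>0 - 1")
    case True
    thus ?thesis using crossing_attains_generator[OF branch] by metis
  next
    case False
    with one have "i - (b0 \<Gamma>\<^sub>0 - 1) < b0 \<Gamma>\<^sub>0 - 1" "b0 \<Gamma>\<^sub>0 - 1 + (i - (b0 \<Gamma>\<^sub>0 - 1)) = i" by auto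
    thus ?thesis using crossing_attains_generator[OF branch] new.swap_relative_cycles by metis
  qed
next
  case (diff m m')
  thus ?case using new.relative_cycles_diff crossing_diff by metis
qed

end

section \<open>The exact sequence of cokernels\<close>

context connected_graph
begin

lemma Q_class_add:
  "c \<in> relative_cycles \<Gamma> \<Longrightarrow> d \<in> relative_cycles \<Gamma> \<Longrightarrow>
     Q_class \<Gamma> (c + d) = Q_class \<Gamma> c \<otimes>\<^bsub>Q \<Gamma>\<^esub> Q_class \<Gamma> d"
  using hom_mult[OF Q_class_hom, of c d] by (simp add: carrier_Z2_rel cell_relcycles_simps)

lemma Q_class_closed: "c \<in> relative_cycles \<Gamma> \<Longrightarrow> Q_class \<Gamma> c \<in> carrier (Q \<Gamma>)"
  by (simp add: carrier_Q)

lemma zero_relative_cycle: "0 \<in> relative_cycles \<Gamma>"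
  by (simp add: relative_cycles_def)

lemma Q_class_eq_one_iff:
  assumes "c \<in> relative_cycles \<Gamma>"
  shows "Q_class \<Gamma> c = \<one>\<^bsub>Q \<Gamma>\<^esub> \<longleftrightarrow> c \<in> null_cycles \<Gamma>"
proof -
  interpret Q: comm_group "Q \<Gamma>" by (rule comm_group_Q)
  note z = zero_relative_cycle
  have "Q_class \<Gamma> 0 = \<one>\<^bsub>Q \<Gamma>\<^esub>"
    using Q_class_add[OF z z] Q.l_cancel_one'[OF Q_class_closed[OF z] Q_class_closed[OF z]] by simp
  thus ?thesis using Q_class_eq_iff[OF assms z] by simp
qed

end

context edge_addition
begin

lemma Q_inclusion_Q_class:
  assumes "c \<in> relative_cycles \<Gamma>"
  shows "Q_inclusion \<Gamma>' (Q_class \<Gamma> c) = Q_class \<Gamma>' c"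
proof -
  have "Q_map \<Gamma>' id (Q_class \<Gamma> c) = Q_class \<Gamma>' (id c)"
    using old_in_new(3-5)
    by (intro Q_map_Q_class[OF connected_graph_axioms new.connected_graph_axioms _ _ _ _ assms]) simp_all
  thus ?thesis by (simp add: Q_inclusion_def)
qed

lemma Q_involution_Q_class:
  assumes "c \<in> relative_cycles \<Gamma>"
  shows "Q_involution \<Gamma> (Q_class \<Gamma> c) = Q_class \<Gamma> (swap_chain c)"
  unfolding Q_involution_def
  using swap_relative_cycles swap_deleted_chains swap_prod_cycles
  by (intro Q_map_Q_class[OF connected_graph_axioms connected_graph_axioms _ _ _ _ assms])
     (auto simp: swap_chain_linear)

lemma Q_inclusion_hom: "group_hom (Q \<Gamma>) (Q \<Gamma>') (Q_inclusion \<Gamma>')"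
proof -
  interpret Q: comm_group "Q \<Gamma>" by (rule comm_group_Q)
  interpret Q': comm_group "Q \<Gamma>'" by (rule new.comm_group_Q)
  have "Q_inclusion \<Gamma>' \<in> hom (Q \<Gamma>) (Q \<Gamma>')"
  proof (rule homI)
    fix X assume "X \<in> carrier (Q \<Gamma>)"
    then obtain c where c: "c \<in> relative_cycles \<Gamma>" "X = Q_class \<Gamma> c" by (auto simp: carrier_Q)
    hence c': "c \<in> relative_cycles \<Gamma>'" using old_in_new by blast
    thus "Q_inclusion \<Gamma>' X \<in> carrier (Q \<Gamma>')"
      by (simp add: c(2) Q_inclusion_Q_class[OF c(1)] new.Q_class_closed)
    fix Y assume "Y \<in> carrier (Q \<Gamma>)"
    then obtain d where d: "d \<in> relative_cycles \<Gamma>" "Y = Q_class \<Gamma> d" by (auto simp: carrier_Q)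
    hence d': "d \<in> relative_cycles \<Gamma>'" using old_in_new by blast
    show "Q_inclusion \<Gamma>' (X \<otimes>\<^bsub>Q \<Gamma>\<^esub> Y) = Q_inclusion \<Gamma>' X \<otimes>\<^bsub>Q \<Gamma>'\<^esub> Q_inclusion \<Gamma>' Y"
      by (simp only: c(2) d(2) Q_class_add[OF c(1) d(1), symmetric] Q_inclusion_Q_class[OF c(1)]
          Q_inclusion_Q_class[OF d(1)] Q_inclusion_Q_class[OF relative_cycles_add[OF c(1) d(1)]]
          new.Q_class_add[OF c' d'])
  qed
  thus ?thesis by (simp add: group_hom_def group_hom_axioms_def Q.is_group Q'.is_group)
qed

lemma linking_image_eq:
  obtains a where "keys a \<subseteq> edges \<Gamma>" "graph_boundary a = frag_of {u} - frag_of {v}"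
    "linking_image \<Gamma> v u = (\<lambda>c. Q_class \<Gamma> (cross_chain a c)) ` cycles \<Gamma>\<^sub>0"
proof -
  define P where "P = (\<lambda>a. a \<in> carrier (graph_chains 1 \<Gamma>) \<and> graph_boundary a = frag_of {u} - frag_of {v})"
  have P: "P a \<longleftrightarrow> keys a \<subseteq> edges \<Gamma> \<and> graph_boundary a = frag_of {u} - frag_of {v}" for a
    unfolding P_def cell_chains_def dims by simp
  have "u \<in> vertices \<Gamma>" "v \<in> vertices \<Gamma>" using ends by (simp_all add: vertices_def)
  then obtain a where "P a" using path_chain[OF reach] P by metis
  hence a: "P (SOME a. P a)" by (rule someI)
  have "Lk \<Gamma> v u {c} = Q_class \<Gamma> (cross_chain (SOME a. P a) c)" for c
    by (simp add: Lk_def P_def)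
  hence "linking_image \<Gamma> v u = (\<lambda>c. Q_class \<Gamma> (cross_chain (SOME a. P a) c)) ` cycles \<Gamma>\<^sub>0"
    unfolding linking_image_def removed.carrier_H1 image_image by simp
  with a that show ?thesis unfolding P by blast
qed

text \<open>The involution turns \<open>a \<times> c\<close> into \<open>- c \<times> a\<close>, so the sums of linking classes are the classes in
  \<open>kernel_chains\<close>. In particular they form a subgroup.\<close>

lemma carrier_linking_subgroup:
  "carrier (linking_subgroup \<Gamma> v u) = kernel (Q \<Gamma>) (Q \<Gamma>') (Q_inclusion \<Gamma>')"
proof -
  obtain a where a: "keys a \<subseteq> edges \<Gamma>" "graph_boundary a = frag_of {u} - frag_of {v}"
    and A: "linking_image \<Gamma> v u = (\<lambda>c. Q_class \<Gamma> (cross_chain a c)) ` cycles \<Gamma>\<^sub>0"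
    by (rule linking_image_eq)
  note link = linking_chain_relative_cycle[OF a]
  have minus: "- c \<in> cycles \<Gamma>\<^sub>0" if "c \<in> cycles \<Gamma>\<^sub>0" for c
    using that by (simp add: cycles_def frag_extend_minus)
  have swap: "swap_chain (cross_chain a c) = cross_chain (- c) a" if "c \<in> cycles \<Gamma>\<^sub>0" for c
  proof -
    have "keys a \<subseteq> {\<sigma>. card \<sigma> = Suc 1}" "keys c \<subseteq> {\<sigma>. card \<sigma> = Suc 1}"
      using a(1) that by (auto simp: cycles_def edges_def)
    from swap_chain_cross[OF this] show ?thesis by (simp add: cross_chain_linear)
  qed
  have "Q_involution \<Gamma> ` linking_image \<Gamma> v u = (\<lambda>c. Q_class \<Gamma> (cross_chain (- c) a)) ` cycles \<Gamma>\<^sub>0"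
    unfolding A image_image using Q_involution_Q_class[OF link(1)] swap by simp
  also have "\<dots> = (\<lambda>c. Q_class \<Gamma> (cross_chain c a)) ` cycles \<Gamma>\<^sub>0"
  proof -
    have "uminus ` cycles \<Gamma>\<^sub>0 = cycles \<Gamma>\<^sub>0" using minus by (force simp: image_iff intro: bexI[of _ "- _"])
    thus ?thesis by (metis (no_types, lifting) image_cong image_image)
  qed
  finally have tA: "Q_involution \<Gamma> ` linking_image \<Gamma> v u = (\<lambda>c. Q_class \<Gamma> (cross_chain c a)) ` cycles \<Gamma>\<^sub>0" .
  have "carrier (linking_subgroup \<Gamma> v u)
      = {Q_class \<Gamma> (cross_chain a c\<^sub>1) \<otimes>\<^bsub>Q \<Gamma>\<^esub> Q_class \<Gamma> (cross_chain c\<^sub>2 a) | c\<^sub>1 c\<^sub>2.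
          c\<^sub>1 \<in> cycles \<Gamma>\<^sub>0 \<and> c\<^sub>2 \<in> cycles \<Gamma>\<^sub>0}"
    unfolding linking_subgroup_def tA unfolding A by (auto simp: set_mult_def)
  also have "\<dots> = {Q_class \<Gamma> (cross_chain a c\<^sub>1 + cross_chain c\<^sub>2 a) | c\<^sub>1 c\<^sub>2.
          c\<^sub>1 \<in> cycles \<Gamma>\<^sub>0 \<and> c\<^sub>2 \<in> cycles \<Gamma>\<^sub>0}"
    using Q_class_add[OF link(1) link(2)] by (intro Collect_cong ex_cong1) auto
  also have "\<dots> = kernel (Q \<Gamma>) (Q \<Gamma>') (Q_inclusion \<Gamma>')"
  proof (intro equalityI subsetI)
    fix X assume "X \<in> {Q_class \<Gamma> (cross_chain a c\<^sub>1 + cross_chain c\<^sub>2 a) | c\<^sub>1 c\<^sub>2.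
          c\<^sub>1 \<in> cycles \<Gamma>\<^sub>0 \<and> c\<^sub>2 \<in> cycles \<Gamma>\<^sub>0}"
    then obtain c\<^sub>1 c\<^sub>2 where c: "c\<^sub>1 \<in> cycles \<Gamma>\<^sub>0" "c\<^sub>2 \<in> cycles \<Gamma>\<^sub>0"
      and X: "X = Q_class \<Gamma> (cross_chain a c\<^sub>1 + cross_chain c\<^sub>2 a)" by blast
    have r: "cross_chain a c\<^sub>1 + cross_chain c\<^sub>2 a \<in> relative_cycles \<Gamma>"
      by (rule relative_cycles_add[OF link(1)[OF c(1)] link(2)[OF c(2)]])
    have n: "cross_chain a c\<^sub>1 + cross_chain c\<^sub>2 a \<in> null_cycles \<Gamma>'"
      by (rule new.null_cycles_add[OF link(3)[OF c(1)] link(4)[OF c(2)]])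
    have "cross_chain a c\<^sub>1 + cross_chain c\<^sub>2 a \<in> relative_cycles \<Gamma>'" using r old_in_new(5) by blast
    thus "X \<in> kernel (Q \<Gamma>) (Q \<Gamma>') (Q_inclusion \<Gamma>')"
      using n by (simp add: kernel_def X Q_class_closed[OF r] Q_inclusion_Q_class[OF r] new.Q_class_eq_one_iff)
  next
    fix X assume "X \<in> kernel (Q \<Gamma>) (Q \<Gamma>') (Q_inclusion \<Gamma>')"
    then obtain c where c: "c \<in> relative_cycles \<Gamma>" "X = Q_class \<Gamma> c" "Q_inclusion \<Gamma>' X = \<one>\<^bsub>Q \<Gamma>'\<^esub>"
      by (auto simp: kernel_def carrier_Q)
    have "c \<in> relative_cycles \<Gamma>'" using c(1) old_in_new(5) by blast
    hence "c \<in> null_cycles \<Gamma>'"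
      using c(3) new.Q_class_eq_one_iff by (simp add: c(2) Q_inclusion_Q_class[OF c(1)])
    then obtain c\<^sub>1 c\<^sub>2 where d: "c\<^sub>1 \<in> cycles \<Gamma>\<^sub>0" "c\<^sub>2 \<in> cycles \<Gamma>\<^sub>0"
      "c - (cross_chain a c\<^sub>1 + cross_chain c\<^sub>2 a) \<in> null_cycles \<Gamma>"
      using kernel_chains[OF a c(1)] by blast
    have "cross_chain a c\<^sub>1 + cross_chain c\<^sub>2 a \<in> relative_cycles \<Gamma>"
      by (rule relative_cycles_add[OF link(1)[OF d(1)] link(2)[OF d(2)]])
    hence "X = Q_class \<Gamma> (cross_chain a c\<^sub>1 + cross_chain c\<^sub>2 a)"
      using Q_class_eq_iff[OF c(1)] d(3) c(2) by blast
    with d show "X \<in> {Q_class \<Gamma> (cross_chain a c\<^sub>1 + cross_chain c\<^sub>2 a) | c\<^sub>1 c\<^sub>2.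
          c\<^sub>1 \<in> cycles \<Gamma>\<^sub>0 \<and> c\<^sub>2 \<in> cycles \<Gamma>\<^sub>0}" by blast
  qed
  finally show ?thesis .
qed

lemma linking_subgroup_group_hom: "group_hom (linking_subgroup \<Gamma> v u) (Q \<Gamma>) id"
proof -
  interpret i: group_hom "Q \<Gamma>" "Q \<Gamma>'" "Q_inclusion \<Gamma>'" by (rule Q_inclusion_hom)
  have sub: "subgroup (carrier (linking_subgroup \<Gamma> v u)) (Q \<Gamma>)"
    unfolding carrier_linking_subgroup by (rule i.subgroup_kernel)
  have eq: "linking_subgroup \<Gamma> v u = (Q \<Gamma>)\<lparr>carrier := carrier (linking_subgroup \<Gamma> v u)\<rparr>"
    by (simp add: linking_subgroup_def)
  have "group (linking_subgroup \<Gamma> v u)"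
    by (subst eq) (rule subgroup.subgroup_is_group[OF sub i.G.is_group])
  moreover have "id \<in> hom (linking_subgroup \<Gamma> v u) (Q \<Gamma>)"
    using subgroup.subset[OF sub] by (auto simp: hom_def linking_subgroup_def)
  ultimately show ?thesis by (simp add: group_hom_def group_hom_axioms_def)
qed

abbreviation crossing_group :: "(nat \<Rightarrow>\<^sub>0 int) monoid" where
  "crossing_group \<equiv> free_Abelian_group {..<2 * b0 \<Gamma>\<^sub>0 - 2}"

text \<open>Any representative may be chosen, since \<open>crossing\<close> vanishes on null cycles.\<close>

definition crossing_map :: "('a set \<times> 'a set \<Rightarrow>\<^sub>0 int) set set \<Rightarrow> (nat \<Rightarrow>\<^sub>0 int)" where
  "crossing_map X = crossing (SOME c. c \<in> relative_cycles \<Gamma>' \<and> Q_class \<Gamma>' c = X)"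

lemma crossing_map_Q_class:
  assumes "c \<in> relative_cycles \<Gamma>'" shows "crossing_map (Q_class \<Gamma>' c) = crossing c"
proof -
  let ?P = "\<lambda>d. d \<in> relative_cycles \<Gamma>' \<and> Q_class \<Gamma>' d = Q_class \<Gamma>' c"
  have "?P (SOME d. ?P d)" by (rule someI[of ?P c]) (simp add: assms)
  hence "(SOME d. ?P d) - c \<in> null_cycles \<Gamma>'" using new.Q_class_eq_iff assms by blast
  from crossing_null[OF this] show ?thesis by (simp add: crossing_map_def crossing_diff)
qed

lemma crossing_map_hom:
  "group_hom (Q \<Gamma>') (crossing_group) crossing_map"
proof -
  interpret Q': comm_group "Q \<Gamma>'" by (rule new.comm_group_Q)
  have "crossing_map \<in> hom (Q \<Gamma>') (crossing_group)"
  proof (rule homI)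
    fix X assume "X \<in> carrier (Q \<Gamma>')"
    then obtain c where c: "c \<in> relative_cycles \<Gamma>'" "X = Q_class \<Gamma>' c" by (auto simp: new.carrier_Q)
    show "crossing_map X \<in> carrier (crossing_group)"
      unfolding c(2) crossing_map_Q_class[OF c(1)] carrier_free_Abelian_group_iff by (rule keys_crossing)
    fix Y assume "Y \<in> carrier (Q \<Gamma>')"
    then obtain d where d: "d \<in> relative_cycles \<Gamma>'" "Y = Q_class \<Gamma>' d" by (auto simp: new.carrier_Q)
    show "crossing_map (X \<otimes>\<^bsub>Q \<Gamma>'\<^esub> Y)
        = crossing_map X \<otimes>\<^bsub>crossing_group\<^esub> crossing_map Y"
      by (simp only: c(2) d(2) new.Q_class_add[OF c(1) d(1), symmetric] mult_free_Abelian_group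
          crossing_map_Q_class[OF c(1)] crossing_map_Q_class[OF d(1)]
          crossing_map_Q_class[OF new.relative_cycles_add[OF c(1) d(1)]] crossing_add)
  qed
  thus ?thesis by (simp add: group_hom_def group_hom_axioms_def Q'.is_group)
qed

lemma image_Q_inclusion:
  "Q_inclusion \<Gamma>' ` carrier (Q \<Gamma>) = kernel (Q \<Gamma>') (crossing_group) crossing_map"
proof (intro equalityI subsetI)
  fix Y assume "Y \<in> Q_inclusion \<Gamma>' ` carrier (Q \<Gamma>)"
  then obtain c where c: "c \<in> relative_cycles \<Gamma>" "Y = Q_class \<Gamma>' c"
    by (auto simp: carrier_Q Q_inclusion_Q_class)
  hence "c \<in> relative_cycles \<Gamma>'" "crossing c = 0"
    using old_in_new(5) by (auto intro!: crossing_old simp: relative_cycles_def)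
  thus "Y \<in> kernel (Q \<Gamma>') (crossing_group) crossing_map"
    by (simp add: kernel_def c(2) new.Q_class_closed crossing_map_Q_class)
next
  fix Y assume "Y \<in> kernel (Q \<Gamma>') (crossing_group) crossing_map"
  then obtain c where c: "c \<in> relative_cycles \<Gamma>'" "Y = Q_class \<Gamma>' c" "crossing_map Y = 0"
    by (auto simp: kernel_def new.carrier_Q)
  hence "crossing c = 0" by (simp add: crossing_map_Q_class)
  then obtain c\<^sub>0 where c0: "c\<^sub>0 \<in> relative_cycles \<Gamma>" "c - c\<^sub>0 \<in> null_cycles \<Gamma>'"
    using image_chains[OF c(1)] by blast
  have "c\<^sub>0 \<in> relative_cycles \<Gamma>'" using c0(1) old_in_new(5) by blast
  hence "Y = Q_class \<Gamma>' c\<^sub>0" using c0(2) new.Q_class_eq_iff[OF c(1)] c(2) by blast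
  hence "Y = Q_inclusion \<Gamma>' (Q_class \<Gamma> c\<^sub>0)" by (simp add: Q_inclusion_Q_class[OF c0(1)])
  thus "Y \<in> Q_inclusion \<Gamma>' ` carrier (Q \<Gamma>)" using Q_class_closed[OF c0(1)] by blast
qed

lemma crossing_map_surjective:
  assumes "b \<in> vertices \<Gamma>" "card (neighbours \<Gamma> b) \<ge> 3"
  shows "crossing_map ` carrier (Q \<Gamma>') = carrier (crossing_group)"
proof
  show "crossing_map ` carrier (Q \<Gamma>') \<subseteq> carrier (crossing_group)"
    using group_hom.hom_closed[OF crossing_map_hom] by blast
  show "carrier (crossing_group) \<subseteq> crossing_map ` carrier (Q \<Gamma>')"
  proof
    fix m assume "m \<in> carrier (crossing_group)"
    then obtain c where "c \<in> relative_cycles \<Gamma>'" "crossing c = m"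
      using crossing_surjective[OF assms, of m] by auto
    thus "m \<in> crossing_map ` carrier (Q \<Gamma>')"
      using new.Q_class_closed crossing_map_Q_class by (metis imageI)
  qed
qed

end

theorem theorem14:
  fixes \<Gamma> :: "'a set set" and u v :: 'a
  assumes "simplicial_graph \<Gamma>"
    and "connected (realization \<Gamma>)"
    and "\<not> realization \<Gamma> homeomorphic {0..1::real}"
    and "\<not> realization \<Gamma> homeomorphic sphere (0::complex) 1"
    and "{u} \<in> \<Gamma>" and "{v} \<in> \<Gamma>" and "u \<noteq> v" and "{u, v} \<notin> \<Gamma>"
  defines "\<Gamma>' \<equiv> add_edge \<Gamma> u v"
    and "G \<equiv> free_Abelian_group {..<2 * b0 (remove_stars \<Gamma> u v) - 2}"
  shows "\<exists>\<phi>.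
      exact_at (singleton_group ()) (\<lambda>_. \<one>\<^bsub>Q \<Gamma>\<^esub>) (linking_subgroup \<Gamma> v u) id (Q \<Gamma>) \<and>
      exact_at (linking_subgroup \<Gamma> v u) id (Q \<Gamma>) (Q_inclusion \<Gamma>') (Q \<Gamma>') \<and>
      exact_at (Q \<Gamma>) (Q_inclusion \<Gamma>') (Q \<Gamma>') \<phi> G \<and>
      exact_at (Q \<Gamma>') \<phi> G (\<lambda>_. ()) (singleton_group ())"
proof -
  interpret edge_addition \<Gamma> u v
    using assms(1,5-8) reachable_if_connected[OF assms(1,2)]
    by unfold_locales
  have uv: "u \<in> vertices \<Gamma>" "v \<in> vertices \<Gamma>" using assms(5,6) by (simp_all add: vertices_def)
  obtain b where b: "b \<in> vertices \<Gamma>" "card (neighbours \<Gamma> b) \<ge> 3"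
    by (rule exists_branch_vertex[OF assms(1-4) uv assms(7)])
  interpret l: group_hom "linking_subgroup \<Gamma> v u" "Q \<Gamma>" id by (rule linking_subgroup_group_hom)
  interpret i: group_hom "Q \<Gamma>" "Q \<Gamma>'" "Q_inclusion \<Gamma>'" unfolding \<Gamma>'_def by (rule Q_inclusion_hom)
  interpret c: group_hom "Q \<Gamma>'" G crossing_map unfolding \<Gamma>'_def G_def by (rule crossing_map_hom)
  have one: "\<one>\<^bsub>linking_subgroup \<Gamma> v u\<^esub> = \<one>\<^bsub>Q \<Gamma>\<^esub>" by (simp add: linking_subgroup_def)
  have trivial: "group (singleton_group ())" by simp
  have first: "group_hom (singleton_group ()) (linking_subgroup \<Gamma> v u) (\<lambda>_. \<one>\<^bsub>Q \<Gamma>\<^esub>)"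
    using l.G.one_closed trivial l.G.is_group l.G.l_one[OF l.G.one_closed]
    by (auto simp: group_hom_def group_hom_axioms_def hom_def one)
  have last: "group_hom G (singleton_group ()) (\<lambda>_. ())"
    using trivial c.H.is_group by (auto simp: group_hom_def group_hom_axioms_def hom_def singleton_group_def)
  have "exact_at (singleton_group ()) (\<lambda>_. \<one>\<^bsub>Q \<Gamma>\<^esub>) (linking_subgroup \<Gamma> v u) id (Q \<Gamma>)"
    unfolding exact_at_def using first l.group_hom_axioms l.G.one_closed
    by (auto simp: kernel_def singleton_group_def one)
  moreover have "exact_at (linking_subgroup \<Gamma> v u) id (Q \<Gamma>) (Q_inclusion \<Gamma>') (Q \<Gamma>')"
    unfolding exact_at_def using l.group_hom_axioms i.group_hom_axioms carrier_linking_subgroup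
    by (simp add: \<Gamma>'_def)
  moreover have "exact_at (Q \<Gamma>) (Q_inclusion \<Gamma>') (Q \<Gamma>') crossing_map G"
    unfolding exact_at_def using i.group_hom_axioms c.group_hom_axioms image_Q_inclusion
    by (simp add: \<Gamma>'_def G_def)
  moreover have "kernel H (singleton_group ()) (\<lambda>_. ()) = carrier H" for H :: "(nat \<Rightarrow>\<^sub>0 int) monoid"
    by (auto simp: kernel_def singleton_group_def)
  hence "exact_at (Q \<Gamma>') crossing_map G (\<lambda>_. ()) (singleton_group ())"
    unfolding exact_at_def using c.group_hom_axioms last crossing_map_surjective[OF b]
    by (simp add: \<Gamma>'_def G_def)
  ultimately show ?thesis by blast
qed

end
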